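(* Let $d\geq 1$ and $k=\lfloor d/2\rfloor+1$. Let $\mathrm M$ and $\mathrm N$ be $d$-dimensional cubical homology manifolds, each of which is (isomorphic to) a subcomplex of some cube $I^n$. If $\mathrm{Skel}_k\mathrm M\cong\mathrm{Skel}_k\mathrm N$, then $\mathrm M\cong\mathrm N$. (That is, a $d$-dimensional cubical homology manifold embeddable in a cube is determined by its $(\lfloor d/2\rfloor+1)$-skeleton.)
   Context: A cubical complex consists of a finite vertex set $V$ and a collection of nonempty subsets of $V$ (faces) such that: every singleton is a face; for each face $F$ the poset of faces contained in $F$ is isomorphic to the poset of nonempty faces of a cube (of dimension $\dim F$); and the intersection of two faces is empty or a face. The dimension of a complex is the maximal face dimension; $\mathrm{Skel}_k$ is the subcomplex of faces of dimension $\leq k$. $I^n$ is the $n$-cube as a cubical complex (vertices $\{0,1\}^n$, faces indexed by $\{0,1,*\}^n$). Isomorphism of cubical complexes: a vertex bijection mapping faces onto faces in both directions. A $d$-dimensional cubical complex $\mathrm M$ is a cubical homology manifold if for every $p$ in its geometric realisation $|\mathrm M|$, $H_i(|\mathrm M|,|\mathrm M|\setminus p;\mathbb Z/2)$ is $\mathbb Z/2$ for $i=d$ and $0$ otherwise. *)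

theory Defs
  imports "HOL-Analysis.Analysis" "HOL-Homology.Homology"
begin

text \<open>The standard n-cube I^n: vertices are 0/1-vectors, encoded as functions
  nat => bool that vanish from coordinate n on; faces are indexed by words in
  {0,1,*}^n, encoded as nat => bool option (None = *).\<close>

definition cube_verts :: "nat \<Rightarrow> (nat \<Rightarrow> bool) set" where
  "cube_verts n = {x. \<forall>i\<ge>n. \<not> x i}"

definition cube_face :: "nat \<Rightarrow> (nat \<Rightarrow> bool option) \<Rightarrow> (nat \<Rightarrow> bool) set" where
  "cube_face n w = {x \<in> cube_verts n. \<forall>i<n. \<forall>b. w i = Some b \<longrightarrow> x i = b}"

definition cube_faces :: "nat \<Rightarrow> (nat \<Rightarrow> bool) set set" where
  "cube_faces n = range (cube_face n)"

definition face_poset_iso :: "'a set set \<Rightarrow> 'a set \<Rightarrow> nat \<Rightarrow> bool" where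
  "face_poset_iso F X m \<longleftrightarrow>
     (\<exists>h. bij_betw h {G \<in> F. G \<subseteq> X} (cube_faces m) \<and>
          (\<forall>G\<in>{G \<in> F. G \<subseteq> X}. \<forall>G'\<in>{G \<in> F. G \<subseteq> X}. G \<subseteq> G' \<longleftrightarrow> h G \<subseteq> h G'))"

definition cubical_complex :: "'a set \<Rightarrow> 'a set set \<Rightarrow> bool" where
  "cubical_complex V F \<longleftrightarrow>
     finite V \<and>
     (\<forall>X\<in>F. X \<noteq> {} \<and> X \<subseteq> V) \<and>
     (\<forall>v\<in>V. {v} \<in> F) \<and>
     (\<forall>X\<in>F. \<exists>m. face_poset_iso F X m) \<and>
     (\<forall>X\<in>F. \<forall>Y\<in>F. X \<inter> Y = {} \<or> X \<inter> Y \<in> F)"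

definition face_dim :: "'a set set \<Rightarrow> 'a set \<Rightarrow> nat" where
  "face_dim F X = (THE m. face_poset_iso F X m)"

definition complex_dim :: "'a set set \<Rightarrow> nat" where
  "complex_dim F = Max (face_dim F ` F)"

definition skel_faces :: "nat \<Rightarrow> 'a set set \<Rightarrow> 'a set set" where
  "skel_faces k F = {X \<in> F. face_dim F X \<le> k}"

definition cc_iso :: "('a \<Rightarrow> 'b) \<Rightarrow> 'a set \<Rightarrow> 'a set set \<Rightarrow> 'b set \<Rightarrow> 'b set set \<Rightarrow> bool" where
  "cc_iso f V F V' F' \<longleftrightarrow>
     bij_betw f V V' \<and> (\<forall>X\<in>F. f ` X \<in> F') \<and> (\<forall>Y\<in>F'. \<exists>X\<in>F. f ` X = Y)"

definition cc_isomorphic :: "'a set \<Rightarrow> 'a set set \<Rightarrow> 'b set \<Rightarrow> 'b set set \<Rightarrow> bool" where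
  "cc_isomorphic V F V' F' \<longleftrightarrow> (\<exists>f. cc_iso f V F V' F')"

definition cube_subcomplex :: "nat \<Rightarrow> (nat \<Rightarrow> bool) set \<Rightarrow> (nat \<Rightarrow> bool) set set \<Rightarrow> bool" where
  "cube_subcomplex n V F \<longleftrightarrow>
     F \<subseteq> cube_faces n \<and> (\<forall>X\<in>F. \<forall>Y\<in>cube_faces n. Y \<subseteq> X \<longrightarrow> Y \<in> F) \<and> V = \<Union>F"

definition cube_embedding :: "nat \<Rightarrow> ('a \<Rightarrow> nat \<Rightarrow> bool) \<Rightarrow> 'a set \<Rightarrow> 'a set set \<Rightarrow> bool" where
  "cube_embedding n f V F \<longleftrightarrow>
     cube_subcomplex n (f ` V) ((`) f ` F) \<and> cc_iso f V F (f ` V) ((`) f ` F)"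

definition cube_embeddable :: "'a set \<Rightarrow> 'a set set \<Rightarrow> bool" where
  "cube_embeddable V F \<longleftrightarrow> (\<exists>n f. cube_embedding n f V F)"

text \<open>A face X of I^n (as a vertex set) is realised as the box in [0,1]^n whose
  coordinates are fixed where all vertices of X agree and free otherwise;
  [0,1]^n is viewed inside nat => real (coordinates >= n are 0) with the
  product topology (which is the Euclidean one on this subspace).\<close>
definition face_box :: "(nat \<Rightarrow> bool) set \<Rightarrow> (nat \<Rightarrow> real) set" where
  "face_box X = {y. \<forall>i. 0 \<le> y i \<and> y i \<le> 1 \<and>
                       (\<forall>b. (\<forall>x\<in>X. x i = b) \<longrightarrow> y i = (if b then 1 else 0))}"

definition geom_real :: "(nat \<Rightarrow> bool) set set \<Rightarrow> (nat \<Rightarrow> real) set" where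
  "geom_real F = (\<Union>X\<in>F. face_box X)"

text \<open>A mod-2 singular p-chain is a finite set of singular p-simplices.\<close>
definition chain2 :: "nat \<Rightarrow> 'a topology \<Rightarrow> ((nat \<Rightarrow> real) \<Rightarrow> 'a) set \<Rightarrow> bool" where
  "chain2 p X c \<longleftrightarrow> finite c \<and> (\<forall>f\<in>c. singular_simplex p X f)"

definition bd2 :: "nat \<Rightarrow> ((nat \<Rightarrow> real) \<Rightarrow> 'a) set \<Rightarrow> ((nat \<Rightarrow> real) \<Rightarrow> 'a) set" where
  "bd2 p c = (if p = 0 then {} else
      {g. odd (card {(f, k). f \<in> c \<and> k \<le> p \<and> singular_face p k f = g})})"

definition symdiff :: "'x set \<Rightarrow> 'x set \<Rightarrow> 'x set" where
  "symdiff A B = (A - B) \<union> (B - A)"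

definition rcycles2 :: "nat \<Rightarrow> 'a topology \<Rightarrow> 'a set \<Rightarrow> ((nat \<Rightarrow> real) \<Rightarrow> 'a) set set" where
  "rcycles2 p X S = {c. chain2 p X c \<and> chain2 (p - 1) (subtopology X S) (bd2 p c)}"

definition rhomologous2 :: "nat \<Rightarrow> 'a topology \<Rightarrow> 'a set \<Rightarrow>
     ((nat \<Rightarrow> real) \<Rightarrow> 'a) set \<Rightarrow> ((nat \<Rightarrow> real) \<Rightarrow> 'a) set \<Rightarrow> bool" where
  "rhomologous2 p X S c c' \<longleftrightarrow>
     (\<exists>e a. chain2 (Suc p) X e \<and> chain2 p (subtopology X S) a \<and>
            symdiff c c' = symdiff (bd2 (Suc p) e) a)"

definition rhom2 :: "nat \<Rightarrow> 'a topology \<Rightarrow> 'a set \<Rightarrow> ((nat \<Rightarrow> real) \<Rightarrow> 'a) set set set" where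
  "rhom2 p X S = (\<lambda>c. {c' \<in> rcycles2 p X S. rhomologous2 p X S c c'}) ` rcycles2 p X S"

text \<open>Z/2-homology d-manifold condition on a subspace T: for each point x,
  H_i(T, T - x; Z/2) is Z/2 (two classes) for i = d and 0 (one class) otherwise.\<close>
definition Z2_homology_manifold :: "nat \<Rightarrow> (nat \<Rightarrow> real) set \<Rightarrow> bool" where
  "Z2_homology_manifold d T \<longleftrightarrow>
     (\<forall>x\<in>T. \<forall>i. card (rhom2 i (subtopology (powertop_real UNIV) T) (T - {x}))
                 = (if i = d then 2 else 1))"

text \<open>A d-dimensional cubical homology manifold (for complexes embeddable in a
  cube, whose realisation is that of any cube model).\<close>
definition cubical_homology_manifold :: "nat \<Rightarrow> 'a set \<Rightarrow> 'a set set \<Rightarrow> bool" where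
  "cubical_homology_manifold d V F \<longleftrightarrow>
     cubical_complex V F \<and> complex_dim F = d \<and>
     (\<forall>n f. cube_embedding n f V F \<longrightarrow> Z2_homology_manifold d (geom_real ((`) f ` F)))"

end

theory Submission
  imports Defs "HOL-Library.Z2"
begin

text \<open>The link of a vertex in a cubical homology d-manifold is a simplicial Z/2-homology sphere of
  dimension d - 1, and such a sphere is determined by its skeleton of dimension d div 2: let S be a
  simplex of the sphere K, while only the boundary of S lies in another sphere K'. The complement of
  S in K is acyclic, whereas by Alexander duality the complement of S in K' has a nonzero class,
  carried by the link of a facet of S. This class lives in a dimension so low that the common
  skeleton of K and K' decides whether it bounds. Thus a face of M of the next dimension yields, at
  each of its vertices, a face of N containing the images of all its other vertices except the
  antipode, and these faces of N coincide.

  Of the comparison between singular and combinatorial local homology only two parts are needed. A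
  combinatorial cycle that bounds a singular chain also bounds combinatorially: subdivide the
  singular chain, label points by the coordinate directions in which they leave the given point, and
  count label sets as in Sperner's lemma. And the local homology vanishes at a boundary point, where
  small simplices can be coned off.\<close>


text \<open>The number d div 2 + 1 comes from a count of degrees. In a vertex link a face of
  dimension J is a simplex with J elements. If the boundary of such a simplex S lies in a sphere of
  rank d and S does not, the dual class is carried by simplices with d + 1 - J elements, and a chain
  filling it by simplices with d + 2 - J elements. The common skeleton sees the filling when d + 2 -
  J < J, and J = d div 2 + 2 is the least such number. Duality is proved on mod 2 chains by
  induction over the vertices of S: removing a vertex passes to its link, which is again a sphere.
  Two parts of the comparison with singular homology suffice for this reason: injectivity of the map
  from link cycles to local homology turns vanishing local homology into exactness, and a group with
  two elements into uniqueness of the top cycle. That a top cycle exists comes instead from every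
  ridge lying in exactly two facets: exactness excludes none, uniqueness excludes three, and only a
  ridge in a single facet, a boundary point, calls for a computation of singular homology.\<close>

declare add_bit_eq_xor [simp del] mult_bit_eq_and [simp del]

section \<open>Mod 2 chains on set families and combinatorial homology spheres\<close>

definition chain_on :: "'v set set \<Rightarrow> nat \<Rightarrow> ('v set \<Rightarrow> bit) \<Rightarrow> bool" where
  "chain_on L i c \<longleftrightarrow> (\<forall>T. c T \<noteq> 0 \<longrightarrow> T \<in> L \<and> card T = i)"

text \<open>The coefficient of G in the boundary, collected from the simplices that have G as a
  facet. At G = {} it is the augmentation, so the complex is the reduced one.\<close>

definition bd :: "'v set \<Rightarrow> ('v set \<Rightarrow> bit) \<Rightarrow> 'v set \<Rightarrow> bit" where
  "bd N c G = (\<Sum>a\<in>N - G. c (insert a G))"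

definition link :: "'v set set \<Rightarrow> 'v set \<Rightarrow> 'v set set" where
  "link L S = {T. T \<inter> S = {} \<and> T \<union> S \<in> L}"

text \<open>All simplices meeting S are removed, not only those containing S. What is left is the
  full subcomplex on the other vertices, a combinatorial model for the complement of a closed cell
  S, or of its boundary if S itself is missing.\<close>

definition del :: "'v set set \<Rightarrow> 'v set \<Rightarrow> 'v set set" where
  "del L S = {T \<in> L. T \<inter> S = {}}"

text \<open>Chains are graded by cardinality, one more than the dimension, so a sphere of rank d has
  dimension d - 1 and the homology in question is reduced homology.\<close>

definition exact_at :: "'v set \<Rightarrow> 'v set set \<Rightarrow> nat \<Rightarrow> bool" where
  "exact_at N L i \<longleftrightarrow>
     (\<forall>c. chain_on L i c \<and> (\<forall>G. bd N c G = 0) \<longrightarrow> (\<exists>y. chain_on L (Suc i) y \<and> bd N y = c))"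

text \<open>The conditions range over all links, so the class is closed under links. The next to
  last clause only says that two nonzero top cycles coincide; that one exists follows from purity
  and the last clause, by which the sum of all facets is a cycle.\<close>

definition homology_sphere :: "'v set \<Rightarrow> 'v set set \<Rightarrow> nat \<Rightarrow> bool" where
  "homology_sphere N L d \<longleftrightarrow>
     finite N \<and> L \<subseteq> Pow N \<and> {} \<in> L \<and> (\<forall>T\<in>L. \<forall>S. S \<subseteq> T \<longrightarrow> S \<in> L) \<and> (\<forall>T\<in>L. card T \<le> d) \<and>
     (\<forall>S\<in>L. \<forall>i. i + card S \<noteq> d \<longrightarrow> exact_at N (link L S) i) \<and>
     (\<forall>S\<in>L. \<forall>i c c'. i + card S = d \<longrightarrow> chain_on (link L S) i c \<longrightarrow> chain_on (link L S) i c' \<longrightarrow>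
        (\<forall>G. bd N c G = 0) \<longrightarrow> (\<forall>G. bd N c' G = 0) \<longrightarrow> (\<exists>T. c T \<noteq> 0) \<longrightarrow> (\<exists>T. c' T \<noteq> 0) \<longrightarrow> c = c') \<and>
     (\<forall>S\<in>L. Suc (card S) = d \<longrightarrow> card {a \<in> N - S. insert a S \<in> L} = 2)"

text \<open>Every chain U splits as \<open>rest a U\<close> plus the cone with apex a over
  \<open>slice a U\<close>; for a chain on L the slice is a chain on the link of a.\<close>

definition slice :: "'v \<Rightarrow> ('v set \<Rightarrow> bit) \<Rightarrow> 'v set \<Rightarrow> bit" where
  "slice a U T = (if a \<in> T then 0 else U (insert a T))"

definition rest :: "'v \<Rightarrow> ('v set \<Rightarrow> bit) \<Rightarrow> 'v set \<Rightarrow> bit" where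
  "rest a U T = (if a \<in> T then 0 else U T)"

definition join :: "'v \<Rightarrow> ('v set \<Rightarrow> bit) \<Rightarrow> 'v set \<Rightarrow> bit" where
  "join a Z T = (if a \<in> T then Z (T - {a}) else 0)"

section \<open>Arithmetic mod 2 and the boundary operator\<close>

lemma bit_add_self [simp]: "(x::bit) + x = 0"
  by (cases x) auto

lemma bit_add_self_left [simp]: "(x::bit) + (x + y) = y"
  by (simp flip: add.assoc)

lemma bit_add_eq_0_iff: "(x::bit) + y = 0 \<longleftrightarrow> x = y"
  by (cases x; cases y) auto

lemma bd_add: "bd N (\<lambda>T. c T + c' T) G = bd N c G + bd N c' G"
  by (simp add: bd_def sum.distrib)

lemma chain_on_add: "chain_on L i c \<Longrightarrow> chain_on L i c' \<Longrightarrow> chain_on L i (\<lambda>T. c T + c' T)"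
  unfolding chain_on_def by (metis add.right_neutral)

lemma bd_0 [simp]: "bd N (\<lambda>T. 0) G = 0"
  by (simp add: bd_def)

lemma chain_on_0 [simp]: "chain_on L i (\<lambda>T. 0)"
  by (simp add: chain_on_def)

text \<open>Both sides count the simplices that exceed \<open>insert a G\<close> by one vertex; mod
  2 there is no sign, so slicing commutes with the boundary.\<close>

lemma bd_slice:
  assumes "finite N" "a \<in> N" "a \<notin> G" shows "bd N (slice a U) G = bd N U (insert a G)"
proof -
  have "bd N (slice a U) G = (\<Sum>b\<in>N - G. if a = b then 0 else U (insert a (insert b G)))"
    unfolding bd_def slice_def using assms by (intro sum.cong) auto
  also have "\<dots> = (\<Sum>b\<in>N - insert a G. U (insert b (insert a G)))"
    by (rule sum.mono_neutral_cong_right) (use assms in \<open>auto simp: insert_commute\<close>)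
  finally show ?thesis by (simp add: bd_def)
qed

lemma bd_slice_in: "a \<in> G \<Longrightarrow> bd N (slice a U) G = 0"
  unfolding bd_def slice_def by (intro sum.neutral) auto

lemma bd_rest:
  assumes "a \<in> N" "a \<notin> G" "finite N" shows "bd N U G = slice a U G + bd N (rest a U) G"
proof -
  have "N - G = insert a (N - insert a G)"
    using assms by auto
  then have "bd N U G = U (insert a G) + (\<Sum>b\<in>N - insert a G. U (insert b G))"
    unfolding bd_def using assms by (metis DiffE finite_Diff insertCI sum.insert)
  also have "(\<Sum>b\<in>N - insert a G. U (insert b G)) = bd N (rest a U) G"
    unfolding bd_def rest_def by (rule sum.mono_neutral_cong_left) (use assms in auto)
  finally show ?thesis using assms by (simp add: slice_def)
qed

lemma bd_rest_in: "a \<in> G \<Longrightarrow> bd N (rest a U) G = 0"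
  unfolding bd_def rest_def by (intro sum.neutral) auto

lemma homology_sphereD:
  assumes "homology_sphere N L d"
  shows "finite N" "T \<in> L \<Longrightarrow> T \<subseteq> N" "{} \<in> L" "T \<in> L \<Longrightarrow> S \<subseteq> T \<Longrightarrow> S \<in> L"
    "T \<in> L \<Longrightarrow> card T \<le> d" "T \<in> L \<Longrightarrow> finite T"
    "S \<in> L \<Longrightarrow> i + card S \<noteq> d \<Longrightarrow> exact_at N (link L S) i"
    "S \<in> L \<Longrightarrow> i + card S = d \<Longrightarrow> chain_on (link L S) i c \<Longrightarrow> chain_on (link L S) i c' \<Longrightarrow>
        (\<And>G. bd N c G = 0) \<Longrightarrow> (\<And>G. bd N c' G = 0) \<Longrightarrow> c T \<noteq> 0 \<Longrightarrow> c' T' \<noteq> 0 \<Longrightarrow> c = c'"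
    "S \<in> L \<Longrightarrow> Suc (card S) = d \<Longrightarrow> card {a \<in> N - S. insert a S \<in> L} = 2"
proof -
  note * = assms[unfolded homology_sphere_def]
  show fin: "finite N" using * by (rule conjunct1)
  have "L \<subseteq> Pow N" using * by (elim conjE)
  then show sub: "T \<in> L \<Longrightarrow> T \<subseteq> N" for T by blast
  then show "T \<in> L \<Longrightarrow> finite T" using fin finite_subset by blast
  show "{} \<in> L" using * by (elim conjE)
  have "\<forall>T\<in>L. \<forall>S. S \<subseteq> T \<longrightarrow> S \<in> L" using * by (elim conjE)
  then show "T \<in> L \<Longrightarrow> S \<subseteq> T \<Longrightarrow> S \<in> L" by blast
  have "\<forall>T\<in>L. card T \<le> d" using * by (elim conjE)
  then show "T \<in> L \<Longrightarrow> card T \<le> d" by blast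
  have "\<forall>S\<in>L. \<forall>i. i + card S \<noteq> d \<longrightarrow> exact_at N (link L S) i" using * by (elim conjE)
  then show "S \<in> L \<Longrightarrow> i + card S \<noteq> d \<Longrightarrow> exact_at N (link L S) i" by blast
  have "\<forall>S\<in>L. Suc (card S) = d \<longrightarrow> card {a \<in> N - S. insert a S \<in> L} = 2" using * by (elim conjE)
  then show "S \<in> L \<Longrightarrow> Suc (card S) = d \<Longrightarrow> card {a \<in> N - S. insert a S \<in> L} = 2" by blast
  show "c = c'" if "S \<in> L" "i + card S = d" "chain_on (link L S) i c" "chain_on (link L S) i c'"
     "\<And>G. bd N c G = 0" "\<And>G. bd N c' G = 0" "c T \<noteq> 0" "c' T' \<noteq> 0"
  proof -
    have "\<forall>S\<in>L. \<forall>i c c'. i + card S = d \<longrightarrow> chain_on (link L S) i c \<longrightarrow> chain_on (link L S) i c' \<longrightarrow>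
        (\<forall>G. bd N c G = 0) \<longrightarrow> (\<forall>G. bd N c' G = 0) \<longrightarrow> (\<exists>T. c T \<noteq> 0) \<longrightarrow> (\<exists>T. c' T \<noteq> 0) \<longrightarrow> c = c'"
      using * by (elim conjE)
    from this[rule_format, OF that(1,2,3,4)] show ?thesis using that(5-8) by blast
  qed
qed

lemma link_empty [simp]: "link L {} = L"
  by (simp add: link_def)

lemma link_link: "link (link L {a}) S = (if a \<in> S then {} else link L (insert a S))"
  by (auto simp: link_def)

text \<open>Links inside \<open>link L {a}\<close> are links of larger simplices in L
  (\<open>link_link\<close>), so each clause is an instance of the same clause for
  \<open>insert a S\<close>.\<close>

lemma homology_sphere_link:
  assumes hs: "homology_sphere N L d" and a: "{a} \<in> L"
  shows "homology_sphere N (link L {a}) (d - 1)"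
proof -
  note D = homology_sphereD[OF hs]
  have d: "d \<ge> 1" using D(5)[OF a] by simp
  have fin: "finite S" if "S \<in> link L {a}" for S
    using that D(6)[of "S \<union> {a}"] by (simp add: link_def)
  have ins: "insert a S \<in> L" "a \<notin> S" if "S \<in> link L {a}" for S
    using that by (auto simp: link_def)
  have card: "card (insert a S) = Suc (card S)" if "S \<in> link L {a}" for S
    using ins[OF that] fin[OF that] by simp
  have ll: "link (link L {a}) S = link L (insert a S)" if "S \<in> link L {a}" for S
    using ins[OF that] by (simp add: link_link)
  have down: "S \<in> link L {a}" if "T \<in> link L {a}" "S \<subseteq> T" for S T
    using that D(4)[of "T \<union> {a}" "S \<union> {a}"] by (auto simp: link_def)
  have sub: "T \<subseteq> N" if "T \<in> link L {a}" for T
    using D(2)[OF ins(1)[OF that]] by auto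
  have two: "card {b \<in> N - S. insert b S \<in> link L {a}} = 2"
    if S: "S \<in> link L {a}" "Suc (card S) = d - 1" for S
  proof -
    have "{b \<in> N - S. insert b S \<in> link L {a}} = {b \<in> N - insert a S. insert b (insert a S) \<in> L}"
      using ins[OF S(1)] by (auto simp: link_def insert_commute)
    then show ?thesis
      using D(9)[OF ins(1)[OF S(1)]] card[OF S(1)] S(2) by simp
  qed
  have one: "{} \<in> link L {a}" using a by (simp add: link_def)
  have bound: "card T \<le> d - 1" if "T \<in> link L {a}" for T
    using D(5)[OF ins(1)[OF that]] card[OF that] by simp
  have ex: "exact_at N (link (link L {a}) S) i" if "S \<in> link L {a}" "i + card S \<noteq> d - 1" for S i
    unfolding ll[OF that(1)] by (rule D(7)) (use ins[OF that(1)] card[OF that(1)] that d in auto)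
  have un: "c = c'" if S: "S \<in> link L {a}" "i + card S = d - 1"
    and c: "chain_on (link (link L {a}) S) i c" "chain_on (link (link L {a}) S) i c'"
     "\<forall>G. bd N c G = 0" "\<forall>G. bd N c' G = 0" "\<exists>T. c T \<noteq> 0" "\<exists>T. c' T \<noteq> 0" for S i c c'
  proof -
    from c(5,6) obtain T T' where "c T \<noteq> 0" "c' T' \<noteq> 0" by blast
    then show ?thesis
      using D(8)[OF ins(1)[OF S(1)], of i c c' T T'] c ll[OF S(1)] card[OF S(1)] S(2) d by simp
  qed
  show ?thesis
    unfolding homology_sphere_def
  proof (intro conjI ballI allI impI)
    show "link L {a} \<subseteq> Pow N" using sub by blast
  qed (fact D(1) one | rule down bound ex un two; assumption)+
qed

section \<open>Fundamental cycles of links\<close>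

definition facet_chain :: "'v set set \<Rightarrow> nat \<Rightarrow> 'v set \<Rightarrow> 'v set \<Rightarrow> bit" where
  "facet_chain L d S T = of_bool (T \<inter> S = {} \<and> T \<union> S \<in> L \<and> card (T \<union> S) = d)"

lemma chain_on_facet_chain:
  assumes "homology_sphere N L d"
  shows "chain_on (link L S) (d - card S) (facet_chain L d S)"
proof -
  have "card T = d - card S" if "T \<inter> S = {}" "T \<union> S \<in> L" "card (T \<union> S) = d" for T
  proof -
    have "finite (T \<union> S)" using homology_sphereD(6)[OF assms that(2)] .
    then show ?thesis using that by (simp add: card_Un_disjoint)
  qed
  then show ?thesis by (auto simp: chain_on_def facet_chain_def link_def)
qed

text \<open>A ridge \<open>G \<union> S\<close> lies in exactly two facets, so its coefficient is 1
  + 1 = 0.\<close>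

lemma bd_facet_chain:
  assumes hs: "homology_sphere N L d"
  shows "bd N (facet_chain L d S) G = 0"
proof (cases "G \<inter> S = {} \<and> G \<union> S \<in> L \<and> Suc (card (G \<union> S)) = d")
  case True
  note D = homology_sphereD[OF hs]
  have fin: "finite (G \<union> S)" using D(6) True by blast
  let ?B = "{a \<in> N - (G \<union> S). insert a (G \<union> S) \<in> L}"
  have two: "card ?B = 2" using D(9) True by blast
  have "bd N (facet_chain L d S) G = (\<Sum>a\<in>N - G. of_bool (a \<in> ?B))"
    unfolding bd_def facet_chain_def using True fin by (intro sum.cong) (auto simp: card_insert_if)
  also have "\<dots> = (\<Sum>a\<in>?B. 1)"
    using D(1) by (intro sum.mono_neutral_cong_right) auto
  also have "\<dots> = of_nat (card ?B)" by simp
  finally show ?thesis using two by simp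
next
  case False
  note D = homology_sphereD[OF hs]
  have "facet_chain L d S (insert a G) = 0" if "a \<in> N - G" for a
  proof (rule ccontr)
    assume "facet_chain L d S (insert a G) \<noteq> 0"
    then have *: "insert a G \<inter> S = {}" "insert a G \<union> S \<in> L" "card (insert a G \<union> S) = d"
      by (auto simp: facet_chain_def)
    then have "G \<union> S \<in> L" "finite (insert a G \<union> S)" using D(4)[OF *(2), of "G \<union> S"] D(6)[OF *(2)] by auto
    moreover have "a \<notin> G \<union> S" using * that by auto
    ultimately show False using False * by auto
  qed
  then show ?thesis by (simp add: bd_def)
qed

text \<open>The Mayer-Vietoris step. A chain U bounding c may run through the vertex a, while c does
  not; so the part of U at a is a cone over a cycle of the link of a. If this cycle bounds W in the
  link, the cone can be traded for W, which removes a from U without changing the boundary.\<close>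

lemma mv_slice:
  assumes "finite N" "a \<in> N" and U: "chain_on (del L S) (Suc i) U" and bU: "bd N U = c"
    and c: "chain_on (del L (insert a S)) i c" and fin: "\<And>T. T \<in> L \<Longrightarrow> finite T"
  shows "chain_on (del (link L {a}) S) i (slice a U)" "bd N (slice a U) G = 0"
    "\<And>W. chain_on (del (link L {a}) S) (Suc i) W \<Longrightarrow> bd N W = slice a U \<Longrightarrow> a \<notin> S \<Longrightarrow>
       (\<And>T S. T \<in> L \<Longrightarrow> S \<subseteq> T \<Longrightarrow> S \<in> L) \<Longrightarrow>
       chain_on (del L (insert a S)) (Suc i) (\<lambda>T. rest a U T + W T) \<and> bd N (\<lambda>T. rest a U T + W T) = c"
proof -
  show "chain_on (del (link L {a}) S) i (slice a U)"
    unfolding chain_on_def slice_def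
  proof (intro allI impI)
    fix T assume "(if a \<in> T then 0 else U (insert a T)) \<noteq> 0"
    then have "a \<notin> T" "insert a T \<in> del L S" "card (insert a T) = Suc i"
      using U by (auto simp: chain_on_def split: if_splits)
    then show "T \<in> del (link L {a}) S \<and> card T = i"
      using fin[of "insert a T"] by (auto simp: del_def link_def)
  qed
  show "bd N (slice a U) G = 0"
  proof (cases "a \<in> G")
    case False
    then have "bd N (slice a U) G = c (insert a G)" using bd_slice[OF assms(1,2)] bU by metis
    also have "\<dots> = 0" using c by (auto simp: chain_on_def del_def)
    finally show ?thesis .
  qed (rule bd_slice_in)
  fix W assume W: "chain_on (del (link L {a}) S) (Suc i) W" "bd N W = slice a U" "a \<notin> S"
    and down: "\<And>T S. T \<in> L \<Longrightarrow> S \<subseteq> T \<Longrightarrow> S \<in> L"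
  have "chain_on (del L (insert a S)) (Suc i) W"
    unfolding chain_on_def
  proof (intro allI impI)
    fix T assume "W T \<noteq> 0"
    then have "T \<in> del (link L {a}) S \<and> card T = Suc i" using W by (simp add: chain_on_def)
    then show "T \<in> del L (insert a S) \<and> card T = Suc i"
      using down[of "insert a T" T] by (auto simp: del_def link_def)
  qed
  moreover have "chain_on (del L (insert a S)) (Suc i) (rest a U)"
    using U by (auto simp: chain_on_def del_def rest_def)
  ultimately have 1: "chain_on (del L (insert a S)) (Suc i) (\<lambda>T. rest a U T + W T)"
    using chain_on_add by blast
  have "bd N (rest a U) G + bd N W G = c G" for G
  proof (cases "a \<in> G")
    case True
    then have "bd N (rest a U) G = 0" by (rule bd_rest_in)
    moreover have "bd N W G = 0" using W True by (simp add: slice_def)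
    moreover have "c G = 0" using c True by (auto simp: chain_on_def del_def)
    ultimately show ?thesis by simp
  next
    case False
    then have "c G = slice a U G + bd N (rest a U) G"
      using bd_rest[OF assms(2) False assms(1), of U] bU by simp
    then show ?thesis using W(2) by (simp add: add.commute fun_eq_iff)
  qed
  then have "bd N (\<lambda>T. rest a U T + W T) = c" by (intro ext) (simp add: bd_add)
  with 1 show "chain_on (del L (insert a S)) (Suc i) (\<lambda>T. rest a U T + W T) \<and> bd N (\<lambda>T. rest a U T + W T) = c"
    by blast
qed

text \<open>Purity. If a simplex with fewer than d elements had no larger simplex above it, the
  empty simplex would be a cycle of its link that bounds nothing, against exactness in degree
  0.\<close>

lemma homology_sphere_nonzero_facet:
  assumes hs: "homology_sphere N L d" and "T0 \<in> L"
  shows "\<exists>T\<in>L. T0 \<subseteq> T \<and> card T = d"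
  using \<open>T0 \<in> L\<close>
proof (induction "d - card T0" arbitrary: T0)
  case 0
  then show ?case using homology_sphereD(5)[OF hs] by (intro bexI[of _ T0]) force+
next
  case (Suc k)
  note D = homology_sphereD[OF hs]
  define c :: "'a set \<Rightarrow> bit" where "c = (\<lambda>T. of_bool (T = {}))"
  have "chain_on (link L T0) 0 c" using Suc.prems by (auto simp: chain_on_def c_def link_def)
  moreover have "bd N c G = 0" for G by (simp add: bd_def c_def)
  moreover have "exact_at N (link L T0) 0" using D(7)[OF Suc.prems, of 0] Suc.hyps by simp
  ultimately obtain y where y: "chain_on (link L T0) (Suc 0) y" "bd N y = c"
    unfolding exact_at_def by blast
  have "bd N y {} = 1" using y(2) by (simp add: c_def)
  then have "(\<Sum>a\<in>N. y {a}) \<noteq> 0" by (simp add: bd_def)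
  then obtain a where "a \<in> N" "y {a} \<noteq> 0" using sum.not_neutral_contains_not_neutral by blast
  then have a: "a \<notin> T0" "insert a T0 \<in> L" using y(1) by (auto simp: chain_on_def link_def)
  moreover have "k = d - card (insert a T0)" using Suc.hyps a D(6)[OF Suc.prems] by simp
  ultimately obtain T where "T \<in> L" "insert a T0 \<subseteq> T" "card T = d" using Suc.hyps(1)[of "insert a T0"] by blast
  then show ?case by blast
qed

lemma top_cycle_eq_facet_chain:
  assumes hs: "homology_sphere N L d" and c: "chain_on L d c" "\<And>G. bd N c G = 0" "c T \<noteq> 0"
  shows "c = facet_chain L d {}"
proof -
  note D = homology_sphereD[OF hs]
  obtain T' where T': "T' \<in> L" "card T' = d" using homology_sphere_nonzero_facet[OF hs D(3)] by blast
  have "chain_on (link L {}) d (facet_chain L d {})" using chain_on_facet_chain[OF hs, of "{}"] by simp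
  moreover have "facet_chain L d {} T' \<noteq> 0" using T' by (simp add: facet_chain_def)
  ultimately show ?thesis
    using D(8)[OF D(3), of d c "facet_chain L d {}" T T'] c bd_facet_chain[OF hs] by simp
qed

text \<open>A cycle avoiding a bounds a chain U in L, and \<open>mv_slice\<close> pushes U off a,
  except in two degrees. In degree d a nonzero cycle would be the sum of all facets, some of which
  contain a. In degree d - 1 the slice of U may be the fundamental cycle of the link of a; it is
  then cancelled by adding the fundamental cycle of L to U.\<close>

lemma exact_at_del_vertex:
  assumes hs: "homology_sphere N L d" and av: "{a} \<in> L"
  shows "exact_at N (del L {a}) i"
proof -
  note D = homology_sphereD[OF hs]
  note D' = homology_sphereD[OF homology_sphere_link[OF hs av]]
  have a: "a \<in> N" using D(2)[OF av] by simp
  show ?thesis unfolding exact_at_def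
  proof (intro allI impI, elim conjE)
    fix c assume c: "chain_on (del L {a}) i c" "\<forall>G. bd N c G = 0"
    have cL: "chain_on L i c" using c(1) by (auto simp: chain_on_def del_def)
    show "\<exists>y. chain_on (del L {a}) (Suc i) y \<and> bd N y = c"
    proof (cases "i = d")
      case True
      have "c = (\<lambda>T. 0)"
      proof (rule ccontr)
        assume "c \<noteq> (\<lambda>T. 0)"
        then obtain T where "c T \<noteq> 0" by blast
        then have eq: "c = facet_chain L d {}"
          using top_cycle_eq_facet_chain[OF hs, of c T] cL c(2) True by blast
        obtain T' where T': "T' \<in> L" "{a} \<subseteq> T'" "card T' = d"
          using homology_sphere_nonzero_facet[OF hs av] by blast
        have "c T' = 0" using c(1) T' by (auto simp: chain_on_def del_def)
        then show False using T' by (simp add: eq facet_chain_def)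
      qed
      then show ?thesis by (intro exI[of _ "\<lambda>T. 0"]) auto
    next
      case False
      then have "exact_at N (link L {}) i" using D(7)[OF D(3)] by simp
      then obtain U where U: "chain_on (del L {}) (Suc i) U" "bd N U = c"
        using cL c(2) unfolding exact_at_def by (auto simp: del_def)
      have key: ?thesis if U: "chain_on (del L {}) (Suc i) U" "bd N U = c"
        and W: "chain_on (link L {a}) (Suc i) W" "bd N W = slice a U" for U W
        using mv_slice(3)[OF D(1) a U c(1) D(6)] W D(4) by (auto simp: del_def)
      have sl: "chain_on (link L {a}) i (slice a U)" "\<And>G. bd N (slice a U) G = 0"
        using mv_slice(1,2)[OF D(1) a U c(1) D(6)] by (auto simp: del_def)
      show ?thesis
      proof (cases "i = d - 1")
        case False
        then have "exact_at N (link L {a}) i" using D'(7)[OF D'(3), of i] by simp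
        then show ?thesis using sl key[OF U] unfolding exact_at_def by blast
      next
        case i: True
        have d: "d \<ge> 1" using D(5)[OF av] by simp
        show ?thesis
        proof (cases "\<exists>T. slice a U T \<noteq> 0")
          case False
          then have "slice a U = (\<lambda>T. 0)" by auto
          then show ?thesis using key[OF U, of "\<lambda>T. 0"] by (auto simp: fun_eq_iff)
        next
          case True
          then have eq: "slice a U = facet_chain (link L {a}) (d - 1) {}"
            using top_cycle_eq_facet_chain[OF homology_sphere_link[OF hs av]] sl i by blast
          define U' where "U' = (\<lambda>T. U T + facet_chain L d {} T)"
          have "chain_on (del L {}) (Suc i) U'"
            using chain_on_add[OF U(1)] chain_on_facet_chain[OF hs, of "{}"] i d
            unfolding U'_def by (auto simp: del_def)
          moreover have "bd N U' = c"
            using U(2) bd_facet_chain[OF hs] by (auto simp: U'_def bd_add)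
          moreover have "slice a U' T = 0" for T
          proof -
            have "slice a U' T = slice a U T + slice a (facet_chain L d {}) T"
              by (simp add: slice_def U'_def)
            also have "slice a (facet_chain L d {}) T = facet_chain (link L {a}) (d - 1) {} T"
            proof -
              have fin: "finite T" if "insert a T \<in> L" using D(6)[OF that] by simp
              show ?thesis
              proof (cases "a \<in> T \<or> insert a T \<notin> L")
                case True
                then show ?thesis by (auto simp: slice_def facet_chain_def link_def)
              next
                case False
                then have "card (insert a T) = d \<longleftrightarrow> card T = d - 1" using fin d by auto
                then show ?thesis using False by (simp add: slice_def facet_chain_def link_def)
              qed
            qed
            finally show ?thesis using eq by simp
          qed
          ultimately show ?thesis using key[of U' "\<lambda>T. 0"] by (auto simp: fun_eq_iff)
        qed
      qed
    qed
  qed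
qed

text \<open>The complement of a closed cell in a homology sphere is acyclic; the vertices of the cell
  are removed one at a time by Mayer-Vietoris.\<close>

lemma exact_at_del_face:
  assumes "finite S" "S \<noteq> {}" "homology_sphere N L d" "S \<in> L"
  shows "exact_at N (del L S) i"
  using assms
proof (induction S arbitrary: L d i rule: finite_induct)
  case (insert a S L d i)
  show ?case
  proof (cases "S = {}")
    case True
    then show ?thesis using exact_at_del_vertex[OF insert.prems(2), of a] insert.prems(3) by simp
  next
    case False
    note D = homology_sphereD[OF insert(5)]
    have a: "{a} \<in> L" "S \<in> L" "a \<in> N" using D(4)[OF insert(6)] D(2)[OF insert(6)] by auto
    have S: "S \<in> link L {a}" using insert.hyps insert.prems(3) by (simp add: link_def)
    \<comment> \<open>Removing a from \<open>del L S\<close> needs the acyclicity of two smaller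
      complements: that of S in L and that of S in the link of a.\<close>
    have ex1: "exact_at N (del L S) i" using insert.IH[OF False insert(5) a(2)] .
    have ex2: "exact_at N (del (link L {a}) S) i" using insert.IH[OF False homology_sphere_link[OF insert(5) a(1)] S] .
    show ?thesis unfolding exact_at_def
    proof (intro allI impI, elim conjE)
      fix c assume c: "chain_on (del L (insert a S)) i c" "\<forall>G. bd N c G = 0"
      have "chain_on (del L S) i c" using c(1) by (auto simp: chain_on_def del_def)
      then obtain U where U: "chain_on (del L S) (Suc i) U" "bd N U = c"
        using ex1 c(2) unfolding exact_at_def by blast
      note mv = mv_slice[OF D(1) a(3) U c(1) D(6)]
      obtain W where "chain_on (del (link L {a}) S) (Suc i) W" "bd N W = slice a U"
        using ex2 mv(1,2) unfolding exact_at_def by blast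
      then show "\<exists>y. chain_on (del L (insert a S)) (Suc i) y \<and> bd N y = c"
        using mv(3) D(4) insert.hyps by blast
    qed
  qed
qed simp

text \<open>If only the boundary of a cell lies in a homology sphere, then the link of a facet of that
  cell represents the nontrivial class Alexander dual to this boundary.\<close>

lemma facet_chain_not_boundary_del:
  assumes "homology_sphere N L d" "finite S" "S \<notin> L" "\<And>b. b \<in> S \<Longrightarrow> S - {b} \<in> L" "a \<in> S"
  shows "\<not> (\<exists>y. chain_on (del L S) (Suc (d + 1 - card S)) y \<and> bd N y = facet_chain L d (S - {a}))"
  using assms
proof (induction "card S" arbitrary: S L d)
  case 0
  then show ?case by auto
next
  case (Suc m)
  note hs = Suc.prems(1)
  note D = homology_sphereD[OF hs]
  show ?case
  proof (cases "S = {a}")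
    \<comment> \<open>Now \<open>S - {a}\<close> is empty and the chain in question is the
      fundamental cycle of L; a filling would need simplices with d + 1 elements.\<close>
    case True
    show ?thesis
    proof
      assume "\<exists>y. chain_on (del L S) (Suc (d + 1 - card S)) y \<and> bd N y = facet_chain L d (S - {a})"
      then obtain y where y: "chain_on (del L S) (Suc d) y" "bd N y = facet_chain L d {}"
        using True by auto
      have "y T = 0" for T
      proof (rule ccontr)
        assume "y T \<noteq> 0"
        then have "T \<in> L" "card T = Suc d" using y(1) by (auto simp: chain_on_def del_def)
        then show False using D(5) by fastforce
      qed
      then have "bd N y T = 0" for T by (simp add: bd_def)
      moreover obtain T' where "T' \<in> L" "card T' = d" using homology_sphere_nonzero_facet[OF hs D(3)] by blast
      moreover from this have "facet_chain L d {} T' = 1" by (simp add: facet_chain_def)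
      ultimately show False using y(2) by (metis zero_neq_one)
    qed
  next
    case False
    \<comment> \<open>The induction removes a vertex b other than a and passes to the link of b, in
      which \<open>S - {b}\<close> is again missing while its boundary is present.\<close>
    then obtain b where b: "b \<in> S" "b \<noteq> a" using Suc.prems(5) by blast
    have bL: "{b} \<in> L" using D(4)[OF Suc.prems(4)[OF Suc.prems(5)], of "{b}"] b by auto
    have bN: "b \<in> N" using D(2)[OF bL] by simp
    let ?S = "S - {b}" and ?L = "link L {b}" and ?Z = "facet_chain L d (S - {a})"
    have cS: "card S = Suc m" "card ?S = m" using Suc.hyps(2) b Suc.prems(2) by auto
    have "card S \<ge> 2" using b Suc.prems(2,5) by (metis False One_nat_def Suc.hyps(2) Suc_leI card_1_singletonE card_gt_0_iff empty_iff le_antisym not_less_eq_eq numeral_2_eq_2 singletonD)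
    then have m: "m \<ge> 1" using cS by simp
    have "card (S - {a}) = m" using cS Suc.prems(5) Suc.prems(2) by simp
    then have dm: "m \<le> d" using D(5)[OF Suc.prems(4)[OF Suc.prems(5)]] by simp
    \<comment> \<open>The link of \<open>S - {a}\<close> in L is the link of
      \<open>S - {b} - {a}\<close> in the link of b, so both have the same fundamental
      cycle.\<close>
    have Z: "facet_chain ?L (d - 1) (?S - {a}) = ?Z"
    proof
      fix T
      have eq: "insert b (T \<union> (S - {b} - {a})) = T \<union> (S - {a})" using b by auto
      show "facet_chain ?L (d - 1) (?S - {a}) T = ?Z T"
      proof (cases "b \<in> T")
        case True then show ?thesis using b by (auto simp: facet_chain_def link_def)
      next
        case False
        have 1: "T \<union> (?S - {a}) \<in> ?L \<longleftrightarrow> T \<union> (S - {a}) \<in> L"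
          using False eq by (simp add: link_def Un_assoc)
        have 2: "T \<inter> (?S - {a}) = {} \<longleftrightarrow> T \<inter> (S - {a}) = {}" using False by auto
        have 3: "card (T \<union> (?S - {a})) = d - 1 \<longleftrightarrow> card (T \<union> (S - {a})) = d" if "T \<union> (S - {a}) \<in> L"
        proof -
          have "finite (T \<union> (?S - {a}))" using D(6)[OF that] by simp
          moreover have "b \<notin> T \<union> (?S - {a})" using False by simp
          ultimately have "card (T \<union> (S - {a})) = Suc (card (T \<union> (?S - {a})))"
            using card_insert_disjoint[of "T \<union> (?S - {a})" b] unfolding eq by simp
          then show ?thesis using dm m by auto
        qed
        show ?thesis unfolding facet_chain_def 1 2 using 3 by auto
      qed
    qed
    show ?thesis
    proof
      assume "\<exists>y. chain_on (del L S) (Suc (d + 1 - card S)) y \<and> bd N y = ?Z"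
      then obtain Y where Y: "chain_on (del L S) (Suc (d - m)) Y" "bd N Y = ?Z" using cS by auto
      \<comment> \<open>Y fills Z away from S, and the cone from b fills Z as well. Their sum is a
        cycle avoiding \<open>S - {b}\<close>, which is a simplex of L, so by acyclicity it bounds
        some U. The slice of U at b fills Z in the link of b, against the induction
        hypothesis.\<close>
      define C where "C = (\<lambda>T. Y T + join b ?Z T)"
      have Zs: "T \<inter> S = {} \<and> T \<union> (S - {a}) \<in> L \<and> card T = d - m" if "?Z T \<noteq> 0" for T
      proof -
        have *: "T \<inter> (S - {a}) = {}" "T \<union> (S - {a}) \<in> L" "card (T \<union> (S - {a})) = d"
          using that by (auto simp: facet_chain_def)
        have "a \<notin> T" using D(4)[OF *(2), of S] Suc.prems(3,5) by blast
        moreover have "finite T" using D(6)[OF *(2)] by simp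
        then have "card T + m = d" using * Suc.prems(2) \<open>card (S - {a}) = m\<close> by (metis card_Un_disjoint finite_Diff)
        ultimately show ?thesis using * by auto
      qed
      have jZ: "chain_on (del L ?S) (Suc (d - m)) (join b ?Z)"
        unfolding chain_on_def
      proof (intro allI impI)
        fix T assume "join b ?Z T \<noteq> 0"
        then have T: "b \<in> T" "?Z (T - {b}) \<noteq> 0" by (auto simp: join_def split: if_splits)
        note z = Zs[OF T(2)]
        have "T \<subseteq> (T - {b}) \<union> (S - {a})" using b by auto
        then have "T \<in> L" using z D(4) by blast
        moreover have "card T = Suc (card (T - {b}))" using card.remove[OF D(6)[OF \<open>T \<in> L\<close>] T(1)] .
        ultimately show "T \<in> del L ?S \<and> card T = Suc (d - m)" using z T by (auto simp: del_def)
      qed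
      have C1: "chain_on (del L ?S) (Suc (d - m)) C"
        unfolding C_def by (rule chain_on_add[OF _ jZ]) (use Y(1) in \<open>auto simp: chain_on_def del_def\<close>)
      have slJ: "slice b (join b ?Z) = ?Z"
        using Zs b by (force simp: slice_def join_def fun_eq_iff)
      have C2: "bd N C G = 0" for G
      proof -
        have "bd N (join b ?Z) G = ?Z G"
        proof (cases "b \<in> G")
          case True
          then have "bd N (join b ?Z) G = bd N (slice b (join b ?Z)) (G - {b})"
            using bd_slice[OF D(1) bN, of "G - {b}"] by (simp add: insert_absorb)
          also have "\<dots> = 0" unfolding slJ by (rule bd_facet_chain[OF hs])
          finally show ?thesis using True Zs b by fastforce
        next
          case False
          have "rest b (join b ?Z) = (\<lambda>T. 0)" by (auto simp: rest_def join_def)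
          then show ?thesis using bd_rest[OF bN False D(1), of "join b ?Z"] slJ by simp
        qed
        then show ?thesis using Y(2) by (simp add: C_def bd_add)
      qed
      have "?S \<in> L" "?S \<noteq> {}" "finite ?S" using Suc.prems b by auto
      then have "exact_at N (del L ?S) (Suc (d - m))" using exact_at_del_face[OF _ _ hs] by blast
      then obtain U where U: "chain_on (del L ?S) (Suc (Suc (d - m))) U" "bd N U = C"
        using C1 C2 unfolding exact_at_def by blast
      have "chain_on (del ?L ?S) (Suc (d - 1 + 1 - card ?S)) (slice b U)"
        unfolding chain_on_def
      proof (intro allI impI)
        fix T assume "slice b U T \<noteq> 0"
        then have T: "b \<notin> T" "insert b T \<in> del L ?S" "card (insert b T) = Suc (Suc (d - m))"
          using U(1) by (auto simp: slice_def chain_on_def split: if_splits)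
        moreover have "finite T" using T(2) D(6) by (fastforce simp: del_def)
        ultimately show "T \<in> del ?L ?S \<and> card T = Suc (d - 1 + 1 - card ?S)"
          using cS dm m by (auto simp: del_def link_def)
      qed
      moreover have "bd N (slice b U) G = facet_chain ?L (d - 1) (?S - {a}) G" for G
      proof (cases "b \<in> G")
        case True
        then have "?Z G = 0" using Zs b by blast
        then show ?thesis using bd_slice_in[OF True, of N U] unfolding Z by simp
      next
        case False
        have "bd N (slice b U) G = C (insert b G)" using bd_slice[OF D(1) bN False] U(2) by metis
        also have "Y (insert b G) = 0" using Y(1) b by (auto simp: chain_on_def del_def)
        then have "C (insert b G) = ?Z G" using False by (simp add: C_def join_def)
        finally show ?thesis unfolding Z .
      qed
      moreover have "\<not> (\<exists>y. chain_on (del ?L ?S) (Suc (d - 1 + 1 - card ?S)) y \<and> bd N y = facet_chain ?L (d - 1) (?S - {a}))"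
      proof (rule Suc.hyps(1))
        show "m = card ?S" using cS by simp
        show "homology_sphere N ?L (d - 1)" using homology_sphere_link[OF hs bL] .
        show "?S \<notin> ?L" using b Suc.prems(3) by (auto simp: link_def insert_absorb)
        show "?S - {x} \<in> ?L" if "x \<in> ?S" for x
        proof -
          have "(?S - {x}) \<union> {b} = S - {x}" using that b by auto
          then show ?thesis using Suc.prems(4)[of x] that by (auto simp: link_def)
        qed
      qed (use b Suc.prems in auto)
      ultimately show False by blast
    qed
  qed
qed

text \<open>The inequality \<open>d + 3 \<le> 2 * J\<close> makes d + 2 - J smaller than J. So the
  dual cycle in L', on simplices with d + 1 - J elements, and the chain that fills it in L both
  consist of simplices common to L and L', and the filling is valid in L' too.\<close>

theorem homology_sphere_skeleton_step:
  assumes hs: "homology_sphere N L d" and hs': "homology_sphere N L' d"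
    and agree: "\<And>T. card T < J \<Longrightarrow> T \<in> L \<longleftrightarrow> T \<in> L'"
    and J: "d + 3 \<le> 2 * J" and S: "S \<in> L" "card S = J"
  shows "S \<in> L'"
proof (rule ccontr)
  assume "S \<notin> L'"
  note D = homology_sphereD[OF hs]
  note D' = homology_sphereD[OF hs']
  have fS: "finite S" using D(6) S by blast
  have "S \<noteq> {}" using J S by auto
  then obtain a where a: "a \<in> S" by blast
  have Jd: "J \<le> d" using D(5) S by blast
  have sub: "S - {b} \<in> L'" if "b \<in> S" for b
  proof -
    have "card (S - {b}) < J" using that fS S(2) by (metis card_Diff1_less)
    then show ?thesis using agree D(4)[OF S(1)] by blast
  qed
  let ?Z = "facet_chain L' d (S - {a})"
  have no: "\<not> (\<exists>y. chain_on (del L' S) (Suc (d + 1 - card S)) y \<and> bd N y = ?Z)"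
    by (rule facet_chain_not_boundary_del[OF hs' fS \<open>S \<notin> L'\<close> sub a])
  have transfer: "chain_on (del L2 S) i y" if "chain_on (del L1 S) i y" "i < J"
    "L1 = L \<and> L2 = L' \<or> L1 = L' \<and> L2 = L" for L1 L2 i y
    using that agree by (auto simp: chain_on_def del_def)
  have "chain_on (del L' S) (d + 1 - card S) ?Z"
  proof -
    have "chain_on (link L' (S - {a})) (d - card (S - {a})) ?Z" by (rule chain_on_facet_chain[OF hs'])
    moreover have "d - card (S - {a}) = d + 1 - card S"
    proof -
      have "J \<ge> 1" using J Jd by linarith
      then show ?thesis using a fS S Jd by simp
    qed
    moreover have "T \<in> del L' S" if "T \<in> link L' (S - {a})" for T
    proof -
      have *: "T \<union> (S - {a}) \<in> L'" "T \<inter> (S - {a}) = {}" using that by (auto simp: link_def)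
      then have "a \<notin> T" using D'(4)[OF *(1), of S] \<open>S \<notin> L'\<close> by blast
      then show ?thesis using * D'(4)[OF *(1), of T] by (auto simp: del_def)
    qed
    ultimately show ?thesis by (auto simp: chain_on_def)
  qed
  then have "chain_on (del L S) (d + 1 - card S) ?Z"
    by (rule transfer) (use J Jd S in auto)
  moreover have "exact_at N (del L S) (d + 1 - card S)"
    by (rule exact_at_del_face[OF fS \<open>S \<noteq> {}\<close> hs S(1)])
  ultimately obtain y where y: "chain_on (del L S) (Suc (d + 1 - card S)) y" "bd N y = ?Z"
    using bd_facet_chain[OF hs'] unfolding exact_at_def by blast
  have "chain_on (del L' S) (Suc (d + 1 - card S)) y"
    by (rule transfer[OF y(1)]) (use J Jd S in auto)
  with y(2) no show False by blast
qed


section \<open>Mod 2 reduction of integral singular chains\<close>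

text \<open>Subdivision and its chain homotopy act on integral chains, while \<open>chain2\<close>
  uses finite sets of simplices. Sets are therefore lifted to integral chains with coefficients 0
  and 1, and identities hold up to twice a chain.\<close>

definition red :: "('a \<Rightarrow>\<^sub>0 int) \<Rightarrow> 'a set" where
  "red c = {f. odd (Poly_Mapping.lookup c f)}"

definition lift :: "'a set \<Rightarrow> 'a \<Rightarrow>\<^sub>0 int" where
  "lift s = (\<Sum>f\<in>s. frag_of f)"

lemma lookup_frag_of: "Poly_Mapping.lookup (frag_of f) g = (if f = g then 1 else 0)"
  by (simp add: lookup_single when_def)

lemma red_add: "red (a + b) = symdiff (red a) (red b)"
  by (auto simp: red_def symdiff_def lookup_add)

lemma red_diff: "red (a - b) = symdiff (red a) (red b)"
  by (auto simp: red_def symdiff_def lookup_minus)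

lemma red_lift [simp]: "finite s \<Longrightarrow> red (lift s) = s"
  by (auto simp: red_def lift_def lookup_sum lookup_frag_of)

lemma red_0 [simp]: "red 0 = {}"
  by (simp add: red_def)

lemma red_cmul_2 [simp]: "red (frag_cmul 2 w) = {}"
  by (simp add: red_def)

lemma symdiff_empty [simp]: "symdiff A {} = A" "symdiff {} A = A" "symdiff A A = {}"
  by (auto simp: symdiff_def)

text \<open>Halve the even coefficients. The bound on the keys keeps w on simplices of u, hence in
  every subspace that carries u.\<close>

lemma red_eq_empty_imp:
  assumes "red u = {}"
  obtains w where "u = frag_cmul 2 w" "Poly_Mapping.keys w \<subseteq> Poly_Mapping.keys u"
proof
  define w where "w = (\<Sum>f\<in>Poly_Mapping.keys u. frag_cmul (Poly_Mapping.lookup u f div 2) (frag_of f))"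
  have lw: "Poly_Mapping.lookup w g = Poly_Mapping.lookup u g div 2" for g
  proof -
    have "Poly_Mapping.lookup w g
        = (\<Sum>f\<in>Poly_Mapping.keys u. if f = g then Poly_Mapping.lookup u f div 2 else 0)"
      unfolding w_def lookup_sum by (intro sum.cong) (auto simp: lookup_frag_of)
    also have "\<dots> = Poly_Mapping.lookup u g div 2"
      by (simp add: in_keys_iff)
    finally show ?thesis .
  qed
  have "even (Poly_Mapping.lookup u g)" for g
    using assms by (auto simp: red_def)
  then show "u = frag_cmul 2 w"
    by (intro poly_mapping_eqI) (simp add: lw)
  show "Poly_Mapping.keys w \<subseteq> Poly_Mapping.keys u"
    by (auto simp: in_keys_iff lw)
qed

lemma singular_chain_lift: "chain2 p X s \<Longrightarrow> singular_chain p X (lift s)"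
  unfolding lift_def by (intro singular_chain_sum) (simp add: chain2_def singular_chain_of)

lemma red_subset_keys: "red c \<subseteq> Poly_Mapping.keys c"
  by (auto simp: red_def in_keys_iff)

lemma chain2_red: "singular_chain p X c \<Longrightarrow> chain2 p X (red c)"
  using red_subset_keys[of c] unfolding chain2_def singular_chain_def
  by (auto intro: finite_subset)

lemma singular_chain_eq_lift_red:
  assumes "singular_chain p X c"
  obtains w where "singular_chain p X w" "c = lift (red c) + frag_cmul 2 w"
proof -
  have "red (c - lift (red c)) = {}"
    using chain2_red[OF assms] by (simp add: red_diff chain2_def)
  then obtain w where w: "c - lift (red c) = frag_cmul 2 w"
      "Poly_Mapping.keys w \<subseteq> Poly_Mapping.keys (c - lift (red c))"
    by (rule red_eq_empty_imp)
  have "singular_chain p X (c - lift (red c))"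
    using assms chain2_red singular_chain_lift singular_chain_diff by blast
  then have "singular_chain p X w" using w(2) by (auto simp: singular_chain_def)
  moreover have "c = lift (red c) + frag_cmul 2 w" using w(1) by (simp add: algebra_simps)
  ultimately show ?thesis by (rule that)
qed

text \<open>Signs do not affect parity, so the coefficient of g has the parity of the number of
  pairs (f, k) with odd coefficient at f and k-th face g, which is what \<open>bd2\<close>
  counts.\<close>

lemma bd2_red: "bd2 p (red c) = red (chain_boundary p c)"
proof (cases "p = 0")
  case False
  have "g \<in> bd2 p (red c) \<longleftrightarrow> g \<in> red (chain_boundary p c)" for g
  proof -
    let ?K = "Poly_Mapping.keys c"
    let ?t = "\<lambda>(f, k). Poly_Mapping.lookup c f * ((-1) ^ k * (if g = singular_face p k f then 1 else 0))"
    have "Poly_Mapping.lookup (chain_boundary p c) g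
      = (\<Sum>f\<in>?K. Poly_Mapping.lookup c f * (\<Sum>k\<le>p. (-1) ^ k * (if g = singular_face p k f then 1 else 0)))"
      using False by (simp add: chain_boundary_def frag_extend_def lookup_sum lookup_frag_of)
    also have "\<dots> = sum ?t (?K \<times> {..p})"
      by (simp add: sum_distrib_left sum.cartesian_product)
    finally have *: "Poly_Mapping.lookup (chain_boundary p c) g = sum ?t (?K \<times> {..p})" .
    have "even (sum ?t (?K \<times> {..p})) \<longleftrightarrow> even (card {x \<in> ?K \<times> {..p}. odd (?t x)})"
      by (rule even_sum_iff) simp
    moreover have "{x \<in> ?K \<times> {..p}. odd (?t x)} = {(f, k). f \<in> red c \<and> k \<le> p \<and> singular_face p k f = g}"
      using red_subset_keys[of c] by (auto simp: red_def split: if_splits)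
    ultimately show ?thesis
      using False * by (simp add: bd2_def red_def)
  qed
  then show ?thesis by blast
qed (simp add: bd2_def chain_boundary_def)

section \<open>Mod 2 cochains evaluated on integral chains\<close>

definition eval2 :: "('a \<Rightarrow> bit) \<Rightarrow> ('a \<Rightarrow>\<^sub>0 int) \<Rightarrow> bit" where
  "eval2 g c = (\<Sum>f\<in>Poly_Mapping.keys c. of_int (Poly_Mapping.lookup c f) * g f)"

lemma eval2_superset:
  assumes "finite K" "Poly_Mapping.keys c \<subseteq> K"
  shows "eval2 g c = (\<Sum>f\<in>K. of_int (Poly_Mapping.lookup c f) * g f)"
  unfolding eval2_def by (rule sum.mono_neutral_left) (use assms in \<open>auto simp: in_keys_iff\<close>)

lemma eval2_add: "eval2 g (a + b) = eval2 g a + eval2 g b"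
proof -
  let ?K = "Poly_Mapping.keys a \<union> Poly_Mapping.keys b"
  have "Poly_Mapping.keys (a + b) \<subseteq> ?K" by (rule keys_add)
  then show ?thesis
    by (simp add: eval2_superset[where K = ?K] lookup_add ring_distribs sum.distrib)
qed

lemma eval2_0 [simp]: "eval2 g 0 = 0"
  by (simp add: eval2_def)

lemma eval2_cmul: "eval2 g (frag_cmul n c) = of_int n * eval2 g c"
proof -
  have "Poly_Mapping.keys (frag_cmul n c) \<subseteq> Poly_Mapping.keys c" by (auto simp: in_keys_iff)
  then show ?thesis
    by (simp add: eval2_superset[where K = "Poly_Mapping.keys c"] sum_distrib_left mult.assoc)
qed

lemma eval2_cmul_2 [simp]: "eval2 g (frag_cmul 2 c) = 0"
  by (simp add: eval2_cmul)

lemma eval2_diff: "eval2 g (a - b) = eval2 g a + eval2 g b"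
proof -
  have "a - b = a + frag_cmul (-1) b" by simp
  then show ?thesis by (simp only: eval2_add eval2_cmul) simp
qed

lemma eval2_sum: "eval2 g (sum c I) = (\<Sum>i\<in>I. eval2 g (c i))"
  by (induction I rule: infinite_finite_induct) (auto simp: eval2_add)

lemma eval2_of [simp]: "eval2 g (frag_of f) = g f"
  by (simp add: eval2_def lookup_frag_of)

lemma eval2_eq_0: "(\<And>f. f \<in> Poly_Mapping.keys c \<Longrightarrow> g f = 0) \<Longrightarrow> eval2 g c = 0"
  by (simp add: eval2_def)

section \<open>Counting completely labelled simplices\<close>

definition vtx :: "nat \<Rightarrow> nat \<Rightarrow> real" where
  "vtx j = (\<lambda>k. if k = j then 1 else 0)"

definition labels :: "('a \<Rightarrow> 'l) \<Rightarrow> nat \<Rightarrow> ((nat \<Rightarrow> real) \<Rightarrow> 'a) \<Rightarrow> 'l set" where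
  "labels L p f = (\<lambda>j. L (f (vtx j))) ` {..p}"

text \<open>The coefficient at S of the image of a chain under the map to simplicial chains on
  labels. For \<open>card S = Suc p\<close> only simplices with pairwise distinct labels count;
  degenerate ones are dropped.\<close>

definition lcount :: "('a \<Rightarrow> 'l) \<Rightarrow> 'l set \<Rightarrow> nat \<Rightarrow> 'a chain \<Rightarrow> bit" where
  "lcount L S p = eval2 (\<lambda>f. of_bool (labels L p f = S))"

lemma vtx_in_simplex: "j \<le> p \<Longrightarrow> vtx j \<in> standard_simplex p"
  using basis_in_standard_simplex[of j p] by (simp add: vtx_def)

lemma labels_singular_face:
  assumes "k \<le> Suc p"
  shows "labels L p (singular_face (Suc p) k f) = (\<lambda>j. L (f (vtx j))) ` ({..Suc p} - {k})"
proof -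
  have "singular_face (Suc p) k f (vtx j) = f (vtx (if j < k then j else Suc j))" if "j \<le> p" for j
  proof -
    have "simplical_face k (vtx j) = vtx (if j < k then j else Suc j)"
      by (auto simp: simplical_face_def vtx_def fun_eq_iff)
    then show ?thesis using vtx_in_simplex[OF that] by (simp add: singular_face_def)
  qed
  then have "labels L p (singular_face (Suc p) k f)
      = (\<lambda>j. L (f (vtx j))) ` (\<lambda>j. if j < k then j else Suc j) ` {..p}"
    unfolding labels_def image_image by (intro image_cong) auto
  moreover have "(\<lambda>j. if j < k then j else Suc j) ` {..p} = {..Suc p} - {k}"
  proof (intro equalityI subsetI)
    fix x assume "x \<in> {..Suc p} - {k}"
    then show "x \<in> (\<lambda>j. if j < k then j else Suc j) ` {..p}"
      using assms by (cases "x < k") (auto intro: image_eqI[of _ _ x] image_eqI[of _ _ "x - 1"])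
  qed (use assms in auto)
  ultimately show ?thesis by simp
qed

text \<open>If the labels are distinct, a face with label set S must be opposite the one vertex
  whose label lies outside S. If two vertices a and b share a label, the right side is 0, and on the
  left the only candidates are the faces opposite a and b, which have the same label set and
  cancel.\<close>

lemma face_label_parity:
  fixes w :: "nat \<Rightarrow> 'l"
  assumes "finite A" "w ` {..Suc i} \<subseteq> A" "card S = Suc i"
  shows "(\<Sum>k\<le>Suc i. of_bool (w ` ({..Suc i} - {k}) = S)) = (\<Sum>s\<in>A - S. of_bool (w ` {..Suc i} = insert s S) :: bit)"
proof (cases "inj_on w {..Suc i}")
  case True
  let ?W = "w ` {..Suc i}"
  have "(\<Sum>k\<le>Suc i. of_bool (w ` ({..Suc i} - {k}) = S)) = (\<Sum>k\<le>Suc i. of_bool (?W - {w k} = S) :: bit)"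
    using True by (intro sum.cong) (auto simp: inj_on_image_set_diff)
  also have "\<dots> = (\<Sum>s\<in>?W. of_bool (?W - {s} = S))"
    by (simp add: sum.reindex[OF True])
  also have "\<dots> = (\<Sum>s\<in>A - S. of_bool (?W = insert s S))"
  proof (rule sum.mono_neutral_cong)
    show "of_bool (?W = insert s S) = (0::bit)" if "s \<in> A - S - ?W" for s
    proof -
      have "?W \<noteq> insert s S" using that by (metis DiffD2 insertI1)
      then show ?thesis by simp
    qed
    show "of_bool (?W - {s} = S) = (0::bit)" if "s \<in> ?W - (A - S)" for s
    proof -
      have "s \<in> S" using that assms(2) by blast
      then have "?W - {s} \<noteq> S" by blast
      then show ?thesis by simp
    qed
    show "of_bool (?W - {s} = S) = (of_bool (?W = insert s S) :: bit)" if "s \<in> ?W \<inter> (A - S)" for s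
    proof -
      have "s \<in> ?W" "s \<notin> S" using that by (rule IntD1, blast)
      moreover have "W - {s} = S \<longleftrightarrow> W = insert s S" if "s \<in> W" "s \<notin> S" for W
        using that by blast
      ultimately have "?W - {s} = S \<longleftrightarrow> ?W = insert s S" by metis
      then show ?thesis by simp
    qed
  qed (use assms in auto)
  finally show ?thesis .
next
  case False
  have "w ` {..Suc i} \<noteq> insert s S" if "s \<in> A - S" for s
  proof
    assume eq: "w ` {..Suc i} = insert s S"
    have "finite S" using assms(3) by (metis card.infinite nat.distinct(1))
    then have "card (w ` {..Suc i}) = card {..Suc i}" using eq that assms(3) by simp
    then show False using False eq_card_imp_inj_on by blast
  qed
  then have 0: "(\<Sum>s\<in>A - S. of_bool (w ` {..Suc i} = insert s S)) = (0::bit)" by simp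
  obtain a b where ab: "a \<le> Suc i" "b \<le> Suc i" "a \<noteq> b" "w a = w b"
    using False by (auto simp: inj_on_def)
  have drop: "w ` (B - {x}) = w ` B" if "y \<in> B" "x \<noteq> y" "w x = w y" for B x y
  proof -
    have "w x \<in> w ` (B - {x})" using that by (metis DiffI image_eqI singletonD)
    then show ?thesis by blast
  qed
  have Wab: "w ` ({..Suc i} - {a}) = w ` {..Suc i}" "w ` ({..Suc i} - {b}) = w ` {..Suc i}"
    using drop[of b "{..Suc i}" a] drop[of a "{..Suc i}" b] ab by auto
  \<comment> \<open>A face opposite any other vertex still contains a and b, so it carries at most i
    labels, too few for S.\<close>
  have ne: "w ` ({..Suc i} - {k}) \<noteq> S" if "k \<noteq> a" "k \<noteq> b" "k \<le> Suc i" for k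
  proof
    assume eq: "w ` ({..Suc i} - {k}) = S"
    have "w ` ({..Suc i} - {k}) = w ` ({..Suc i} - {k} - {a})"
      using drop[of b "{..Suc i} - {k}" a] ab that by auto
    moreover have "card ({..Suc i} - {k} - {a}) = i" using ab that by simp
    ultimately have "card S \<le> i" using eq by (metis card_image_le finite_Diff finite_atMost)
    then show False using assms(3) by simp
  qed
  have "(\<Sum>k\<le>Suc i. of_bool (w ` ({..Suc i} - {k}) = S)) = (\<Sum>k\<in>{a, b}. of_bool (w ` {..Suc i} = S) :: bit)"
    by (rule sum.mono_neutral_cong_right) (use ab Wab ne in auto)
  also have "\<dots> = 0" using ab(3) by simp
  finally show ?thesis using 0 by simp
qed

text \<open>Recording the label sets is a chain map from singular chains to simplicial chains on the
  set of labels.\<close>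

lemma lcount_chain_boundary:
  assumes "finite A" "\<And>x. L x \<in> A" "card S = Suc i"
  shows "lcount L S i (chain_boundary (Suc i) c) = (\<Sum>s\<in>A - S. lcount L (insert s S) (Suc i) c)"
proof -
  have "Poly_Mapping.keys c \<subseteq> UNIV" by simp
  then show ?thesis
  proof (induction c rule: frag_induction)
    case (one f)
    have "lcount L S i (chain_boundary (Suc i) (frag_of f))
        = (\<Sum>k\<le>Suc i. of_bool (labels L i (singular_face (Suc i) k f) = S))"
      unfolding lcount_def chain_boundary_of
      by (simp add: eval2_sum eval2_cmul eval2_add del: sum.atMost_Suc)
    also have "\<dots> = (\<Sum>k\<le>Suc i. of_bool ((\<lambda>j. L (f (vtx j))) ` ({..Suc i} - {k}) = S))"
      by (intro sum.cong) (auto simp: labels_singular_face)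
    also have "\<dots> = (\<Sum>s\<in>A - S. of_bool ((\<lambda>j. L (f (vtx j))) ` {..Suc i} = insert s S))"
      by (rule face_label_parity) (use assms in auto)
    finally show ?case by (simp add: lcount_def labels_def)
  next
    case (diff a b)
    then show ?case
      by (simp add: chain_boundary_diff lcount_def eval2_diff sum.distrib)
  qed (simp add: lcount_def)
qed


section \<open>Cones over singular simplices\<close>

text \<open>The coordinate 0 of t is the weight of the apex v, the others are rescaled to a point of
  the base simplex. At the apex the division is by 0 and the argument of f is meaningless, but its
  factor 1 - t 0 vanishes there.\<close>

definition cone :: "(nat \<Rightarrow> real) \<Rightarrow> nat \<Rightarrow> ((nat \<Rightarrow> real) \<Rightarrow> nat \<Rightarrow> real) \<Rightarrow> (nat \<Rightarrow> real) \<Rightarrow> nat \<Rightarrow> real" where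
  "cone v p f = restrict (\<lambda>t i. t 0 * v i + (1 - t 0) * f (\<lambda>j. t (Suc j) / (1 - t 0)) i) (standard_simplex (Suc p))"

lemma simplex_shift:
  assumes "t \<in> standard_simplex (Suc p)" "t 0 \<noteq> 1"
  shows "(\<lambda>j. t (Suc j) / (1 - t 0)) \<in> standard_simplex p"
proof -
  have t: "\<And>i. 0 \<le> t i \<and> t i \<le> 1" "\<And>i. i > Suc p \<Longrightarrow> t i = 0" "(\<Sum>i\<le>Suc p. t i) = 1"
    using assms by (auto simp: standard_simplex_def)
  have sum: "(\<Sum>i\<le>p. t (Suc i)) = 1 - t 0"
    using t(3) unfolding sum.atMost_Suc_shift by simp
  have pos: "1 - t 0 > 0" using assms(2) t(1)[of 0] by simp
  have "t (Suc i) \<le> 1 - t 0" for i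
  proof (cases "i \<le> p")
    case True
    then show ?thesis using member_le_sum[of i "{..p}" "\<lambda>i. t (Suc i)"] t(1) by (simp add: sum)
  qed (use t pos in auto)
  then show ?thesis
    using t pos sum by (auto simp: standard_simplex_def divide_simps simp flip: sum_divide_distrib)
qed

lemma compact_standard_simplex: "compact (standard_simplex p)"
  using compactin_standard_simplex[of p] by (simp add: euclidean_product_topology)

lemma singular_simplex_euclidean:
  "singular_simplex p (powertop_real UNIV) f \<longleftrightarrow>
     (\<forall>i. continuous_on (standard_simplex p) (\<lambda>x. f x i)) \<and> f \<in> extensional (standard_simplex p)"
  unfolding singular_simplex_def continuous_map_componentwise_UNIV
  by (simp add: euclidean_product_topology)

text \<open>Only the apex needs care: the rescaled argument need not converge there, but each
  coordinate of f is bounded on the compact simplex, and the factor 1 - t 0 tends to 0.\<close>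

lemma singular_simplex_cone:
  assumes f: "singular_simplex p (powertop_real UNIV) f"
  shows "singular_simplex (Suc p) (powertop_real UNIV) (cone v p f)"
  unfolding singular_simplex_euclidean
proof (intro conjI allI)
  show "cone v p f \<in> extensional (standard_simplex (Suc p))" by (simp add: cone_def)
  fix i
  let ?S = "standard_simplex (Suc p)"
  let ?s = "\<lambda>t j. t (Suc j) / (1 - t (0::nat)) :: real"
  let ?g = "\<lambda>t. t 0 * v i + (1 - t 0) * f (?s t) i"
  have fi: "continuous_on (standard_simplex p) (\<lambda>x. f x i)" using f by (simp add: singular_simplex_euclidean)
  have coord: "continuous_on X (\<lambda>t. t j)" for X :: "(nat \<Rightarrow> real) set" and j
    by (rule continuous_on_product_then_coordinatewise) (rule continuous_on_id)
  have "bounded ((\<lambda>x. f x i) ` standard_simplex p)"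
    using compact_continuous_image[OF fi compact_standard_simplex] compact_imp_bounded by blast
  then obtain B where B: "\<And>x. x \<in> standard_simplex p \<Longrightarrow> \<bar>f x i\<bar> \<le> B"
    unfolding bounded_iff by auto
  have "continuous_on ?S ?g"
    unfolding continuous_on_eq_continuous_within
  proof
    fix t assume t: "t \<in> ?S"
    show "continuous (at t within ?S) ?g"
    proof (cases "t 0 = 1")
      case False
      let ?U = "{t :: nat \<Rightarrow> real. t 0 \<noteq> 1}"
      have "continuous_on (?S \<inter> ?U) ?s"
        by (rule continuous_on_coordinatewise_then_product) (intro continuous_intros coord, auto)
      then have "continuous_on (?S \<inter> ?U) (\<lambda>t. f (?s t) i)"
        by (rule continuous_on_compose2[OF fi]) (use simplex_shift in blast)
      then have "continuous_on (?S \<inter> ?U) ?g" by (intro continuous_intros coord)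
      then have "continuous (at t within (?S \<inter> ?U)) ?g"
        using t False unfolding continuous_on_eq_continuous_within by blast
      moreover have "open ?U"
        using open_Collect_neq[OF coord[of UNIV 0] continuous_on_const[of UNIV 1]] by simp
      then have "at t within (?S \<inter> ?U) = at t within ?S"
        using False by (intro at_within_nhd[of _ ?U]) auto
      ultimately show ?thesis by simp
    next
      case True
      have lim: "((\<lambda>t. t 0) \<longlongrightarrow> t 0) (at t within ?S)"
        using coord[of ?S 0] t unfolding continuous_on_def by blast
      then have "((\<lambda>t. (1 - t 0) * (B + \<bar>v i\<bar>)) \<longlongrightarrow> (1 - t 0) * (B + \<bar>v i\<bar>)) (at t within ?S)"
        by (intro tendsto_intros)
      then have "((\<lambda>t. (1 - t 0) * (B + \<bar>v i\<bar>)) \<longlongrightarrow> 0) (at t within ?S)"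
        using True by simp
      moreover have "norm (?g u - v i) \<le> (1 - u 0) * (B + \<bar>v i\<bar>)" if "u \<in> ?S" for u
      proof (cases "u 0 = 1")
        case False
        have "?g u - v i = (1 - u 0) * (f (?s u) i - v i)" by (simp add: algebra_simps)
        moreover have "0 \<le> 1 - u 0" using that by (simp add: standard_simplex_def)
        moreover have "\<bar>f (?s u) i - v i\<bar> \<le> B + \<bar>v i\<bar>"
          using B[OF simplex_shift[OF that False]] by linarith
        ultimately show ?thesis by (simp add: abs_mult mult_left_mono)
      qed simp
      then have "\<forall>\<^sub>F u in at t within ?S. norm (?g u - v i) \<le> (1 - u 0) * (B + \<bar>v i\<bar>)"
        by (simp add: eventually_at_filter)
      ultimately have "((\<lambda>u. ?g u - v i) \<longlongrightarrow> 0) (at t within ?S)"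
        by (rule Lim_null_comparison[rotated])
      then have "(?g \<longlongrightarrow> v i) (at t within ?S)" by (rule LIM_zero_cancel)
      then show ?thesis using True by (simp add: continuous_within)
    qed
  qed
  then show "continuous_on ?S (\<lambda>x. cone v p f x i)"
    by (rule continuous_on_eq) (simp add: cone_def)
qed

text \<open>Taking t = 1 shows that v itself belongs to U as soon as U is nonempty.\<close>

definition star_shaped :: "(nat \<Rightarrow> real) \<Rightarrow> (nat \<Rightarrow> real) set \<Rightarrow> bool" where
  "star_shaped v U \<longleftrightarrow> (\<forall>x\<in>U. \<forall>t. 0 \<le> t \<longrightarrow> t \<le> 1 \<longrightarrow> (\<lambda>i. t * v i + (1 - t) * x i) \<in> U)"

lemma singular_simplex_cone_subtopology:
  assumes f: "singular_simplex p (subtopology (powertop_real UNIV) U) f" and U: "star_shaped v U"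
  shows "singular_simplex (Suc p) (subtopology (powertop_real UNIV) U) (cone v p f)"
  unfolding singular_simplex_subtopology
proof (intro conjI singular_simplex_cone image_subsetI)
  show "singular_simplex p (powertop_real UNIV) f" using f by (simp add: singular_simplex_subtopology)
  have fU: "f x \<in> U" if "x \<in> standard_simplex p" for x
    using f that by (auto simp: singular_simplex_subtopology)
  fix t assume t: "t \<in> standard_simplex (Suc p)"
  have t0: "0 \<le> t 0" "t 0 \<le> 1" using t by (auto simp: standard_simplex_def)
  show "cone v p f t \<in> U"
  proof (cases "t 0 = 1")
    case True
    obtain x where "x \<in> U" using fU nonempty_standard_simplex by blast
    then have "(\<lambda>i. 1 * v i + (1 - 1) * x i) \<in> U" using U unfolding star_shaped_def by (metis zero_le_one order_refl)
    then show ?thesis using t True by (simp add: cone_def)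
  next
    case False
    then show ?thesis
      using t t0 U fU[OF simplex_shift[OF t False]] by (simp add: cone_def star_shaped_def)
  qed
qed

lemma singular_face_cone_0:
  assumes "f \<in> extensional (standard_simplex p)"
  shows "singular_face (Suc p) 0 (cone v p f) = f"
proof
  fix x
  show "singular_face (Suc p) 0 (cone v p f) x = f x"
  proof (cases "x \<in> standard_simplex p")
    case True
    then have "simplical_face 0 x \<in> standard_simplex (Suc p)"
      using simplical_face_in_standard_simplex[of "Suc p" 0 x] by simp
    then show ?thesis using True by (simp add: singular_face_def cone_def) (simp add: simplical_face_def)
  qed (use assms in \<open>simp add: singular_face_def extensional_def\<close>)
qed

lemma singular_face_cone_Suc:
  assumes "k \<le> Suc p"
  shows "singular_face (Suc (Suc p)) (Suc k) (cone v (Suc p) f) = cone v p (singular_face (Suc p) k f)"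
proof
  fix x
  show "singular_face (Suc (Suc p)) (Suc k) (cone v (Suc p) f) x = cone v p (singular_face (Suc p) k f) x"
  proof (cases "x \<in> standard_simplex (Suc p)")
    case True
    let ?t = "simplical_face (Suc k) x"
    have t: "?t \<in> standard_simplex (Suc (Suc p))"
      using simplical_face_in_standard_simplex[of "Suc (Suc p)" "Suc k" x] assms True by simp
    have t0: "?t 0 = x 0" by (simp add: simplical_face_def)
    have "(\<lambda>j. ?t (Suc j) / (1 - x 0)) = simplical_face k (\<lambda>j. x (Suc j) / (1 - x 0))"
      by (auto simp: simplical_face_def fun_eq_iff)
    then have "cone v (Suc p) f ?t = (\<lambda>i. x 0 * v i + (1 - x 0) * f (simplical_face k (\<lambda>j. x (Suc j) / (1 - x 0))) i)"
      using t t0 by (simp add: cone_def)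
    moreover have "singular_face (Suc p) k f (\<lambda>j. x (Suc j) / (1 - x 0))
        = f (simplical_face k (\<lambda>j. x (Suc j) / (1 - x 0)))" if "x 0 \<noteq> 1"
      using simplex_shift[OF True that] by (simp add: singular_face_def)
    ultimately show ?thesis
      using True by (cases "x 0 = 1") (auto simp: singular_face_def cone_def)
  qed (simp add: singular_face_def cone_def)
qed

definition chain_cone :: "(nat \<Rightarrow> real) \<Rightarrow> nat \<Rightarrow> (nat \<Rightarrow> real) chain \<Rightarrow> (nat \<Rightarrow> real) chain" where
  "chain_cone v p c = frag_extend (\<lambda>f. frag_of (cone v p f)) c"

lemma chain_cone_add: "chain_cone v p (a + b) = chain_cone v p a + chain_cone v p b"
  and chain_cone_cmul: "chain_cone v p (frag_cmul n a) = frag_cmul n (chain_cone v p a)"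
  by (simp_all add: chain_cone_def frag_extend_add frag_extend_cmul)

lemma singular_chain_cone:
  assumes "singular_chain p (subtopology (powertop_real UNIV) U) c" "star_shaped v U"
  shows "singular_chain (Suc p) (subtopology (powertop_real UNIV) U) (chain_cone v p c)"
  unfolding chain_cone_def
  by (rule singular_chain_extend)
     (use assms singular_simplex_cone_subtopology in \<open>auto simp: singular_chain_of singular_chain_def\<close>)

text \<open>The face opposite the apex is the simplex itself, and the other faces are cones over its
  faces, with the sign shifted by one. Dimension 0 is excluded because there the apex would enter as
  a further term.\<close>

lemma chain_boundary_cone:
  assumes "singular_chain (Suc p) X c"
  shows "chain_boundary (Suc (Suc p)) (chain_cone v (Suc p) c) = c - chain_cone v p (chain_boundary (Suc p) c)"
  using assms unfolding singular_chain_def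
proof (induction c rule: frag_induction)
  case (one f)
  then have ext: "f \<in> extensional (standard_simplex (Suc p))" by (simp add: singular_simplex_def)
  have "chain_boundary (Suc (Suc p)) (chain_cone v (Suc p) (frag_of f))
      = frag_of (singular_face (Suc (Suc p)) 0 (cone v (Suc p) f))
        + (\<Sum>k\<le>Suc p. frag_cmul ((-1) ^ Suc k) (frag_of (singular_face (Suc (Suc p)) (Suc k) (cone v (Suc p) f))))"
    by (simp only: chain_cone_def frag_extend_of chain_boundary_of sum.atMost_Suc_shift[of _ "Suc p"]) simp
  also have "(\<Sum>k\<le>Suc p. frag_cmul ((-1) ^ Suc k) (frag_of (singular_face (Suc (Suc p)) (Suc k) (cone v (Suc p) f))))
     = - (\<Sum>k\<le>Suc p. frag_cmul ((-1) ^ k) (frag_of (cone v p (singular_face (Suc p) k f))))"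
    unfolding sum_negf[symmetric] by (intro sum.cong) (auto simp: singular_face_cone_Suc)
  also have "(\<Sum>k\<le>Suc p. frag_cmul ((-1) ^ k) (frag_of (cone v p (singular_face (Suc p) k f))))
     = chain_cone v p (chain_boundary (Suc p) (frag_of f))"
    by (simp add: chain_cone_def chain_boundary_of frag_extend_sum frag_extend_cmul comp_def frag_extend_add del: sum.atMost_Suc)
  finally show ?case using singular_face_cone_0[OF ext] by simp
next
  case (diff a b)
  then show ?case by (simp add: chain_cone_def chain_boundary_diff frag_extend_diff)
qed (simp add: chain_cone_def)


section \<open>Subdivision\<close>

abbreviation Sd :: "nat \<Rightarrow> nat \<Rightarrow> 'a chain \<Rightarrow> 'a chain" where
  "Sd N p \<equiv> singular_subdivision p ^^ N"

lemma singular_chain_Sd: "singular_chain p X c \<Longrightarrow> singular_chain p X (Sd N p c)"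
  by (induction N) (auto intro: singular_chain_singular_subdivision)

lemma Sd_add: "Sd N p (a + b) = Sd N p a + Sd N p b"
  by (induction N) (auto simp: singular_subdivision_add)

lemma frag_cmul_2: "frag_cmul 2 (w :: 'a \<Rightarrow>\<^sub>0 int) = w + w"
  by (intro poly_mapping_eqI) (simp add: lookup_add)

lemma Sd_cmul_2: "Sd N p (frag_cmul 2 w) = frag_cmul 2 (Sd N p w)"
  by (simp add: frag_cmul_2 Sd_add)

lemma chain_boundary_Sd:
  "singular_chain p X c \<Longrightarrow> chain_boundary p (Sd N p c) = Sd N (p - Suc 0) (chain_boundary p c)"
proof (induction N)
  case (Suc N)
  then show ?case
    using chain_boundary_singular_subdivision[OF singular_chain_Sd[OF Suc.prems, of N]] by simp
qed simp

lemma fine_subdivision: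
  assumes "\<forall>U\<in>C. openin X U" "topspace X \<subseteq> \<Union>C" "singular_chain p X c"
  shows "\<exists>N. \<forall>m\<ge>N. \<forall>f\<in>Poly_Mapping.keys (Sd m p c). \<exists>U\<in>C. f \<in> standard_simplex p \<rightarrow> U"
proof (rule sufficient_iterated_singular_subdivision_exists[OF bspec[OF assms(1)] assms(2,3)])
  fix n
  assume "\<And>m f. n \<le> m \<Longrightarrow> f \<in> Poly_Mapping.keys (Sd m p c) \<Longrightarrow> \<exists>V\<in>C. f \<in> standard_simplex p \<rightarrow> V"
  then show ?thesis by (intro exI[of _ n] allI impI ballI)
qed

text \<open>One operator h serves all spaces X, so it keeps a chain inside every subspace containing
  it. The homotopy equation is solved for \<open>Sd N p c\<close>, the form in which it is
  used.\<close>

lemma chain_homotopic_Sd: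
  obtains h :: "nat \<Rightarrow> 'a chain \<Rightarrow> 'a chain" where
    "\<And>p a b. h p (a + b) = h p a + h p b"
    "\<And>p a. h p (- a) = - h p a"
    "\<And>p X c. singular_chain p X c \<Longrightarrow> singular_chain (Suc p) X (h p c)"
    "\<And>p X c. singular_chain p X c \<Longrightarrow>
        Sd N p c = c + chain_boundary (Suc p) (h p c) + h (p - Suc 0) (chain_boundary p c)"
proof -
  obtain h :: "nat \<Rightarrow> 'a chain \<Rightarrow> 'a chain" where h: "\<And>p. h p 0 = 0"
    "\<And>p c1 c2. h p (c1-c2) = h p c1 - h p c2"
    "\<And>p X c. singular_chain p X c \<Longrightarrow> singular_chain (Suc p) X (h p c)"
    "\<And>p X c. singular_chain p X c \<Longrightarrow>
       chain_boundary (Suc p) (h p c) + h (p - Suc 0) (chain_boundary p c) = Sd N p c - c"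
    using chain_homotopic_iterated_singular_subdivision[where n = N] by blast
  have minus: "h p (- a) = - h p a" for p a
    using h(2)[of p 0 a] h(1) by simp
  moreover have "h p (a + b) = h p a + h p b" for p a b
    using h(2)[of p a "- b"] minus by simp
  ultimately show ?thesis
    using that[of h] h(3,4) by (metis (no_types, lifting) add.assoc add.commute diff_add_cancel)
qed

lemma additive_sum_sign:
  fixes h :: "'a chain \<Rightarrow> bit"
  assumes "\<And>a b. h (a + b) = h a + h b" "\<And>a. h (- a) = h a" "\<And>k. k \<in> K \<Longrightarrow> h (c k) = 0"
  shows "h (\<Sum>k\<in>K. frag_cmul ((-1) ^ m k) (c k)) = 0"
proof -
  have "h 0 = 0" using assms(1)[of 0 0] by (cases "h 0") auto
  moreover have "h (frag_cmul ((-1) ^ j) (c k)) = 0" if "k \<in> K" for j k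
    using assms(2,3) that by (cases "even j") auto
  ultimately show ?thesis
    using assms(1) by (induction K rule: infinite_finite_induct) auto
qed

lemma eval2_minus: "eval2 g (- a) = eval2 g a"
  using eval2_diff[of g 0 a] by simp

section \<open>Relative cycles pushed off a boundary point\<close>

lemma rcycles2_symdiff:
  assumes "c \<in> rcycles2 p X S" "c' \<in> rcycles2 p X S"
  shows "symdiff c c' \<in> rcycles2 p X S"
proof -
  have c: "chain2 p X c" "chain2 (p - 1) (subtopology X S) (bd2 p c)"
    "chain2 p X c'" "chain2 (p - 1) (subtopology X S) (bd2 p c')"
    using assms by (auto simp: rcycles2_def)
  then have "finite c" "finite c'" by (auto simp: chain2_def)
  then have "bd2 p (symdiff c c') = symdiff (bd2 p c) (bd2 p c')"
    using bd2_red[of p "lift c + lift c'"] bd2_red[of p "lift c"] bd2_red[of p "lift c'"]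
    by (simp add: red_add chain_boundary_add)
  with c show ?thesis by (auto simp: rcycles2_def chain2_def symdiff_def)
qed

text \<open>Small simplices of a relative cycle near p lie in V, where coning from v bounds them modulo
  simplices that avoid p.\<close>

lemma rhomologous2_empty_if_star_shaped:
  fixes M :: "(nat \<Rightarrow> real) set"
  defines "X \<equiv> subtopology (powertop_real UNIV) M"
  assumes V: "openin X V" "p \<in> V" "star_shaped v V" "star_shaped v (V - {p})"
    and c: "c \<in> rcycles2 (Suc q) X (M - {p})"
  shows "rhomologous2 (Suc q) X (M - {p}) c {}"
proof -
  let ?S = "M - {p}" and ?d = "Suc q" and ?XS = "subtopology X (M - {p})"
  have XS: "?XS = subtopology (powertop_real UNIV) ?S"
    by (simp add: X_def subtopology_subtopology Int_absorb1)
  have VM: "V \<subseteq> M" using openin_subset[OF V(1)] by (simp add: X_def)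
  have XV: "subtopology X V = subtopology (powertop_real UNIV) V"
    using VM by (simp add: X_def subtopology_subtopology Int_absorb1)
  have opS: "openin X ?S"
  proof -
    have "openin (powertop_real UNIV) (UNIV - {p})"
      by (simp add: euclidean_product_topology open_delete)
    then have "openin X ((UNIV - {p}) \<inter> M)" unfolding X_def by (rule openin_subtopology_Int)
    moreover have "(UNIV - {p}) \<inter> M = ?S" by auto
    ultimately show ?thesis by simp
  qed
  have cc: "chain2 ?d X c" "chain2 q ?XS (bd2 ?d c)" using c by (auto simp: rcycles2_def)
  have fin: "finite c" using cc by (simp add: chain2_def)
  define z where "z = lift c"
  have z: "singular_chain ?d X z" unfolding z_def by (rule singular_chain_lift[OF cc(1)])
  have redz: "red z = c" using fin by (simp add: z_def)
  have rbz: "red (chain_boundary ?d z) = bd2 ?d c" using bd2_red[of ?d z] redz by simp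
  \<comment> \<open>The integral boundary of the lift agrees with the lift of the mod 2 boundary
    only up to an even chain; w is carried along to the end, where reduction kills it.\<close>
  obtain w where w: "singular_chain q X w" "chain_boundary ?d z = lift (bd2 ?d c) + frag_cmul 2 w"
    using singular_chain_eq_lift_red[OF singular_chain_boundary_alt[OF z]] unfolding rbz by blast
  define b where "b = lift (bd2 ?d c)"
  have b: "singular_chain q ?XS b" unfolding b_def by (rule singular_chain_lift[OF cc(2)])
  have op: "\<forall>U\<in>{V, ?S}. openin X U" using V(1) opS by blast
  have cov: "topspace X \<subseteq> \<Union>{V, ?S}" using V(2) by (auto simp: X_def)
  obtain N where N: "\<forall>m\<ge>N. \<forall>f\<in>Poly_Mapping.keys (Sd m ?d z). \<exists>U\<in>{V, ?S}. f \<in> standard_simplex ?d \<rightarrow> U"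
    using fine_subdivision[OF op cov z] by (rule exE)
  obtain h :: "nat \<Rightarrow> (nat \<Rightarrow> real) chain \<Rightarrow> (nat \<Rightarrow> real) chain" where h:
    "\<And>p a b. h p (a + b) = h p a + h p b" "\<And>p a. h p (- a) = - h p a"
    "\<And>p X c. singular_chain p X c \<Longrightarrow> singular_chain (Suc p) X (h p c)"
    "\<And>p X c. singular_chain p X c \<Longrightarrow>
        Sd N p c = c + chain_boundary (Suc p) (h p c) + h (p - Suc 0) (chain_boundary p c)"
    by (rule chain_homotopic_Sd[where N = N]) (rule that; assumption)
  define F where "F = (\<lambda>U. {f \<in> Poly_Mapping.keys (Sd N ?d z). f \<in> standard_simplex ?d \<rightarrow> U})"
  have "Poly_Mapping.keys (Sd N ?d z) \<subseteq> F V \<union> F ?S"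
  proof
    fix f assume f: "f \<in> Poly_Mapping.keys (Sd N ?d z)"
    from N[rule_format, OF order_refl this] obtain U where "U \<in> {V, ?S}" "f \<in> standard_simplex ?d \<rightarrow> U" ..
    then show "f \<in> F V \<union> F ?S" using f unfolding F_def by blast
  qed
  then obtain c1 c2 where keys: "Poly_Mapping.keys c1 \<subseteq> F V" "Poly_Mapping.keys c2 \<subseteq> F ?S"
     and c12: "c1 + c2 = Sd N ?d z"
    by (rule frag_split)
  have SdX: "singular_chain ?d X (Sd N ?d z)" by (rule singular_chain_Sd[OF z])
  have c1: "singular_chain ?d (subtopology X V) c1" and c2: "singular_chain ?d ?XS c2"
    using keys SdX unfolding singular_chain_subtopology F_def by (auto simp: singular_chain_def)
  have bSd: "chain_boundary ?d (Sd N ?d z) = Sd N q b + frag_cmul 2 (Sd N q w)"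
    using chain_boundary_Sd[OF z, of N] w(2) by (simp add: Sd_add Sd_cmul_2 b_def)
  \<comment> \<open>The mod 2 boundary of c1 lies in V since c1 does, and it avoids p because it
    equals a chain built from b and c2, both in M - {p}. So it lies in V - {p}, which is star-shaped
    too.\<close>
  have "chain_boundary ?d c1 = Sd N q b - chain_boundary ?d c2 + frag_cmul 2 (Sd N q w)"
    using bSd chain_boundary_add[of ?d c1 c2] c12 by (simp add: algebra_simps)
  then have r1: "red (chain_boundary ?d c1) = red (Sd N q b - chain_boundary ?d c2)"
    by (simp add: red_add)
  have "chain2 q ?XS (red (chain_boundary ?d c1))"
    unfolding r1 by (intro chain2_red singular_chain_diff singular_chain_Sd b singular_chain_boundary_alt c2)
  moreover have c1b: "singular_chain q (subtopology X V) (chain_boundary ?d c1)"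
    by (rule singular_chain_boundary_alt[OF c1])
  then have "chain2 q (subtopology X V) (red (chain_boundary ?d c1))" by (rule chain2_red)
  ultimately have "chain2 q (subtopology X (V - {p})) (red (chain_boundary ?d c1))"
    unfolding chain2_def singular_simplex_subtopology by blast
  then have b1: "singular_chain q (subtopology X (V - {p})) (lift (red (chain_boundary ?d c1)))"
    by (rule singular_chain_lift)
  obtain w1 where w1: "singular_chain q (subtopology X V) w1"
     "chain_boundary ?d c1 = lift (red (chain_boundary ?d c1)) + frag_cmul 2 w1"
    by (rule singular_chain_eq_lift_red[OF c1b])
  define b1 where "b1 = lift (red (chain_boundary ?d c1))"
  let ?K = "chain_cone v"
  have Kc1: "chain_boundary (Suc ?d) (?K ?d c1) = c1 - ?K q b1 - frag_cmul 2 (?K q w1)"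
    using chain_boundary_cone[OF c1, of v] w1(2) unfolding b1_def
    by (metis chain_cone_add chain_cone_cmul diff_diff_eq)
  have XVp: "subtopology X (V - {p}) = subtopology (powertop_real UNIV) (V - {p})"
    using VM by (simp add: X_def subtopology_subtopology Int_absorb1 subset_iff Int_commute)
  have Kb1: "singular_chain ?d (subtopology X (V - {p})) (?K q b1)"
    using singular_chain_cone[OF _ V(4)] b1 unfolding XVp b1_def by blast
  have KX: "singular_chain (Suc ?d) (subtopology X V) (?K ?d c1)"
    using singular_chain_cone[OF _ V(3)] c1 unfolding XV by blast
  \<comment> \<open>Mod 2, z is its subdivision plus the homotopy terms, the subdivision is c1 + c2,
    and c1 is the boundary of its cone plus the cone over its boundary. Sorting the terms into a
    boundary and chains avoiding p gives e and a.\<close>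
  define e where "e = ?K ?d c1 - h ?d z"
  define a where "a = ?K q b1 + c2 - h q b"
  have eX: "singular_chain (Suc ?d) X e"
    unfolding e_def using KX h(3)[OF z] by (auto simp: singular_chain_subtopology intro: singular_chain_diff)
  have aS: "singular_chain ?d ?XS a"
    unfolding a_def
  proof (intro singular_chain_diff singular_chain_add c2 h(3) b)
    show "singular_chain ?d ?XS (?K q b1)" using singular_chain_mono[OF Kb1] VM by blast
  qed
  have "h q (chain_boundary ?d z) = h q b + frag_cmul 2 (h q w)"
    unfolding w(2) b_def by (simp add: frag_cmul_2 h(1))
  then have "Sd N ?d z = z + chain_boundary (Suc ?d) (h ?d z) + h q b + frag_cmul 2 (h q w)"
    using h(4)[OF z] by (simp add: add.assoc)
  then have "z = chain_boundary (Suc ?d) e + a + frag_cmul 2 (?K q w1 - h q w)"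
    unfolding e_def a_def chain_boundary_diff Kc1
    by (simp add: c12[symmetric] frag_cmul_2 algebra_simps)
  then have "red z = symdiff (bd2 (Suc ?d) (red e)) (red a)"
    by (simp only: red_add red_cmul_2 bd2_red symdiff_empty)
  then have "symdiff c {} = symdiff (bd2 (Suc ?d) (red e)) (red a)" by (simp add: redz)
  then show ?thesis
    unfolding rhomologous2_def using chain2_red[OF eX] chain2_red[OF aS] by blast
qed

section \<open>Sperner's lemma\<close>

lemma labels_subset:
  assumes "f \<in> standard_simplex p \<rightarrow> U" "\<And>x. x \<in> U \<Longrightarrow> L x \<in> R"
  shows "labels L p f \<subseteq> R"
  unfolding labels_def
proof (rule image_subsetI)
  fix j assume "j \<in> {..p}"
  then have "f (vtx j) \<in> U" using assms(1) vtx_in_simplex[of j p] by auto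
  then show "L (f (vtx j)) \<in> R" by (rule assms(2))
qed

lemma lcount_eq_0:
  assumes "singular_chain p (subtopology (powertop_real UNIV) U) c" "\<And>x. x \<in> U \<Longrightarrow> L x \<in> R" "\<not> S \<subseteq> R"
  shows "lcount L S p c = 0"
  unfolding lcount_def
proof (rule eval2_eq_0)
  fix f assume "f \<in> Poly_Mapping.keys c"
  then have "f \<in> standard_simplex p \<rightarrow> U"
    using assms(1) by (auto simp: singular_chain_subtopology)
  then have "labels L p f \<subseteq> R" using assms(2) by (rule labels_subset)
  then show "of_bool (labels L p f = S) = (0::bit)" using assms(3) by auto
qed

text \<open>Compare f with its subdivision by the chain homotopy h. The boundary of h f contributes
  nothing, because h f lives where only the labels of S occur and a simplex of dimension i + 1 would
  have to carry a further label. The term h applied to the boundary runs over faces of f, each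
  missing a label of S. What remains is the count 1 for f itself.\<close>

lemma sperner:
  fixes f :: "(nat \<Rightarrow> real) \<Rightarrow> nat \<Rightarrow> real"
  assumes f: "singular_simplex i (powertop_real UNIV) f"
    and A: "finite A" "\<And>x. L x \<in> A" and S: "card S = Suc i"
    and f_labels: "\<And>x. x \<in> standard_simplex i \<Longrightarrow> L (f x) \<in> S"
    and face_labels: "\<And>k. i > 0 \<Longrightarrow> k \<le> i \<Longrightarrow>
        \<exists>s\<in>S. \<forall>x \<in> standard_simplex (i - 1). L (singular_face i k f x) \<noteq> s"
    and vertices: "labels L i f = S"
  shows "lcount L S i (Sd N i (frag_of f)) = 1"
proof -
  obtain h :: "nat \<Rightarrow> (nat \<Rightarrow> real) chain \<Rightarrow> (nat \<Rightarrow> real) chain" where h: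
    "\<And>p a b. h p (a + b) = h p a + h p b" "\<And>p a. h p (- a) = - h p a"
    "\<And>p X c. singular_chain p X c \<Longrightarrow> singular_chain (Suc p) X (h p c)"
    "\<And>p X c. singular_chain p X c \<Longrightarrow>
        Sd N p c = c + chain_boundary (Suc p) (h p c) + h (p - Suc 0) (chain_boundary p c)"
    by (rule chain_homotopic_Sd[where N = N]) (rule that; assumption)
  let ?P = "powertop_real UNIV" and ?c = "frag_of f"
  have sc: "singular_chain i (subtopology ?P {x. L x \<in> S}) ?c"
    unfolding singular_chain_of singular_simplex_subtopology using f f_labels by blast
  have 1: "lcount L S i (chain_boundary (Suc i) (h i ?c)) = 0"
  proof -
    have "lcount L (insert s S) (Suc i) (h i ?c) = 0" if "s \<in> A - S" for s
      by (rule lcount_eq_0[OF h(3)[OF sc], where R = S]) (use that in auto)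
    then show ?thesis using lcount_chain_boundary[where L = L, OF A S] by simp
  qed
  have 2: "lcount L S i (h (i - Suc 0) (chain_boundary i ?c)) = 0"
  proof (cases "i = 0")
    case True
    have "h 0 0 = 0" using h(1)[of 0 0 0] by simp
    then show ?thesis using True by (simp add: chain_boundary_def lcount_def)
  next
    case False
    have "lcount L S i (h (i - Suc 0) (\<Sum>k\<in>{..i}. frag_cmul ((-1) ^ k) (frag_of (singular_face i k f)))) = 0"
    proof (rule additive_sum_sign[where m = "\<lambda>k. k"])
      fix k assume "k \<in> {..i}"
      then obtain s where s: "s \<in> S" "\<And>x. x \<in> standard_simplex (i - 1) \<Longrightarrow> L (singular_face i k f x) \<noteq> s"
        using face_labels[of k] False by auto
      have "singular_simplex (i - Suc 0) ?P (singular_face i k f)"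
        using singular_simplex_singular_face[OF f] False \<open>k \<in> {..i}\<close> by auto
      then have "singular_chain (i - Suc 0) (subtopology ?P {x. L x \<noteq> s}) (frag_of (singular_face i k f))"
        unfolding singular_chain_of singular_simplex_subtopology using s(2) by auto
      then have "singular_chain i (subtopology ?P {x. L x \<noteq> s}) (h (i - Suc 0) (frag_of (singular_face i k f)))"
        using h(3) False by fastforce
      then show "lcount L S i (h (i - Suc 0) (frag_of (singular_face i k f))) = 0"
        by (rule lcount_eq_0[where R = "- {s}"]) (use s(1) in auto)
    qed (simp_all add: h(1,2) lcount_def eval2_add eval2_minus)
    then show ?thesis using False by (simp add: chain_boundary_of)
  qed
  have "Sd N i ?c = ?c + chain_boundary (Suc i) (h i ?c) + h (i - Suc 0) (chain_boundary i ?c)"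
    by (rule h(4)[OF sc])
  then have "lcount L S i (Sd N i ?c) = lcount L S i ?c"
    using 1 2 by (simp add: lcount_def eval2_add)
  also have "\<dots> = 1" using vertices by (simp add: lcount_def)
  finally show ?thesis .
qed


section \<open>Stars of vertices in subcomplexes of a cube\<close>

definition vface :: "nat \<Rightarrow> (nat \<Rightarrow> bool) \<Rightarrow> nat set \<Rightarrow> (nat \<Rightarrow> bool) set" where
  "vface n v T = {x \<in> cube_verts n. \<forall>i<n. i \<notin> T \<longrightarrow> x i = v i}"

text \<open>The link of the vertex v as an abstract simplicial complex: its vertices are
  coordinates, and a simplex is the set of free directions of a face through v.\<close>

definition dirs :: "nat \<Rightarrow> (nat \<Rightarrow> bool) set set \<Rightarrow> (nat \<Rightarrow> bool) \<Rightarrow> nat set set" where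
  "dirs n F v = {T. T \<subseteq> {..<n} \<and> vface n v T \<in> F}"

lemma vface_in_cube_faces: "vface n v T \<in> cube_faces n"
proof -
  have "vface n v T = cube_face n (\<lambda>i. if i \<in> T then None else Some (v i))"
    by (auto simp: vface_def cube_face_def)
  then show ?thesis by (simp add: cube_faces_def)
qed

lemma vface_mono: "S \<subseteq> T \<Longrightarrow> vface n v S \<subseteq> vface n v T"
  by (auto simp: vface_def)

text \<open>Local homology is studied at the centre \<open>pt\<close> of the face through v with
  directions D. Near it M is an open cube in the directions D times the cone over \<open>Lk\<close>,
  so local homology in degree \<open>card D + i\<close> is to be compared with the homology of
  \<open>Lk\<close> on simplices with i elements.\<close>

locale star_point =
  fixes n :: nat and F :: "(nat \<Rightarrow> bool) set set" and v :: "nat \<Rightarrow> bool" and D :: "nat set"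
  assumes faces: "F \<subseteq> cube_faces n"
    and down: "\<And>X Y. X \<in> F \<Longrightarrow> Y \<in> cube_faces n \<Longrightarrow> Y \<subseteq> X \<Longrightarrow> Y \<in> F"
    and v: "v \<in> cube_verts n"
    and D: "D \<in> dirs n F v"
begin

abbreviation "M \<equiv> geom_real F"
abbreviation "X \<equiv> subtopology (powertop_real UNIV) M"
abbreviation "r i \<equiv> (of_bool (v i) :: real)"
abbreviation "Lk \<equiv> link (dirs n F v) D"

definition pt :: "nat \<Rightarrow> real" where
  "pt i = (if i \<in> D then 1/2 else r i)"

text \<open>Outside D the sign of 1/2 - r i points from the vertex into the unit interval.\<close>

definition step :: "nat \<Rightarrow> real" where
  "step i = (if i \<in> D then 1/4 else 1/2 - r i)"

text \<open>Label 0 belongs to a point with all D-coordinates below those of the center pt, label Suc i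
  to a point shifted from pt in direction i.\<close>

definition q :: "nat \<Rightarrow> nat \<Rightarrow> real" where
  "q s i = pt i - (if s = 0 \<and> i \<in> D then 1/4 else 0) + (if s = Suc i then step i else 0)"

definition sx :: "nat set \<Rightarrow> (nat \<Rightarrow> real) \<Rightarrow> nat \<Rightarrow> real" where
  "sx R = oriented_simplex (card R - 1) (\<lambda>j. q (sorted_list_of_set R ! j))"

text \<open>The simplex \<open>sx (labset T)\<close> is the join of a simplex of full dimension in
  the face D, with \<open>pt\<close> as its barycentre, and one vertex for each direction in
  T.\<close>

definition labset :: "nat set \<Rightarrow> nat set" where
  "labset T = insert 0 (Suc ` (D \<union> T))"

section \<open>The realisation near the centre of a face\<close>

lemma Dn: "D \<subseteq> {..<n}"
  using D by (simp add: dirs_def)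

lemma dirs_subset: "T \<in> dirs n F v \<Longrightarrow> T \<subseteq> {..<n}"
  by (simp add: dirs_def)

lemma dirs_down: "T \<in> dirs n F v \<Longrightarrow> S \<subseteq> T \<Longrightarrow> S \<in> dirs n F v"
  using down vface_mono vface_in_cube_faces unfolding dirs_def by blast

lemma link_down: "T \<in> Lk \<Longrightarrow> S \<subseteq> T \<Longrightarrow> S \<in> Lk"
  using dirs_down[of "T \<union> D" "S \<union> D"] by (auto simp: link_def)

lemma link_finite: "finite Lk" "T \<in> Lk \<Longrightarrow> finite T" "T \<in> Lk \<Longrightarrow> T \<subseteq> {..<n} - D"
proof -
  show *: "T \<subseteq> {..<n} - D" if "T \<in> Lk" for T
    using that dirs_subset by (auto simp: link_def)
  then show "T \<in> Lk \<Longrightarrow> finite T" using finite_subset by blast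
  have "Lk \<subseteq> Pow ({..<n} - D)" using * by blast
  then show "finite Lk" by (rule finite_subset) simp
qed

lemma v0: "i \<ge> n \<Longrightarrow> \<not> v i"
  using v by (simp add: cube_verts_def)

lemma geom_bounds:
  assumes "x \<in> M"
  shows "0 \<le> x i" "x i \<le> 1" "i \<ge> n \<Longrightarrow> x i = 0"
proof -
  obtain Y where Y: "Y \<in> F" "x \<in> face_box Y" using assms by (auto simp: geom_real_def)
  then show "0 \<le> x i" "x i \<le> 1" by (auto simp: face_box_def)
  assume "i \<ge> n"
  have "Y \<in> cube_faces n" using Y(1) faces by blast
  then have "Y \<subseteq> cube_verts n" by (auto simp: cube_faces_def cube_face_def)
  then have "\<forall>y\<in>Y. y i = False" using \<open>i \<ge> n\<close> by (auto simp: cube_verts_def)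
  moreover have "(\<forall>y\<in>Y. y i = False) \<longrightarrow> x i = (if False then 1 else 0)"
    using Y(2) unfolding face_box_def by blast
  ultimately show "x i = 0" by simp
qed

text \<open>A coordinate that a face Y containing x keeps fixed has value 0 or 1 at x, so it is not
  in D, and as x is closer than 1 to v there, it agrees with v. Hence Y contains the face through v
  spanned by D and the directions in which x leaves v.\<close>

lemma geom_carrier:
  assumes x: "x \<in> M" and xD: "\<And>b. b \<in> D \<Longrightarrow> 0 < x b \<and> x b < 1"
    and xN: "\<And>c. c < n \<Longrightarrow> c \<notin> D \<Longrightarrow> \<bar>x c - r c\<bar> < 1"
  shows "{c. c < n \<and> c \<notin> D \<and> x c \<noteq> r c} \<in> Lk"
proof -
  let ?T = "{c. c < n \<and> c \<notin> D \<and> x c \<noteq> r c}"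
  obtain Y where Y: "Y \<in> F" "x \<in> face_box Y" using x by (auto simp: geom_real_def)
  then obtain w where w: "Y = cube_face n w" using faces by (auto simp: cube_faces_def)
  have xw: "x i = of_bool b" if "i < n" "w i = Some b" for i b
  proof -
    have "\<forall>y\<in>Y. y i = b" using that by (auto simp: w cube_face_def)
    then show ?thesis using Y(2) by (auto simp: face_box_def)
  qed
  have "vface n v (?T \<union> D) \<subseteq> Y"
  proof
    fix y assume y: "y \<in> vface n v (?T \<union> D)"
    have "y i = b" if "i < n" "w i = Some b" for i b
    proof -
      have xi: "x i = of_bool b" using xw that by blast
      then have "i \<notin> D" using xD[of i] by (cases b) auto
      moreover from this xN[OF that(1)] xi have "b = v i" by (cases b; cases "v i") auto
      ultimately show ?thesis using y that xi by (auto simp: vface_def)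
    qed
    then show "y \<in> Y" using y by (auto simp: w cube_face_def vface_def)
  qed
  then have "vface n v (?T \<union> D) \<in> F" using down[OF Y(1) vface_in_cube_faces] by blast
  then show ?thesis using Dn by (auto simp: link_def dirs_def)
qed

lemma geom_memI:
  assumes T: "T \<in> dirs n F v" and y: "\<And>i. i \<notin> T \<Longrightarrow> y i = r i" "\<And>i. 0 \<le> y i \<and> y i \<le> 1"
  shows "y \<in> M"
proof -
  have "y \<in> face_box (vface n v T)"
    unfolding face_box_def
  proof (intro CollectI allI conjI impI)
    fix i b assume all: "\<forall>x\<in>vface n v T. x i = b"
    have vv: "v \<in> vface n v T" using v by (simp add: vface_def)
    show "y i = (if b then 1 else 0)"
    proof (cases "i \<in> T")
      case True
      \<comment> \<open>In a free direction both values occur among the vertices, so the box imposes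
        no condition.\<close>
      have "v(i := \<not> v i) \<in> vface n v T"
        using True dirs_subset[OF T] v by (auto simp: vface_def cube_verts_def)
      then have "(v(i := \<not> v i)) i = b" using all by blast
      then show ?thesis using all vv by auto
    next
      case False
      then show ?thesis using all vv y(1) by auto
    qed
  qed (use y in auto)
  then show ?thesis using T by (auto simp: geom_real_def dirs_def)
qed

lemma pt_in_M: "pt \<in> M"
  using D by (rule geom_memI) (auto simp: pt_def)

section \<open>Affine simplices with labelled vertices\<close>

lemma card_labset:
  assumes "T \<in> Lk" shows "card (labset T) = Suc (card D + card T)"
proof -
  have "finite T" using link_finite(2) assms by blast
  moreover have "finite D" using Dn finite_subset by blast
  moreover have "D \<inter> T = {}" using assms by (auto simp: link_def)
  ultimately have "card (Suc ` (D \<union> T)) = card D + card T" by (simp add: card_image card_Un_disjoint)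
  moreover have "finite (Suc ` (D \<union> T))" using \<open>finite T\<close> \<open>finite D\<close> by simp
  ultimately show ?thesis unfolding labset_def by (subst card_insert_disjoint) auto
qed

lemma labset_inj:
  assumes "labset T = labset T'" "T \<inter> D = {}" "T' \<inter> D = {}" shows "T = T'"
proof -
  have "Suc ` (D \<union> T) = Suc ` (D \<union> T')" using assms(1) unfolding labset_def by (metis Zero_not_Suc image_iff insert_ident)
  then have "D \<union> T = D \<union> T'" by (simp add: inj_image_eq_iff)
  then show ?thesis using assms by blast
qed

lemma enum_image:
  assumes "finite R" shows "(\<lambda>j. sorted_list_of_set R ! j) ` {..<card R} = R"
proof -
  have "set (sorted_list_of_set R) = R" "length (sorted_list_of_set R) = card R" using assms by auto
  then show ?thesis by (auto simp: set_conv_nth)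
qed

text \<open>Barycentric coordinates indexed by labels instead of positions in the sorted list. The
  coordinate i of the point depends only on \<open>u 0\<close> and \<open>u (Suc i)\<close>, so each
  coordinate can be examined alone.\<close>

lemma sx_coords:
  assumes R: "finite R" "card R = Suc p" and t: "t \<in> standard_simplex p"
  obtains u where "\<And>s. 0 \<le> u s" "\<And>s. s \<notin> R \<Longrightarrow> u s = 0" "sum u R = 1" "\<And>s. u s \<le> 1"
    "\<And>i. sx R t i = pt i - (if i \<in> D then u 0 / 4 else 0) + step i * u (Suc i)"
proof -
  let ?l = "\<lambda>j. sorted_list_of_set R ! j"
  define u where "u = (\<lambda>s. \<Sum>j\<le>p. if ?l j = s then t j else 0)"
  have t0: "\<And>j. 0 \<le> t j" and t1: "(\<Sum>j\<le>p. t j) = 1" using t by (auto simp: standard_simplex_def)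
  have lR: "?l ` {..p} = R" using enum_image[OF R(1)] R(2) by (simp add: lessThan_Suc_atMost)
  have u0: "0 \<le> u s" for s unfolding u_def by (intro sum_nonneg) (use t0 in auto)
  moreover have u1: "u s = 0" if "s \<notin> R" for s
    unfolding u_def by (intro sum.neutral) (use that lR in auto)
  moreover have s1: "sum u R = 1"
  proof -
    have "sum u R = (\<Sum>j\<le>p. \<Sum>s\<in>R. if ?l j = s then t j else 0)" unfolding u_def by (rule sum.swap)
    also have "\<dots> = (\<Sum>j\<le>p. t j)"
      by (intro sum.cong) (use lR R in auto)
    finally show ?thesis using t1 by simp
  qed
  moreover have "u s \<le> 1" for s
  proof (cases "s \<in> R")
    case True
    then show ?thesis using member_le_sum[of s R u] u0 R s1 by simp
  qed (simp add: u1)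
  moreover have "sx R t i = pt i - (if i \<in> D then u 0 / 4 else 0) + step i * u (Suc i)" for i
  proof -
    have "sx R t i = (\<Sum>j\<le>p. q (?l j) i * t j)"
      using t R(2) by (simp add: sx_def oriented_simplex_def)
    also have "\<dots> = (\<Sum>j\<le>p. pt i * t j - (if i \<in> D then (if ?l j = 0 then t j else 0) / 4 else 0)
         + step i * (if ?l j = Suc i then t j else 0))"
      by (intro sum.cong) (auto simp: q_def algebra_simps)
    also have "\<dots> = pt i * (\<Sum>j\<le>p. t j) - (if i \<in> D then u 0 / 4 else 0) + step i * u (Suc i)"
      unfolding u_def
      by (simp add: sum.distrib sum_subtractf sum_distrib_left sum_divide_distrib)
    finally show ?thesis using t1 by simp
  qed
  ultimately show ?thesis by (rule that)
qed

lemma finite_labset: "T \<in> Lk \<Longrightarrow> finite (labset T)"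
  using link_finite(2) finite_subset[OF Dn] by (simp add: labset_def)

lemma sx_in_M:
  assumes T: "T \<in> Lk" and R: "R \<subseteq> labset T" "card R = Suc p" and t: "t \<in> standard_simplex p"
  shows "sx R t \<in> M"
proof -
  have fR: "finite R" using finite_labset[OF T] R(1) finite_subset by blast
  obtain u where u: "\<And>s. 0 \<le> u s" "\<And>s. s \<notin> R \<Longrightarrow> u s = 0" "\<And>s. u s \<le> 1"
    "\<And>i. sx R t i = pt i - (if i \<in> D then u 0 / 4 else 0) + step i * u (Suc i)"
    using sx_coords[OF fR R(2) t] by metis
  have TD: "T \<union> D \<in> dirs n F v" using T by (simp add: link_def)
  show ?thesis
  proof (rule geom_memI[OF TD])
    fix i assume "i \<notin> T \<union> D"
    then have "u (Suc i) = 0" using u(2) R(1) by (auto simp: labset_def)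
    then show "sx R t i = r i" using u(4)[of i] \<open>i \<notin> T \<union> D\<close> by (simp add: pt_def)
  next
    fix i
    show "0 \<le> sx R t i \<and> sx R t i \<le> 1"
      unfolding u(4) using u(1)[of 0] u(3)[of 0] u(1)[of "Suc i"] u(3)[of "Suc i"]
      by (cases "v i") (auto simp: pt_def step_def)
  qed
qed

text \<open>At \<open>pt\<close> the weights of the labels \<open>Suc b\<close> with b in D all
  equal \<open>u 0\<close> and the weights of other directions vanish, so one missing label of
  \<open>labset {}\<close> would force all weights to be 0.\<close>

lemma sx_avoids_pt:
  assumes R: "finite R" "card R = Suc p" "R \<subseteq> labset T" and t: "t \<in> standard_simplex p"
    and miss: "0 \<notin> R \<or> (\<exists>b\<in>D. Suc b \<notin> R)"
  shows "sx R t \<noteq> pt"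
proof
  assume eq: "sx R t = pt"
  obtain u where u: "\<And>s. 0 \<le> u s" "\<And>s. s \<notin> R \<Longrightarrow> u s = 0" "sum u R = 1"
    "\<And>i. sx R t i = pt i - (if i \<in> D then u 0 / 4 else 0) + step i * u (Suc i)"
    using sx_coords[OF R(1,2) t] by metis
  have 1: "(if i \<in> D then u 0 / 4 else 0) = step i * u (Suc i)" for i
    using u(4)[of i] eq by simp
  have 2: "u (Suc b) = u 0" if "b \<in> D" for b using 1[of b] that by (simp add: step_def)
  have 3: "u (Suc c) = 0" if "c \<notin> D" for c using 1[of c] that by (cases "v c") (auto simp: step_def)
  have "u 0 = 0" using miss u(2) 2 by metis
  then have "u s = 0" for s using 2 3 by (metis not0_implies_Suc)
  then show False using u(3) by simp
qed

lemma singular_simplex_sx: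
  assumes "\<And>t. t \<in> standard_simplex p \<Longrightarrow> sx R t \<in> U" "card R = Suc p"
  shows "singular_simplex p (subtopology (powertop_real UNIV) U) (sx R)"
  by (rule simplicial_imp_singular_simplex) (use assms in \<open>auto simp: simplicial_simplex sx_def\<close>)

lemma q_inj: "q s = q s' \<Longrightarrow> s = s'"
proof -
  have step0: "step i \<noteq> 0" for i by (auto simp: step_def)
  have 1: "q (Suc c) \<noteq> q s" if "s \<noteq> Suc c" for c s
  proof
    assume "q (Suc c) = q s"
    then have "q (Suc c) c = q s c" by simp
    then show False using that step0[of c] by (auto simp: q_def step_def split: if_splits)
  qed
  then show "q s = q s' \<Longrightarrow> s = s'" by (metis not0_implies_Suc)
qed

text \<open>Mod 2 chains are sets of maps, so different label sets must give different maps, lest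
  simplices merge in \<open>realize\<close>.\<close>

lemma sx_inj:
  assumes "sx R = sx R'" "card R = Suc p" "card R' = Suc p"
  shows "R = R'"
proof -
  have fin: "finite R" "finite R'" using assms(2,3) by (metis card.infinite nat.distinct(1))+
  have "q (sorted_list_of_set R ! j) = q (sorted_list_of_set R' ! j)" if "j \<le> p" for j
    using assms that unfolding sx_def by (simp add: oriented_simplex_eq)
  then have "sorted_list_of_set R ! j = sorted_list_of_set R' ! j" if "j < Suc p" for j
    using q_inj that by auto
  then have "(\<lambda>j. sorted_list_of_set R ! j) ` {..<Suc p} = (\<lambda>j. sorted_list_of_set R' ! j) ` {..<Suc p}"
    by (intro image_cong) auto
  then show ?thesis using enum_image[OF fin(1)] enum_image[OF fin(2)] assms(2,3) by simp
qed

text \<open>Listing the labels in increasing order makes the affine simplices compatible with faces: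
  dropping a label keeps the order of the others.\<close>

lemma singular_face_sx:
  assumes R: "card R = Suc (Suc p)" and k: "k \<le> Suc p"
  shows "singular_face (Suc p) k (sx R) = sx (R - {sorted_list_of_set R ! k})"
proof -
  have fin: "finite R" using R by (metis card.infinite nat.distinct(1))
  let ?l = "sorted_list_of_set R" and ?R' = "R - {sorted_list_of_set R ! k}"
  have len: "length ?l = Suc (Suc p)" using R by simp
  have kR: "?l ! k \<in> R" using enum_image[OF fin] R k by auto
  have cR': "card ?R' = Suc p" using kR R fin by simp
  have "?l = take k ?l @ ?l ! k # drop (Suc k) ?l" using k len by (simp add: id_take_nth_drop)
  then have "remove1 (?l ! k) ?l = take k ?l @ drop (Suc k) ?l"
    using distinct_sorted_list_of_set[of R]
    by (metis distinct.simps(2) distinct_append not_distinct_conv_prefix remove1.simps(2) remove1_append)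
  then have l': "sorted_list_of_set ?R' = take k ?l @ drop (Suc k) ?l"
    using sorted_list_of_set_remove[OF fin] by simp
  have nth: "sorted_list_of_set ?R' ! j = (if j < k then ?l ! j else ?l ! Suc j)" if "j \<le> p" for j
    unfolding l' using that len k by (auto simp: nth_append)
  have "singular_face (Suc p) k (sx R) = oriented_simplex p (\<lambda>j. if j < k then q (?l ! j) else q (?l ! Suc j))"
    unfolding sx_def using R k by (simp add: singular_face_oriented_simplex)
  also have "\<dots> = sx ?R'"
    unfolding sx_def using cR' by (auto simp: oriented_simplex_eq nth)
  finally show ?thesis .
qed

section \<open>Simplicial chains of the link as relative cycles\<close>

definition realize :: "(nat set \<Rightarrow> bit) \<Rightarrow> ((nat \<Rightarrow> real) \<Rightarrow> nat \<Rightarrow> real) set" where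
  "realize c = (\<lambda>T. sx (labset T)) ` {T. c T \<noteq> 0}"

lemma sx_labset_inj:
  assumes "T \<in> Lk" "T' \<in> Lk" "card T = card T'" "sx (labset T) = sx (labset T')"
  shows "T = T'"
proof -
  have "labset T = labset T'" using sx_inj[OF assms(4)] card_labset assms(1,2,3) by metis
  then show ?thesis using labset_inj assms(1,2) by (auto simp: link_def)
qed

lemma chain2_realize:
  assumes "chain_on Lk i c" shows "chain2 (card D + i) X (realize c)"
  unfolding chain2_def
proof
  have sub: "{T. c T \<noteq> 0} \<subseteq> {T \<in> Lk. card T = i}" using assms by (auto simp: chain_on_def)
  then show "finite (realize c)" unfolding realize_def
    using link_finite(1) by (metis (no_types, lifting) finite_imageI finite_subset mem_Collect_eq subsetI)
  show "\<forall>f\<in>realize c. singular_simplex (card D + i) X f"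
  proof
    fix f assume "f \<in> realize c"
    then obtain T where T: "T \<in> Lk" "card T = i" "f = sx (labset T)" using sub by (auto simp: realize_def)
    then show "singular_simplex (card D + i) X f"
      using singular_simplex_sx sx_in_M[OF T(1)] card_labset[OF T(1)] by auto
  qed
qed

lemma realize_0 [simp]: "realize (\<lambda>T. 0) = {}"
  by (simp add: realize_def)

text \<open>A face opposite the label 0 or a label \<open>Suc b\<close> with b in D avoids
  \<open>pt\<close>. A face opposite a direction in T is \<open>sx (labset G)\<close> with G one
  element smaller; it occurs once for each a with \<open>c (insert a G) \<noteq> 0\<close>, an even
  number of times as c is a cycle, and so cancels.\<close>

lemma realize_rcycle:
  assumes c: "chain_on Lk i c" and cyc: "\<And>G. bd {..<n} c G = 0"
  shows "realize c \<in> rcycles2 (card D + i) X (M - {pt})"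
proof -
  let ?p = "card D + i"
  have ch: "chain2 ?p X (realize c)" by (rule chain2_realize[OF c])
  have cT: "T \<in> Lk \<and> card T = i \<and> card (labset T) = Suc ?p" if "c T \<noteq> 0" for T
    using c that card_labset by (auto simp: chain_on_def)
  have "chain2 (?p - 1) (subtopology X (M - {pt})) (bd2 ?p (realize c))"
  proof (cases ?p)
    case 0
    then show ?thesis by (simp add: bd2_def chain2_def)
  next
    case (Suc p)
    have "bd2 ?p (realize c) = red (chain_boundary ?p (lift (realize c)))"
      using bd2_red[of ?p "lift (realize c)"] ch by (simp add: chain2_def)
    then have X: "chain2 p X (bd2 ?p (realize c))"
      using chain2_red[OF singular_chain_boundary[OF singular_chain_lift[OF ch]]] Suc by simp
    have "g t \<in> M - {pt}" if g: "g \<in> bd2 ?p (realize c)" and t: "t \<in> standard_simplex p" for g t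
    proof -
      let ?B = "{(f, k). f \<in> realize c \<and> k \<le> ?p \<and> singular_face ?p k f = g}"
      have odd: "odd (card ?B)" using g Suc by (simp add: bd2_def)
      then have "?B \<noteq> {}" by (metis card.empty even_zero)
      then obtain T k where T: "c T \<noteq> 0" and k: "k \<le> ?p" "singular_face ?p k (sx (labset T)) = g"
        by (auto simp: realize_def)
      define s where "s = sorted_list_of_set (labset T) ! k"
      have fin: "finite (labset T)" using cT[OF T] finite_labset by blast
      have sR: "s \<in> labset T" using enum_image[OF fin] cT[OF T] k(1) by (auto simp: s_def)
      have gs: "g = sx (labset T - {s})"
        using singular_face_sx[of "labset T" p k] cT[OF T] k Suc by (simp add: s_def)
      have card: "card (labset T - {s}) = Suc p" using cT[OF T] sR fin Suc by simp
      have "g t \<in> M"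
        unfolding gs by (rule sx_in_M[OF _ _ card t]) (use cT[OF T] in auto)
      moreover have "g t \<noteq> pt"
      proof (cases "s = 0 \<or> (\<exists>b\<in>D. s = Suc b)")
        case True
        show ?thesis unfolding gs
          by (rule sx_avoids_pt[OF _ card _ t, of T]) (use True fin in auto)
      next
        case False
        then obtain a where a: "s = Suc a" "a \<in> T" "a \<notin> D" using sR by (auto simp: labset_def)
        define G where "G = T - {a}"
        have G: "G \<in> Lk" "a \<notin> G" using cT[OF T] link_down by (auto simp: G_def)
        have R: "labset T - {s} = labset G" using a by (auto simp: labset_def G_def)
        have fT: "finite T" using cT[OF T] link_finite by blast
        have cG: "Suc (card G) = i" using card_Suc_Diff1[OF fT a(2)] cT[OF T] by (simp add: G_def)
        have gG: "g = sx (labset G)" using gs R by simp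
        let ?A = "{a \<in> {..<n} - G. c (insert a G) \<noteq> 0}"
        have even: "even (card ?A)"
        proof -
          have "(0::bit) = (\<Sum>a\<in>{..<n} - G. c (insert a G))" using cyc[of G] by (simp add: bd_def)
          also have "\<dots> = (\<Sum>a\<in>?A. 1)" by (rule sum.mono_neutral_cong_right) auto
          also have "\<dots> = of_nat (card ?A)" by simp
          finally have "of_nat (card ?A) = (0::bit)" by (rule sym)
          then have "even (of_nat (card ?A) :: bit)" by (simp only: even_zero)
          then show ?thesis by (simp only: even_of_nat_iff)
        qed
        \<comment> \<open>\<open>bd2\<close> counts pairs of a simplex and a face index, so the
          simplex on \<open>insert a G\<close> is paired with the position of its label
          \<open>Suc a\<close>.\<close>
        define idx where "idx = (\<lambda>a. SOME k. k \<le> ?p \<and> sorted_list_of_set (labset (insert a G)) ! k = Suc a)"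
        have idx: "idx a \<le> ?p \<and> sorted_list_of_set (labset (insert a G)) ! idx a = Suc a" if "a \<in> ?A" for a
        proof -
          have l: "card (labset (insert a G)) = Suc ?p" "finite (labset (insert a G))"
            using cT finite_labset that by auto
          have "Suc a \<in> labset (insert a G)" by (simp add: labset_def)
          then have "\<exists>k. k \<le> ?p \<and> sorted_list_of_set (labset (insert a G)) ! k = Suc a"
            using enum_image[OF l(2)] l(1) by (metis (no_types, lifting) imageE lessThan_iff less_Suc_eq_le)
          then show ?thesis unfolding idx_def by (rule someI_ex)
        qed
        have "?B = (\<lambda>a. (sx (labset (insert a G)), idx a)) ` ?A"
        proof (intro equalityI subsetI)
          fix x assume "x \<in> ?B"
          then obtain T' k' where x: "x = (sx (labset T'), k')" "c T' \<noteq> 0" "k' \<le> ?p"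
             "singular_face ?p k' (sx (labset T')) = g" by (auto simp: realize_def)
          define s' where "s' = sorted_list_of_set (labset T') ! k'"
          have fin': "finite (labset T')" using cT[OF x(2)] finite_labset by blast
          have s'R: "s' \<in> labset T'" using enum_image[OF fin'] cT[OF x(2)] x(3) by (auto simp: s'_def)
          have "sx (labset T' - {s'}) = sx (labset G)"
            using singular_face_sx[of "labset T'" p k'] cT[OF x(2)] x Suc gG by (simp add: s'_def)
          moreover have "card (labset T' - {s'}) = Suc p" using cT[OF x(2)] s'R fin' Suc by simp
          moreover have "card (labset G) = Suc p" using card R by simp
          ultimately have eq: "labset T' - {s'} = labset G" by (rule sx_inj)
          then have s'G: "s' \<notin> labset G" by blast
          then obtain a' where a': "s' = Suc a'" "a' \<in> T'" "a' \<notin> D" "a' \<notin> G"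
            using s'R by (auto simp: labset_def)
          have "labset T' = insert s' (labset G)" unfolding eq[symmetric] using s'R by blast
          then have "labset T' = labset (insert a' G)" using a'(1) by (auto simp: labset_def)
          moreover have "T' \<inter> D = {}" using cT[OF x(2)] by (simp add: link_def)
          moreover have "insert a' G \<inter> D = {}" using a' G by (auto simp: link_def)
          ultimately have T': "T' = insert a' G" by (rule labset_inj)
          have a'A: "a' \<in> ?A" using a' x(2) T' cT[OF x(2)] link_finite(3)[of T'] by auto
          have "k' = idx a'"
          proof -
            have "sorted_list_of_set (labset T') ! idx a' = sorted_list_of_set (labset T') ! k'"
              using idx[OF a'A] a'(1) s'_def T' by simp
            moreover have "idx a' < length (sorted_list_of_set (labset T'))" "k' < length (sorted_list_of_set (labset T'))"
              using idx[OF a'A] x(3) cT[OF x(2)] by auto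
            ultimately show ?thesis by (simp add: nth_eq_iff_index_eq)
          qed
          then show "x \<in> (\<lambda>a. (sx (labset (insert a G)), idx a)) ` ?A" using a'A x(1) T' by auto
        next
          fix x assume "x \<in> (\<lambda>a. (sx (labset (insert a G)), idx a)) ` ?A"
          then obtain a' where a': "a' \<in> ?A" "x = (sx (labset (insert a' G)), idx a')" by auto
          have l: "insert a' G \<in> Lk" "card (labset (insert a' G)) = Suc ?p" using cT a' by auto
          then have "a' \<notin> D" by (auto simp: link_def)
          then have "labset (insert a' G) - {Suc a'} = labset G" using a' by (auto simp: labset_def)
          then have "singular_face ?p (idx a') (sx (labset (insert a' G))) = g"
            using singular_face_sx[of "labset (insert a' G)" p "idx a'"] l idx[OF a'(1)] Suc gG by simp
          then show "x \<in> ?B" using a' idx[OF a'(1)] by (auto simp: realize_def)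
        qed
        moreover have "inj_on (\<lambda>a. (sx (labset (insert a G)), idx a)) ?A"
        proof (rule inj_onI)
          fix x y assume xy: "x \<in> ?A" "y \<in> ?A"
            "(sx (labset (insert x G)), idx x) = (sx (labset (insert y G)), idx y)"
          have "c (insert x G) \<noteq> 0" "c (insert y G) \<noteq> 0" using xy(1,2) by blast+
          from cT[OF this(1)] cT[OF this(2)] xy(3) have "insert x G = insert y G"
            by (intro sx_labset_inj) auto
          then show "x = y" using xy by blast
        qed
        ultimately have "card ?B = card ?A" by (simp add: card_image)
        then show ?thesis using odd even by simp
      qed
      ultimately show ?thesis by simp
    qed
    then show ?thesis using X Suc by (auto simp: chain2_def singular_simplex_subtopology)
  qed
  with ch show ?thesis by (simp add: rcycles2_def)
qed

end


section \<open>Simplicial cycles that bound singular chains\<close>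

context star_point
begin

text \<open>In the directions of D only a shift upwards is recorded and the label 0 takes the rest,
  which matches \<open>q\<close>. In the other directions leaving v is recorded beyond a tolerance
  \<open>\<epsilon>\<close>, so that a small simplex with all the labels of \<open>labset {}\<close>
  comes near \<open>pt\<close>.\<close>

definition excess :: "real \<Rightarrow> (nat \<Rightarrow> real) \<Rightarrow> nat \<Rightarrow> real" where
  "excess \<epsilon> x c = (if c \<in> D then x c - 1/2 else \<bar>x c - r c\<bar> - \<epsilon>)"

definition lab :: "real \<Rightarrow> (nat \<Rightarrow> real) \<Rightarrow> nat" where
  "lab \<epsilon> x = (if \<exists>c<n. excess \<epsilon> x c > 0 then Suc (LEAST c. c < n \<and> excess \<epsilon> x c > 0) else 0)"

lemma lab_Suc: "lab \<epsilon> x = Suc c \<Longrightarrow> c < n \<and> excess \<epsilon> x c > 0"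
  unfolding lab_def by (metis (mono_tags, lifting) LeastI_ex Zero_not_Suc nat.inject)

lemma lab_0: "lab \<epsilon> x = 0 \<Longrightarrow> c < n \<Longrightarrow> excess \<epsilon> x c \<le> 0"
  unfolding lab_def by (metis Zero_not_Suc linorder_not_less)

lemma lab_le: "lab \<epsilon> x \<in> {..n}"
  using lab_Suc by (cases "lab \<epsilon> x") (auto simp: Suc_le_eq)

lemma lab_q:
  assumes \<epsilon>: "0 < \<epsilon>" "\<epsilon> < 1/2" and s: "s \<le> n"
  shows "lab \<epsilon> (q s) = s"
proof -
  have step: "i \<notin> D \<Longrightarrow> \<bar>step i\<bar> = 1/2" for i by (simp add: step_def)
  have ex: "excess \<epsilon> (q s) c > 0 \<longleftrightarrow> s = Suc c" for c
  proof (cases "c \<in> D")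
    case True
    then show ?thesis by (auto simp: excess_def q_def pt_def step_def)
  next
    case False
    then show ?thesis using step[OF False] \<epsilon> by (auto simp: excess_def q_def pt_def)
  qed
  show ?thesis
  proof (cases s)
    case 0
    then show ?thesis using ex by (auto simp: lab_def)
  next
    case (Suc c)
    then have "c < n" "excess \<epsilon> (q s) c > 0" using ex s by auto
    moreover have "(LEAST c. c < n \<and> excess \<epsilon> (q s) c > 0) = c"
      by (rule Least_equality) (use ex Suc calculation in auto)
    ultimately show ?thesis using Suc by (auto simp: lab_def)
  qed
qed

text \<open>The Sperner condition. If \<open>Suc c\<close> is not in R, direction c is not entered
  and cannot be the label. If 0 is not in R, a point labelled 0 would have every weight at most
  \<open>2 * \<epsilon>\<close>, and the at most n weights could not add up to 1; hence the bound on
  \<open>\<epsilon>\<close>.\<close>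

lemma lab_sx:
  assumes R: "finite R" "R \<subseteq> {..n}" "card R = Suc p" and t: "t \<in> standard_simplex p"
    and \<epsilon>: "0 < \<epsilon>" "2 * \<epsilon> * real n < 1"
  shows "lab \<epsilon> (sx R t) \<in> R"
proof (rule ccontr)
  assume notin: "lab \<epsilon> (sx R t) \<notin> R"
  obtain u where u: "\<And>s. 0 \<le> u s" "\<And>s. s \<notin> R \<Longrightarrow> u s = 0" "sum u R = 1"
    "\<And>i. sx R t i = pt i - (if i \<in> D then u 0 / 4 else 0) + step i * u (Suc i)"
    using sx_coords[OF R(1,3) t] by metis
  have step: "\<bar>step i * u (Suc i)\<bar> = u (Suc i) / 2" if "i \<notin> D" for i
    using u(1)[of "Suc i"] that by (simp add: abs_mult step_def)
  show False
  proof (cases "lab \<epsilon> (sx R t)")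
    case 0
    then have u0: "u 0 = 0" using notin u(2) by auto
    have "u s \<le> 2 * \<epsilon>" if "s \<in> {1..n}" for s
    proof -
      have "s = Suc (s - 1)" "s - 1 < n" using that by auto
      then obtain c where c: "s = Suc c" "c < n" by blast
      have "excess \<epsilon> (sx R t) c \<le> 0" by (rule lab_0[OF 0 c(2)])
      then show ?thesis
        using u0 c u(1)[of s] \<epsilon> step[of c] by (cases "c \<in> D") (auto simp: excess_def u(4) pt_def step_def)
    qed
    then have "sum u {1..n} \<le> of_nat (card {1..n}) * (2 * \<epsilon>)" by (rule sum_bounded_above)
    moreover have "sum u R \<le> sum u {..n}" using R u(1) by (intro sum_mono2) auto
    moreover have "sum u {..n} = sum u {1..n}"
      by (rule sum.mono_neutral_right) (use u0 in \<open>auto simp: Suc_le_eq\<close>)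
    ultimately show False using u(3) \<epsilon>(2) by (simp add: mult.commute mult.left_commute)
  next
    case (Suc c)
    then have "excess \<epsilon> (sx R t) c > 0" using lab_Suc by blast
    moreover have "u (Suc c) = 0" using Suc notin u(2) by auto
    ultimately show False using u(1)[of 0] \<epsilon> by (auto simp: excess_def u(4) pt_def split: if_splits)
  qed
qed

lemma labset_le: "T \<in> Lk \<Longrightarrow> labset T \<subseteq> {..n}"
  using link_finite(3)[of T] Dn by (auto simp: labset_def Suc_le_eq)

lemma sx_vtx:
  assumes "card R = Suc p" "j \<le> p" shows "sx R (vtx j) = q (sorted_list_of_set R ! j)"
proof
  fix i
  have "sx R (vtx j) i = (\<Sum>k\<le>p. q (sorted_list_of_set R ! k) i * (if k = j then 1 else 0))"
    using vtx_in_simplex[OF assms(2)] assms(1) by (simp add: sx_def oriented_simplex_def) (simp add: vtx_def)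
  also have "\<dots> = q (sorted_list_of_set R ! j) i"
    using assms(2) by (simp add: if_distrib cong: if_cong)
  finally show "sx R (vtx j) i = q (sorted_list_of_set R ! j) i" .
qed

text \<open>For T = G this is Sperner's lemma. Otherwise the points of the simplex have labels in
  \<open>labset T\<close> only, which has the same size as \<open>labset G\<close> without being
  equal to it.\<close>

lemma lcount_Sd_sx:
  assumes T: "T \<in> Lk" and G: "G \<in> Lk" "card G = card T"
    and \<epsilon>: "0 < \<epsilon>" "\<epsilon> < 1/2" "2 * \<epsilon> * real n < 1" and p: "p = card D + card T"
  shows "lcount (lab \<epsilon>) (labset G) p (Sd N p (frag_of (sx (labset T)))) = of_bool (T = G)"
proof -
  let ?R = "labset T"
  have R: "finite ?R" "card ?R = Suc p" "?R \<subseteq> {..n}"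
    using finite_labset[OF T] card_labset[OF T] labset_le[OF T] p by auto
  have "singular_simplex p X (sx ?R)"
    using singular_simplex_sx[OF _ R(2)] sx_in_M[OF T subset_refl R(2)] by blast
  then have ss: "singular_simplex p (powertop_real UNIV) (sx ?R)" by (simp add: singular_simplex_subtopology)
  have labs: "lab \<epsilon> (sx ?R t) \<in> ?R" if "t \<in> standard_simplex p" for t
    by (rule lab_sx[OF R(1,3,2) that \<epsilon>(1,3)])
  show ?thesis
  proof (cases "T = G")
    case True
    have "lcount (lab \<epsilon>) ?R p (Sd N p (frag_of (sx ?R))) = 1"
    proof (rule sperner[where L = "lab \<epsilon>", OF ss finite_atMost[of n] lab_le R(2) labs])
      fix k assume k: "p > 0" "k \<le> p"
      then obtain p' where p': "p = Suc p'" by (cases p) auto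
      let ?s = "sorted_list_of_set ?R ! k"
      have s: "?s \<in> ?R" using enum_image[OF R(1)] R(2) k(2) by auto
      have face: "singular_face p k (sx ?R) = sx (?R - {?s})"
        using singular_face_sx[of ?R p' k] R(2) k(2) p' by simp
      have "lab \<epsilon> (sx (?R - {?s}) t) \<in> ?R - {?s}" if "t \<in> standard_simplex p'" for t
        by (rule lab_sx[OF _ _ _ that \<epsilon>(1,3)]) (use R s p' in auto)
      then show "\<exists>s\<in>?R. \<forall>x\<in>standard_simplex (p - 1). lab \<epsilon> (singular_face p k (sx ?R) x) \<noteq> s"
        unfolding face using s p' by (intro bexI[of _ ?s]) auto
    next
      have "lab \<epsilon> (sx ?R (vtx j)) = sorted_list_of_set ?R ! j" if "j \<le> p" for j
      proof -
        have "sorted_list_of_set ?R ! j \<in> ?R" using enum_image[OF R(1)] R(2) that by auto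
        then show ?thesis using sx_vtx[OF R(2) that] lab_q[OF \<epsilon>(1,2)] R(3) by auto
      qed
      then have "labels (lab \<epsilon>) p (sx ?R) = (\<lambda>j. sorted_list_of_set ?R ! j) ` {..p}"
        unfolding labels_def by (intro image_cong) auto
      then show "labels (lab \<epsilon>) p (sx ?R) = ?R"
        using enum_image[OF R(1)] R(2) by (simp add: lessThan_Suc_atMost)
    qed
    then show ?thesis using True by simp
  next
    case False
    have "labset G \<noteq> ?R" using labset_inj[of G T] False T G by (auto simp: link_def)
    then have ns: "\<not> labset G \<subseteq> ?R"
      using card_subset_eq[OF R(1), of "labset G"] card_labset[OF G(1)] G(2) R(2) p by auto
    have sc: "singular_chain p (subtopology (powertop_real UNIV) {x. lab \<epsilon> x \<in> ?R}) (Sd N p (frag_of (sx ?R)))"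
      by (intro singular_chain_Sd) (use ss labs in \<open>auto simp: singular_chain_of singular_simplex_subtopology\<close>)
    have "lcount (lab \<epsilon>) (labset G) p (Sd N p (frag_of (sx ?R))) = 0"
      by (rule lcount_eq_0[OF sc _ ns]) simp
    then show ?thesis using False by simp
  qed
qed

lemma Sd_sum: "Sd N p (sum f I) = (\<Sum>i\<in>I. Sd N p (f i))"
proof (induction I rule: infinite_finite_induct)
  case (insert x I)
  then show ?case by (simp add: Sd_add)
qed auto

text \<open>Counting labels is a left inverse of \<open>realize\<close>, after any number of
  subdivisions.\<close>

lemma lcount_Sd_realize:
  assumes c: "chain_on Lk i c" and G: "G \<in> Lk" "card G = i"
    and \<epsilon>: "0 < \<epsilon>" "\<epsilon> < 1/2" "2 * \<epsilon> * real n < 1" and p: "p = card D + i"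
  shows "lcount (lab \<epsilon>) (labset G) p (Sd N p (lift (realize c))) = c G"
proof -
  let ?C = "{T. c T \<noteq> 0}"
  have C: "T \<in> Lk \<and> card T = i" if "T \<in> ?C" for T using c that by (auto simp: chain_on_def)
  have "?C \<subseteq> Lk" using C by blast
  then have fin: "finite ?C" using link_finite(1) finite_subset by blast
  have inj: "inj_on (\<lambda>T. sx (labset T)) ?C"
  proof (rule inj_onI)
    fix S T assume "S \<in> ?C" "T \<in> ?C" "sx (labset S) = sx (labset T)"
    then show "S = T" using sx_labset_inj[of S T] C[of S] C[of T] by simp
  qed
  have "lift (realize c) = (\<Sum>T\<in>?C. frag_of (sx (labset T)))"
    unfolding lift_def realize_def using sum.reindex[OF inj, of frag_of] by (simp add: comp_def)
  then have "lcount (lab \<epsilon>) (labset G) p (Sd N p (lift (realize c)))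
     = (\<Sum>T\<in>?C. lcount (lab \<epsilon>) (labset G) p (Sd N p (frag_of (sx (labset T)))))"
    by (simp add: Sd_sum lcount_def eval2_sum)
  also have "\<dots> = (\<Sum>T\<in>?C. of_bool (T = G))"
  proof (rule sum.cong[OF refl])
    fix T assume "T \<in> ?C"
    from C[OF this] show "lcount (lab \<epsilon>) (labset G) p (Sd N p (frag_of (sx (labset T)))) = of_bool (T = G)"
      by (intro lcount_Sd_sx[OF _ G(1) _ \<epsilon>]) (use G p in auto)
  qed
  also have "\<dots> = (\<Sum>T\<in>?C. if T = G then 1 else 0)" by (intro sum.cong) auto
  also have "\<dots> = c G" using fin by (cases "c G") auto
  finally show ?thesis .
qed

section \<open>Small simplices and compactness\<close>

definition nbhd :: "real \<Rightarrow> (nat \<Rightarrow> real) \<Rightarrow> (nat \<Rightarrow> real) set" where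
  "nbhd \<delta> x = {y \<in> M. \<forall>k<n. \<bar>y k - x k\<bar> < \<delta>}"

lemma openin_X_Collect:
  assumes "open {y :: nat \<Rightarrow> real. P y}" shows "openin X {y \<in> M. P y}"
proof -
  have "openin X ({y. P y} \<inter> M)"
    using assms by (intro openin_subtopology_Int) (simp add: euclidean_product_topology)
  moreover have "{y. P y} \<inter> M = {y \<in> M. P y}" by auto
  ultimately show ?thesis by simp
qed

lemma open_coord_less:
  "open {y :: nat \<Rightarrow> real. \<forall>k\<in>K. \<bar>y k - x k\<bar> < e}" if "finite K" for K :: "nat set"
proof -
  have "open {y :: nat \<Rightarrow> real. \<bar>y k - x k\<bar> < e}" for k
    by (intro open_Collect_less continuous_intros continuous_on_product_coordinates)
  then have "open (\<Inter>k\<in>K. {y :: nat \<Rightarrow> real. \<bar>y k - x k\<bar> < e})" using that by (intro open_INT) auto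
  moreover have "(\<Inter>k\<in>K. {y :: nat \<Rightarrow> real. \<bar>y k - x k\<bar> < e}) = {y. \<forall>k\<in>K. \<bar>y k - x k\<bar> < e}" by auto
  ultimately show ?thesis by simp
qed

lemma openin_nbhd: "openin X (nbhd \<delta> x)"
proof -
  have "{y. \<forall>k<n. \<bar>y k - x k\<bar> < \<delta>} = {y. \<forall>k\<in>{..<n}. \<bar>y k - x k\<bar> < \<delta>}" by auto
  then show ?thesis
    unfolding nbhd_def using open_coord_less[of "{..<n}" x \<delta>] by (intro openin_X_Collect) simp
qed

text \<open>The point is the vertex labelled 0. It exceeds no threshold, but a vertex labelled
  \<open>Suc c\<close> exceeds the threshold in direction c and is closer than
  \<open>2 * \<delta>\<close> to it in every coordinate below n.\<close>

lemma small_simplex_labels: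
  assumes f: "f \<in> standard_simplex p \<rightarrow> nbhd \<delta> x" and labs: "labels (lab \<epsilon>) p f = labset T"
    and T: "T \<subseteq> {..<n} - D" and \<delta>: "0 < \<delta>"
  obtains t where "t \<in> standard_simplex p" "f t \<in> M"
    "\<And>b. b \<in> D \<Longrightarrow> 1/2 - 2 * \<delta> < f t b \<and> f t b \<le> 1/2"
    "\<And>c. c < n \<Longrightarrow> c \<notin> D \<Longrightarrow> \<bar>f t c - r c\<bar> \<le> \<epsilon>"
    "\<And>c. c \<in> T \<Longrightarrow> \<bar>f t c - r c\<bar> > \<epsilon> - 2 * \<delta>"
proof -
  have ex: "\<exists>j\<le>p. lab \<epsilon> (f (vtx j)) = s" if "s \<in> labset T" for s
  proof -
    have "s \<in> (\<lambda>j. lab \<epsilon> (f (vtx j))) ` {..p}" using that labs by (simp add: labels_def)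
    then show ?thesis by auto
  qed
  have fM: "f (vtx j) \<in> M" "\<And>k. k < n \<Longrightarrow> \<bar>f (vtx j) k - x k\<bar> < \<delta>" if "j \<le> p" for j
    using f vtx_in_simplex[OF that] by (auto simp: nbhd_def)
  obtain j0 where j0: "j0 \<le> p" "lab \<epsilon> (f (vtx j0)) = 0" using ex[of 0] by (auto simp: labset_def)
  have close: "\<bar>f (vtx j0) k - f (vtx j) k\<bar> < 2 * \<delta>" if "j \<le> p" "k < n" for j k
    using fM(2)[OF j0(1) that(2)] fM(2)[OF that] by linarith
  have above: "\<exists>j\<le>p. excess \<epsilon> (f (vtx j)) c > 0" if "c \<in> D \<union> T" for c
    using ex[of "Suc c"] that lab_Suc by (auto simp: labset_def)
  show ?thesis
  proof (rule that[of "vtx j0"])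
    fix b assume b: "b \<in> D"
    then obtain j where j: "j \<le> p" "excess \<epsilon> (f (vtx j)) b > 0" using above by blast
    have bn: "b < n" using b Dn by auto
    show "1/2 - 2 * \<delta> < f (vtx j0) b \<and> f (vtx j0) b \<le> 1/2"
      using lab_0[OF j0(2) bn] close[OF j(1) bn] j(2) b by (auto simp: excess_def)
  next
    fix c assume "c < n" "c \<notin> D"
    then show "\<bar>f (vtx j0) c - r c\<bar> \<le> \<epsilon>" using lab_0[OF j0(2), of c] by (simp add: excess_def)
  next
    fix c assume c: "c \<in> T"
    then obtain j where j: "j \<le> p" "excess \<epsilon> (f (vtx j)) c > 0" using above by blast
    have cn: "c < n" "c \<notin> D" using c T by auto
    show "\<bar>f (vtx j0) c - r c\<bar> > \<epsilon> - 2 * \<delta>"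
      using close[OF j(1) cn(1)] j(2) cn(2) by (auto simp: excess_def)
  qed (use fM j0 vtx_in_simplex in auto)
qed

lemma avoids_nbhd:
  assumes a: "chain2 p (subtopology X (M - {pt})) a"
  obtains \<rho> where "\<rho> > 0" "\<And>f t. f \<in> a \<Longrightarrow> t \<in> standard_simplex p \<Longrightarrow> \<exists>k<n. \<bar>f t k - pt k\<bar> > \<rho>"
proof -
  have "\<exists>\<rho>>0. \<forall>t\<in>standard_simplex p. \<exists>k<n. \<bar>f t k - pt k\<bar> > \<rho>" if "f \<in> a" for f
  proof -
    have f: "singular_simplex p (subtopology X (M - {pt})) f" using a that by (simp add: chain2_def)
    then have fM: "f t \<in> M" "f t \<noteq> pt" if "t \<in> standard_simplex p" for t
      using that by (auto simp: singular_simplex_subtopology)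
    have "singular_simplex p (powertop_real UNIV) f" using f by (simp add: singular_simplex_subtopology)
    then have cont: "continuous_on (standard_simplex p) (\<lambda>t. \<Sum>k<n. \<bar>f t k - pt k\<bar>)" (is "continuous_on _ ?m")
      unfolding singular_simplex_euclidean by (intro continuous_intros) blast
    have pos: "?m t > 0" if t: "t \<in> standard_simplex p" for t
    proof -
      obtain k where k: "f t k \<noteq> pt k" using fM(2)[OF t] by blast
      have "k < n"
      proof (rule ccontr)
        assume "\<not> k < n"
        then have "f t k = 0" "pt k = 0" using geom_bounds(3)[OF fM(1)[OF t]] geom_bounds(3)[OF pt_in_M] by auto
        then show False using k by simp
      qed
      then show ?thesis using k by (intro sum_pos2[of _ k]) auto
    qed
    obtain t0 where t0: "t0 \<in> standard_simplex p" "\<And>t. t \<in> standard_simplex p \<Longrightarrow> ?m t0 \<le> ?m t"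
      using continuous_attains_inf[OF compact_standard_simplex nonempty_standard_simplex cont] by blast
    \<comment> \<open>If all n coordinates deviated by at most this number, the sum of the
      deviations would stay below its minimum \<open>?m t0\<close>.\<close>
    define \<rho> where "\<rho> = ?m t0 / (n + 1)"
    have m0: "?m t0 > 0" by (rule pos[OF t0(1)])
    have "\<exists>k<n. \<bar>f t k - pt k\<bar> > \<rho>" if t: "t \<in> standard_simplex p" for t
    proof (rule ccontr)
      assume "\<not> ?thesis"
      then have "\<bar>f t k - pt k\<bar> \<le> \<rho>" if "k \<in> {..<n}" for k
        using that by (metis lessThan_iff linorder_not_less)
      then have "?m t \<le> of_nat (card {..<n}) * \<rho>" by (rule sum_bounded_above)
      also have "\<dots> = ?m t0 * (n / (n + 1))" by (simp add: \<rho>_def)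
      also have "\<dots> < ?m t0 * 1" using m0 by (intro mult_strict_left_mono) auto
      finally show False using t0(2)[OF t] by simp
    qed
    moreover have "\<rho> > 0" using m0 by (simp add: \<rho>_def)
    ultimately show ?thesis by blast
  qed
  then obtain \<rho> where \<rho>: "\<And>f. f \<in> a \<Longrightarrow> \<rho> f > (0::real)"
     "\<And>f t. f \<in> a \<Longrightarrow> t \<in> standard_simplex p \<Longrightarrow> \<exists>k<n. \<bar>f t k - pt k\<bar> > \<rho> f" by metis
  have fin: "finite (insert 1 (\<rho> ` a))" using a by (simp add: chain2_def)
  show ?thesis
  proof (rule that[of "Min (insert 1 (\<rho> ` a))"])
    show "Min (insert 1 (\<rho> ` a)) > 0" using fin \<rho>(1) by (subst Min_gr_iff) auto
    fix f t assume f: "f \<in> a" "t \<in> standard_simplex p"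
    then obtain k where k: "k < n" "\<bar>f t k - pt k\<bar> > \<rho> f" using \<rho>(2) by blast
    moreover have "Min (insert 1 (\<rho> ` a)) \<le> \<rho> f" using fin f by (intro Min_le) auto
    ultimately show "\<exists>k<n. \<bar>f t k - pt k\<bar> > Min (insert 1 (\<rho> ` a))"
      by (intro exI[of _ k]) linarith
  qed
qed

text \<open>Label counting turns the singular chain e into the simplicial chain y, and its boundary
  into c + c'. Two facts about small simplices carrying exactly the labels of
  \<open>labset T\<close> make this work: inside M they force T into \<open>Lk\<close>, so y loses
  nothing by being restricted to the link, and away from \<open>pt\<close> there are none, so a is
  not seen.\<close>

theorem realize_homologous_imp_boundary:
  assumes c: "chain_on Lk i c" "chain_on Lk i c'"
    and hom: "rhomologous2 (card D + i) X (M - {pt}) (realize c) (realize c')"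
  shows "\<exists>y. chain_on Lk (Suc i) y \<and> bd {..<n} y = (\<lambda>T. c T + c' T)"
proof -
  let ?p = "card D + i"
  obtain e a where e: "chain2 (Suc ?p) X e" and a: "chain2 ?p (subtopology X (M - {pt})) a"
    and ea: "symdiff (realize c) (realize c') = symdiff (bd2 (Suc ?p) e) a"
    using hom unfolding rhomologous2_def by blast
  have aX: "chain2 ?p X a" using a by (simp add: chain2_def singular_simplex_subtopology)
  define z where "z = lift (realize c) + lift (realize c')"
  have "finite (realize c)" "finite (realize c')" "finite e" "finite a"
    using chain2_realize[OF c(1)] chain2_realize[OF c(2)] e a by (auto simp: chain2_def)
  then have "red z = red (chain_boundary (Suc ?p) (lift e) + lift a)"
    using ea by (simp add: z_def red_add flip: bd2_red)
  then have "red (z - (chain_boundary (Suc ?p) (lift e) + lift a)) = {}" by (simp only: red_diff symdiff_empty)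
  then obtain w where w: "z - (chain_boundary (Suc ?p) (lift e) + lift a) = frag_cmul 2 w"
    by (rule red_eq_empty_imp)
  then have zeq: "z = chain_boundary (Suc ?p) (lift e) + lift a + frag_cmul 2 w"
    by (simp add: algebra_simps)
  obtain \<rho> where \<rho>: "\<rho> > 0" "\<And>f t. f \<in> a \<Longrightarrow> t \<in> standard_simplex ?p \<Longrightarrow> \<exists>k<n. \<bar>f t k - pt k\<bar> > \<rho>"
    using avoids_nbhd[OF a] by blast
  \<comment> \<open>The bound \<open>\<rho>\<close> keeps the simplices of a outside the tolerance
    range; the other bound gives \<open>2 * \<epsilon> * n < 1\<close> for \<open>lab_sx\<close> and
    \<open>\<epsilon> < 1/2\<close> for \<open>lab_q\<close>.\<close>
  define \<epsilon> where "\<epsilon> = min \<rho> (1 / (2 * n + 3))"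
  have \<epsilon>: "0 < \<epsilon>" "\<epsilon> < 1/2" "2 * \<epsilon> * real n < 1" "\<epsilon> \<le> \<rho>"
  proof -
    have le: "\<epsilon> \<le> 1 / (2 * real n + 3)" by (simp add: \<epsilon>_def)
    have "1 / (2 * real n + 3) < 1/2" by (simp add: divide_simps)
    then show "\<epsilon> < 1/2" using le by linarith
    have "\<epsilon> * n \<le> 1 / (2 * real n + 3) * n" using le by (intro mult_right_mono) auto
    also have "\<dots> < 1/2" by (simp add: divide_simps)
    finally show "2 * \<epsilon> * real n < 1" by simp
  qed (use \<rho> in \<open>auto simp: \<epsilon>_def\<close>)
  \<comment> \<open>With \<open>2 * \<delta> < \<epsilon>\<close>, a direction recorded at a
    neighbouring vertex is still left by the vertex labelled 0, and the coordinates of that vertex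
    in D differ from 1/2 by less than \<open>\<rho>\<close>.\<close>
  define \<delta> where "\<delta> = \<epsilon> / 4"
  have \<delta>: "0 < \<delta>" "\<epsilon> = 4 * \<delta>" using \<epsilon> by (auto simp: \<delta>_def)
  let ?C = "range (nbhd \<delta>)"
  have op: "\<forall>U\<in>?C. openin X U" using openin_nbhd by blast
  have "x \<in> nbhd \<delta> x" if "x \<in> M" for x using that \<delta> by (simp add: nbhd_def)
  then have cov: "topspace X \<subseteq> \<Union>?C" by auto
  obtain N1 where N1: "\<forall>m\<ge>N1. \<forall>f\<in>Poly_Mapping.keys (Sd m (Suc ?p) (lift e)). \<exists>U\<in>?C. f \<in> standard_simplex (Suc ?p) \<rightarrow> U"
    using fine_subdivision[OF op cov singular_chain_lift[OF e]] by (rule exE)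
  obtain N2 where N2: "\<forall>m\<ge>N2. \<forall>f\<in>Poly_Mapping.keys (Sd m ?p (lift a)). \<exists>U\<in>?C. f \<in> standard_simplex ?p \<rightarrow> U"
    using fine_subdivision[OF op cov singular_chain_lift[OF aX]] by (rule exE)
  define N where "N = max N1 N2"
  define L where "L = lab \<epsilon>"
  have A: "finite {..n}" "\<And>x. L x \<in> {..n}" using lab_le by (auto simp: L_def)
  have outside: "lcount L (labset T) (Suc ?p) (Sd N (Suc ?p) (lift e)) = 0"
    if T: "T \<subseteq> {..<n} - D" "T \<notin> Lk" for T
    unfolding lcount_def
  proof (rule eval2_eq_0)
    fix f assume "f \<in> Poly_Mapping.keys (Sd N (Suc ?p) (lift e))"
    then obtain x where f: "f \<in> standard_simplex (Suc ?p) \<rightarrow> nbhd \<delta> x" using N1 N_def by (metis max.cobounded1 imageE)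
    show "of_bool (labels L (Suc ?p) f = labset T) = (0::bit)"
    proof (rule ccontr)
      assume "\<not> ?thesis"
      then have "labels (lab \<epsilon>) (Suc ?p) f = labset T" by (simp add: L_def)
      then obtain t where t: "f t \<in> M"
        "\<And>b. b \<in> D \<Longrightarrow> 1/2 - 2 * \<delta> < f t b \<and> f t b \<le> 1/2"
        "\<And>c. c < n \<Longrightarrow> c \<notin> D \<Longrightarrow> \<bar>f t c - r c\<bar> \<le> \<epsilon>"
        "\<And>c. c \<in> T \<Longrightarrow> \<bar>f t c - r c\<bar> > \<epsilon> - 2 * \<delta>"
        using small_simplex_labels[OF f _ T(1) \<delta>(1)] by metis
      have "{c. c < n \<and> c \<notin> D \<and> f t c \<noteq> r c} \<in> Lk"
        by (rule geom_carrier[OF t(1)]) (use t \<epsilon> \<delta> in force)+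
      moreover have "T \<subseteq> {c. c < n \<and> c \<notin> D \<and> f t c \<noteq> r c}" using t(4) T(1) \<delta> by fastforce
      ultimately show False using link_down T(2) by blast
    qed
  qed
  have away: "lcount L (labset T) ?p (Sd N ?p (lift a)) = 0" if T: "T \<subseteq> {..<n} - D" for T
    unfolding lcount_def
  proof (rule eval2_eq_0)
    fix f assume fk: "f \<in> Poly_Mapping.keys (Sd N ?p (lift a))"
    then obtain x where f: "f \<in> standard_simplex ?p \<rightarrow> nbhd \<delta> x" using N2 N_def by (metis max.cobounded2 imageE)
    let ?U = "{y. \<exists>k<n. \<bar>y k - pt k\<bar> > \<rho>}"
    have "singular_chain ?p (subtopology (powertop_real UNIV) ?U) (Sd N ?p (lift a))"
    proof (rule singular_chain_Sd)
      have "chain2 ?p (subtopology (powertop_real UNIV) ?U) a"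
        using a \<rho>(2) by (auto simp: chain2_def singular_simplex_subtopology)
      then show "singular_chain ?p (subtopology (powertop_real UNIV) ?U) (lift a)" by (rule singular_chain_lift)
    qed
    then have fU: "f t \<in> ?U" if "t \<in> standard_simplex ?p" for t
      using fk that unfolding singular_chain_subtopology by blast
    show "of_bool (labels L ?p f = labset T) = (0::bit)"
    proof (rule ccontr)
      assume "\<not> ?thesis"
      then have "labels (lab \<epsilon>) ?p f = labset T" by (simp add: L_def)
      then obtain t where t: "t \<in> standard_simplex ?p"
        "\<And>b. b \<in> D \<Longrightarrow> 1/2 - 2 * \<delta> < f t b \<and> f t b \<le> 1/2"
        "\<And>c. c < n \<Longrightarrow> c \<notin> D \<Longrightarrow> \<bar>f t c - r c\<bar> \<le> \<epsilon>"
        using small_simplex_labels[OF f _ T \<delta>(1)] by metis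
      obtain k where k: "k < n" "\<bar>f t k - pt k\<bar> > \<rho>" using fU[OF t(1)] by blast
      show False
      proof (cases "k \<in> D")
        case True
        then show False using t(2)[OF True] k \<epsilon> \<delta> by (auto simp: pt_def)
      next
        case False
        then show False using t(3)[OF k(1) False] k \<epsilon> by (auto simp: pt_def)
      qed
    qed
  qed
  define y where "y = (\<lambda>T. if T \<in> Lk \<and> card T = Suc i then lcount L (labset T) (Suc ?p) (Sd N (Suc ?p) (lift e)) else 0)"
  have "bd {..<n} y G = c G + c' G" for G
  proof (cases "G \<in> Lk \<and> card G = i")
    case True
    then have G: "G \<in> Lk" "card G = i" by auto
    have GN: "G \<subseteq> {..<n} - D" "finite G" using link_finite(2,3)[OF G(1)] by auto
    have cG: "card (labset G) = Suc ?p" using card_labset[OF G(1)] G(2) by simp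
    have "c G + c' G = lcount L (labset G) ?p (Sd N ?p z)"
      using lcount_Sd_realize[OF c(1) G \<epsilon>(1,2,3)] lcount_Sd_realize[OF c(2) G \<epsilon>(1,2,3)]
      by (simp add: z_def Sd_add L_def lcount_def eval2_add)
    also have "\<dots> = lcount L (labset G) ?p (Sd N ?p (chain_boundary (Suc ?p) (lift e)))"
      using away[OF GN(1)] unfolding zeq by (simp add: Sd_add Sd_cmul_2 lcount_def eval2_add)
    also have "Sd N ?p (chain_boundary (Suc ?p) (lift e)) = chain_boundary (Suc ?p) (Sd N (Suc ?p) (lift e))"
      using chain_boundary_Sd[OF singular_chain_lift[OF e], of N] by simp
    also have "lcount L (labset G) ?p (chain_boundary (Suc ?p) (Sd N (Suc ?p) (lift e)))
       = (\<Sum>s\<in>{..n} - labset G. lcount L (insert s (labset G)) (Suc ?p) (Sd N (Suc ?p) (lift e)))"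
      by (rule lcount_chain_boundary[OF A cG])
    \<comment> \<open>0 and the directions in D already belong to \<open>labset G\<close>, so only
      directions outside D can be added.\<close>
    also have "{..n} - labset G = Suc ` ({..<n} - D - G)"
    proof (intro equalityI subsetI)
      fix s assume "s \<in> {..n} - labset G"
      then show "s \<in> Suc ` ({..<n} - D - G)" by (cases s) (auto simp: labset_def)
    qed (auto simp: labset_def)
    also have "(\<Sum>s\<in>Suc ` ({..<n} - D - G). lcount L (insert s (labset G)) (Suc ?p) (Sd N (Suc ?p) (lift e)))
       = (\<Sum>a\<in>{..<n} - D - G. lcount L (insert (Suc a) (labset G)) (Suc ?p) (Sd N (Suc ?p) (lift e)))"
      by (simp add: sum.reindex)
    also have "\<dots> = (\<Sum>a\<in>{..<n} - D - G. y (insert a G))"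
    proof (rule sum.cong[OF refl])
      fix x assume x: "x \<in> {..<n} - D - G"
      have "insert (Suc x) (labset G) = labset (insert x G)" by (auto simp: labset_def)
      moreover have "card (insert x G) = Suc i" using GN(2) x G(2) by simp
      moreover have "insert x G \<subseteq> {..<n} - D" using GN x by auto
      ultimately show "lcount L (insert (Suc x) (labset G)) (Suc ?p) (Sd N (Suc ?p) (lift e)) = y (insert x G)"
        using outside[of "insert x G"] by (simp add: y_def)
    qed
    also have "\<dots> = bd {..<n} y G"
      unfolding bd_def
    proof (rule sum.mono_neutral_left)
      show "\<forall>x\<in>{..<n} - G - ({..<n} - D - G). y (insert x G) = 0" by (auto simp: y_def link_def)
    qed auto
    finally show ?thesis by simp
  next
    case False
    then have "c G = 0" "c' G = 0" using c unfolding chain_on_def by blast+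
    moreover have "y (insert x G) = 0" if "x \<in> {..<n} - G" for x
    proof (rule ccontr)
      assume "y (insert x G) \<noteq> 0"
      then have *: "insert x G \<in> Lk" "card (insert x G) = Suc i" by (auto simp: y_def split: if_splits)
      then have "G \<in> Lk" using link_down by blast
      moreover have "card G = i" using *(2) link_finite(2)[OF \<open>G \<in> Lk\<close>] that by simp
      ultimately show False using False by blast
    qed
    ultimately show ?thesis by (simp add: bd_def)
  qed
  moreover have "chain_on Lk (Suc i) y" by (auto simp: chain_on_def y_def)
  ultimately show ?thesis by blast
qed

end


section \<open>Vertex stars of cubical homology manifolds\<close>

lemma rhomologous2_refl: "rhomologous2 p X S c c"
  unfolding rhomologous2_def
  by (intro exI[of _ "{}"]) (simp add: chain2_def bd2_def)

lemma empty_in_rcycles2: "{} \<in> rcycles2 p X S"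
  by (simp add: rcycles2_def chain2_def bd2_def)

definition hclass :: "nat \<Rightarrow> 'a topology \<Rightarrow> 'a set \<Rightarrow> ((nat \<Rightarrow> real) \<Rightarrow> 'a) set \<Rightarrow> ((nat \<Rightarrow> real) \<Rightarrow> 'a) set set" where
  "hclass p X S c = {c' \<in> rcycles2 p X S. rhomologous2 p X S c c'}"

text \<open>By reflexivity c' lies in its own class, hence in that of c.\<close>

lemma hclass_eq_imp: "c' \<in> rcycles2 p X S \<Longrightarrow> hclass p X S c = hclass p X S c' \<Longrightarrow> rhomologous2 p X S c c'"
  using rhomologous2_refl[of p X S c'] unfolding hclass_def by blast

lemma rhom2_eq_hclass: "rhom2 p X S = hclass p X S ` rcycles2 p X S"
  by (simp add: rhom2_def hclass_def)

lemma rhomologous2_if_card_1: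
  assumes "card (rhom2 p X S) = 1" "c \<in> rcycles2 p X S" "c' \<in> rcycles2 p X S"
  shows "rhomologous2 p X S c c'"
proof -
  obtain h where "rhom2 p X S = {h}" using assms(1) by (rule card_1_singletonE)
  then have "hclass p X S c = hclass p X S c'" using assms(2,3) unfolding rhom2_eq_hclass by blast
  then show ?thesis by (rule hclass_eq_imp[OF assms(3)])
qed

lemma rhomologous2_pigeonhole:
  assumes "card (rhom2 p X S) = 2" "c1 \<in> rcycles2 p X S" "c2 \<in> rcycles2 p X S" "c3 \<in> rcycles2 p X S"
  shows "rhomologous2 p X S c1 c2 \<or> rhomologous2 p X S c1 c3 \<or> rhomologous2 p X S c2 c3"
proof (rule ccontr)
  let ?h = "hclass p X S"
  assume "\<not> ?thesis"
  then have not: "\<not> rhomologous2 p X S c1 c2" "\<not> rhomologous2 p X S c1 c3" "\<not> rhomologous2 p X S c2 c3"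
    by simp_all
  have "?h c1 \<noteq> ?h c2" using not(1) hclass_eq_imp[OF assms(3)] by blast
  moreover have "?h c1 \<noteq> ?h c3" using not(2) hclass_eq_imp[OF assms(4)] by blast
  moreover have "?h c2 \<noteq> ?h c3" using not(3) hclass_eq_imp[OF assms(4)] by blast
  ultimately have three: "card {?h c1, ?h c2, ?h c3} = 3" by simp
  have sub: "{?h c1, ?h c2, ?h c3} \<subseteq> rhom2 p X S" using assms(2-4) unfolding rhom2_eq_hclass by blast
  have "finite (rhom2 p X S)" using assms(1) by (metis card.infinite zero_neq_numeral)
  from card_mono[OF this sub] three assms(1) show False by simp
qed

context star_point
begin

lemma exact_at_link:
  assumes "card (rhom2 (card D + i) X (M - {pt})) = 1"
  shows "exact_at {..<n} Lk i"
  unfolding exact_at_def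
proof (intro allI impI, elim conjE)
  fix c assume c: "chain_on Lk i c" "\<forall>G. bd {..<n} c G = 0"
  have "rhomologous2 (card D + i) X (M - {pt}) (realize c) (realize (\<lambda>T. 0))"
    using rhomologous2_if_card_1[OF assms realize_rcycle[OF c(1)] empty_in_rcycles2] c(2) by simp
  from realize_homologous_imp_boundary[OF c(1) _ this]
  show "\<exists>y. chain_on Lk (Suc i) y \<and> bd {..<n} y = c" by simp
qed

text \<open>Among c, c' and 0 two are homologous because there are only two classes. They then
  differ by a boundary, and as there are no simplices with i + 1 elements, they are equal.\<close>

lemma top_cycle_unique:
  assumes two: "card (rhom2 (card D + i) X (M - {pt})) = 2"
    and dim: "\<And>T. T \<in> Lk \<Longrightarrow> card T \<le> i"
    and c: "chain_on Lk i c" "\<And>G. bd {..<n} c G = 0" "c T \<noteq> 0"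
    and c': "chain_on Lk i c'" "\<And>G. bd {..<n} c' G = 0" "c' T' \<noteq> 0"
  shows "c = c'"
proof -
  let ?H = "rhomologous2 (card D + i) X (M - {pt})"
  have eq: "a = b" if ab: "chain_on Lk i a" "chain_on Lk i b" "?H (realize a) (realize b)" for a b
  proof -
    obtain y where y: "chain_on Lk (Suc i) y" "bd {..<n} y = (\<lambda>T. a T + b T)"
      using realize_homologous_imp_boundary[OF ab] by blast
    have "y T = 0" for T
    proof (rule ccontr)
      assume "y T \<noteq> 0"
      then have "T \<in> Lk" "card T = Suc i" using y(1) unfolding chain_on_def by blast+
      then show False using dim[of T] by simp
    qed
    then have "bd {..<n} y G = 0" for G by (simp add: bd_def)
    then have "a G + b G = 0" for G using y(2) by metis
    then show ?thesis by (auto simp: bit_add_eq_0_iff)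
  qed
  have "?H (realize c) (realize c') \<or> ?H (realize c) (realize (\<lambda>T. 0)) \<or> ?H (realize c') (realize (\<lambda>T. 0))"
    using rhomologous2_pigeonhole[OF two realize_rcycle[OF c(1,2)] realize_rcycle[OF c'(1,2)] empty_in_rcycles2]
    by simp
  moreover have "c \<noteq> (\<lambda>T. 0)" "c' \<noteq> (\<lambda>T. 0)" using c(3) c'(3) by auto
  ultimately show ?thesis using eq[OF c(1) c'(1)] eq[OF c(1), of "\<lambda>T. 0"] eq[OF c'(1), of "\<lambda>T. 0"] by auto
qed

text \<open>If only one facet contains the ridge D, then near pt the complex is a half-space.\<close>

lemma card_rhom2_boundary_point:
  assumes a: "a \<in> {..<n} - D" "insert a D \<in> dirs n F v"
    and unique: "\<And>b. b \<in> {..<n} - D \<Longrightarrow> insert b D \<in> dirs n F v \<Longrightarrow> b = a"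
  shows "card (rhom2 (Suc (card D)) X (M - {pt})) = 1"
proof -
  let ?d = "Suc (card D)"
  \<comment> \<open>The open star of the face D. By \<open>geom_carrier\<close> a point of V leaves
    v only in directions of D and in a, so V is a product of open intervals and one half-open
    interval.\<close>
  define V where "V = {x \<in> M. (\<forall>b\<in>D. \<bar>x b - 1/2\<bar> < 1/2) \<and> (\<forall>c\<in>{..<n} - D. \<bar>x c - r c\<bar> < 1)}"
  have Vflat: "x c = r c" if x: "x \<in> V" and c: "c \<notin> D" "c \<noteq> a" for x c
  proof (cases "c < n")
    case True
    let ?T = "{c. c < n \<and> c \<notin> D \<and> x c \<noteq> r c}"
    have xM: "x \<in> M" using x by (simp add: V_def)
    have "0 < x b \<and> x b < 1" if "b \<in> D" for b
    proof -
      have "\<bar>x b - 1/2\<bar> < 1/2" using x that by (simp add: V_def)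
      then show ?thesis by linarith
    qed
    then have T: "?T \<in> Lk" by (rule geom_carrier[OF xM]) (use x in \<open>auto simp: V_def\<close>)
    show ?thesis
    proof (rule ccontr)
      assume "x c \<noteq> r c"
      then have "{c} \<in> Lk" using True c link_down[OF T, of "{c}"] by auto
      then have "insert c D \<in> dirs n F v" by (simp add: link_def)
      then show False using unique[of c] True c by auto
    qed
  next
    case False
    then show ?thesis using x geom_bounds(3)[of x c] v0[of c] by (simp add: V_def)
  qed
  have VI: "y \<in> V" if y: "\<And>b. b \<in> D \<Longrightarrow> \<bar>y b - 1/2\<bar> < 1/2" "\<And>c. c \<notin> D \<Longrightarrow> c \<noteq> a \<Longrightarrow> y c = r c"
    "0 \<le> y a" "y a \<le> 1" "\<bar>y a - r a\<bar> < 1" for y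
  proof -
    have "0 \<le> y i \<and> y i \<le> 1" for i
    proof (cases "i \<in> D")
      case True
      then show ?thesis using y(1)[of i] by linarith
    next
      case False
      then show ?thesis using y(2)[of i] y(3,4) by (cases "i = a") auto
    qed
    then have "y \<in> M" using y(2) by (intro geom_memI[OF a(2)]) auto
    moreover have "\<bar>y c - r c\<bar> < 1" if "c \<notin> D" for c using y(2)[of c] y(5) that by (cases "c = a") auto
    ultimately show ?thesis using y(1) by (simp add: V_def)
  qed
  have opV: "openin X V"
    unfolding V_def
  proof (rule openin_X_Collect)
    have "finite D" using finite_subset[OF Dn] by simp
    then have "open {y :: nat \<Rightarrow> real. \<forall>b\<in>D. \<bar>y b - 1/2\<bar> < 1/2}" by (rule open_coord_less)
    moreover have "open {y. \<forall>c\<in>{..<n} - D. \<bar>y c - r c\<bar> < 1}" by (rule open_coord_less) simp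
    ultimately show "open {x. (\<forall>b\<in>D. \<bar>x b - 1/2\<bar> < 1/2) \<and> (\<forall>c\<in>{..<n} - D. \<bar>x c - r c\<bar> < 1)}"
      by (rule open_Collect_conj)
  qed
  have ptV: "pt \<in> V" using a by (intro VI) (auto simp: pt_def)
  \<comment> \<open>The apex is moved from \<open>pt\<close> into the interior along a. As
    \<open>pt\<close> is extreme in that coordinate, no segment from w to a point of V other than
    \<open>pt\<close> passes through \<open>pt\<close>; so V without \<open>pt\<close> is
    star-shaped as well.\<close>
  define w where "w = pt(a := 1/2)"
  have star: "star_shaped w V"
    unfolding star_shaped_def
  proof (intro ballI allI impI)
    fix x t assume x: "x \<in> V" and t: "0 \<le> t" "t \<le> (1::real)"
    show "(\<lambda>i. t * w i + (1 - t) * x i) \<in> V"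
    proof (rule VI)
      fix b assume b: "b \<in> D"
      then have xb: "\<bar>x b - 1/2\<bar> < 1/2" using x by (simp add: V_def)
      have "w b = 1/2" using b a by (auto simp: w_def pt_def)
      then have "t * w b + (1 - t) * x b - 1/2 = (1 - t) * (x b - 1/2)" by (simp add: field_simps)
      moreover have "\<bar>(1 - t) * (x b - 1/2)\<bar> \<le> \<bar>x b - 1/2\<bar>"
        using t by (simp add: abs_mult mult_left_le_one_le)
      ultimately show "\<bar>t * w b + (1 - t) * x b - 1/2\<bar> < 1/2" using xb by simp
    next
      fix c assume c: "c \<notin> D" "c \<noteq> a"
      then have "x c = r c" "w c = r c" using Vflat[OF x] by (auto simp: w_def pt_def)
      then show "t * w c + (1 - t) * x c = r c" by (simp add: algebra_simps)
    next
      have xa: "0 \<le> x a" "x a \<le> 1" using x geom_bounds by (auto simp: V_def)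
      have wa: "w a = 1/2" by (simp add: w_def)
      show "0 \<le> t * w a + (1 - t) * x a" using t xa wa by simp
      show "t * w a + (1 - t) * x a \<le> 1" using t xa wa by (intro convex_bound_le) auto
      have "\<bar>x a - r a\<bar> < 1" using x a by (simp add: V_def)
      moreover have "\<bar>w a - r a\<bar> < 1" using wa by auto
      ultimately have "\<bar>t * (w a - r a) + (1 - t) * (x a - r a)\<bar> < 1"
        using t convex_bound_lt[of "\<bar>w a - r a\<bar>" 1 "\<bar>x a - r a\<bar>" t "1 - t"]
          abs_triangle_ineq[of "t * (w a - r a)" "(1 - t) * (x a - r a)"]
        by (simp add: abs_mult)
      then show "\<bar>t * w a + (1 - t) * x a - r a\<bar> < 1" by (simp add: algebra_simps)
    qed
  qed
  moreover have "star_shaped w (V - {pt})"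
    unfolding star_shaped_def
  proof (intro ballI allI impI DiffI)
    fix x t assume x: "x \<in> V - {pt}" and t: "0 \<le> t" "t \<le> (1::real)"
    let ?y = "\<lambda>i. t * w i + (1 - t) * x i"
    show "?y \<in> V" using star x t unfolding star_shaped_def by blast
    show "?y \<notin> {pt}"
    proof
      assume "?y \<in> {pt}"
      then have "?y = pt" by simp
      from fun_cong[OF this, of a] have "t * w a + (1 - t) * x a = pt a" .
      then have eq: "t / 2 + (1 - t) * x a = r a" using a by (simp add: w_def pt_def)
      have xa: "0 \<le> x a" "x a \<le> 1" using x geom_bounds by (auto simp: V_def)
      have t0: "t = 0"
      proof (cases "v a")
        case True
        have "(1 - t) * x a \<le> (1 - t) * 1" using t xa by (intro mult_left_mono) auto
        then show ?thesis using eq True t by simp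
      next
        case False
        have "0 \<le> (1 - t) * x a" using t xa by simp
        then show ?thesis using eq False t by simp
      qed
      then show False using x \<open>?y \<in> {pt}\<close> by simp
    qed
  qed
  ultimately have hom: "rhomologous2 ?d X (M - {pt}) c {}" if "c \<in> rcycles2 ?d X (M - {pt})" for c
    using rhomologous2_empty_if_star_shaped[OF opV ptV] that by blast
  have "hclass ?d X (M - {pt}) c = rcycles2 ?d X (M - {pt})" if c: "c \<in> rcycles2 ?d X (M - {pt})" for c
  proof -
    have "rhomologous2 ?d X (M - {pt}) c c'" if c': "c' \<in> rcycles2 ?d X (M - {pt})" for c'
      using hom[OF rcycles2_symdiff[OF c c']] by (simp add: rhomologous2_def)
    then show ?thesis by (auto simp: hclass_def)
  qed
  then have "rhom2 ?d X (M - {pt}) = {rcycles2 ?d X (M - {pt})}"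
    unfolding rhom2_eq_hclass using empty_in_rcycles2[of ?d X "M - {pt}"] by (auto simp: image_iff)
  then show ?thesis by simp
qed

section \<open>The facets containing a ridge\<close>

lemma bd_pair:
  fixes a b :: nat
  assumes ab: "a \<noteq> b" "a < n" "b < n"
  shows "bd {..<n} (\<lambda>T. of_bool (T = {a} \<or> T = {b})) G = 0"
proof (cases "G = {}")
  case True
  have "bd {..<n} (\<lambda>T. of_bool (T = {a} \<or> T = {b})) G = (\<Sum>x<n. of_bool (x = a \<or> x = b))"
    using True by (simp add: bd_def)
  also have "\<dots> = (\<Sum>x\<in>{a, b}. 1)"
    by (rule sum.mono_neutral_cong_right) (use ab in auto)
  finally show ?thesis using ab by simp
next
  case False
  then show ?thesis unfolding bd_def by (intro sum.neutral) auto
qed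

text \<open>With no facet the empty simplex would be a cycle of the link that bounds nothing. With a
  single facet \<open>pt\<close> is a boundary point, where the local homology is trivial. With
  three facets x, y, z the pairs x, y and y, z would be different top cycles.\<close>

lemma card_facets_of_ridge:
  assumes d: "Suc (card D) = d"
    and two: "card (rhom2 d X (M - {pt})) = 2" and one: "card (rhom2 (card D) X (M - {pt})) = 1"
    and dim: "\<And>T. T \<in> Lk \<Longrightarrow> card T \<le> 1"
  shows "card {a \<in> {..<n} - D. insert a D \<in> dirs n F v} = 2"
proof -
  let ?B = "{a \<in> {..<n} - D. insert a D \<in> dirs n F v}"
  have fin: "finite ?B" by simp
  have B_Lk: "{b} \<in> Lk" if "b \<in> ?B" for b using that by (auto simp: link_def)
  have "?B \<noteq> {}"
  proof
    assume B: "?B = {}"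
    define c :: "nat set \<Rightarrow> bit" where "c = (\<lambda>T. of_bool (T = {}))"
    have "chain_on Lk 0 c" using D by (auto simp: chain_on_def c_def link_def)
    moreover have "bd {..<n} c G = 0" for G by (simp add: bd_def c_def)
    moreover have "exact_at {..<n} Lk 0" by (rule exact_at_link) (use one in simp)
    ultimately obtain y where y: "chain_on Lk (Suc 0) y" "bd {..<n} y = c"
      unfolding exact_at_def by blast
    have "y {x} = 0" for x
    proof (rule ccontr)
      assume "y {x} \<noteq> 0"
      then have "{x} \<in> Lk" using y(1) unfolding chain_on_def by blast
      then have "x \<in> ?B" using link_finite(3)[of "{x}"] by (auto simp: link_def)
      then show False using B by blast
    qed
    then have "bd {..<n} y {} = 0" by (simp add: bd_def)
    then show False using y(2) by (simp add: c_def)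
  qed
  moreover have "card ?B \<noteq> 1"
  proof
    assume "card ?B = 1"
    then obtain a where a: "?B = {a}" by (rule card_1_singletonE)
    have "card (rhom2 (Suc (card D)) X (M - {pt})) = 1"
    proof (rule card_rhom2_boundary_point)
      show "a \<in> {..<n} - D" "insert a D \<in> dirs n F v" using a by blast+
      show "b = a" if "b \<in> {..<n} - D" "insert b D \<in> dirs n F v" for b using a that by blast
    qed
    then show False using two d by simp
  qed
  moreover have "\<not> card ?B \<ge> 3"
  proof
    assume "card ?B \<ge> 3"
    then obtain C where C: "C \<subseteq> ?B" "card C = 3" by (meson obtain_subset_with_card_n)
    then obtain x y z where xyz: "C = {x, y, z}" "x \<noteq> y" "x \<noteq> z" "y \<noteq> z" by (auto simp: card_3_iff)
    let ?c = "\<lambda>a b T. of_bool (T = {a} \<or> T = {b}) :: bit"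
    have B: "x \<in> ?B" "y \<in> ?B" "z \<in> ?B" using C(1) xyz(1) by auto
    have ch: "chain_on Lk 1 (?c a b)" if "a \<in> ?B" "b \<in> ?B" for a b
      using B_Lk[OF that(1)] B_Lk[OF that(2)] unfolding chain_on_def by auto
    have bd0: "bd {..<n} (?c a b) G = 0" if "a \<in> ?B" "b \<in> ?B" "a \<noteq> b" for a b G
      using bd_pair that by auto
    have eq: "?c x y = ?c y z"
      by (rule top_cycle_unique[of 1 _ "{y}" _ "{y}"]) (use two d dim ch bd0 B xyz in auto)
    show False using fun_cong[OF eq, of "{x}"] xyz by simp
  qed
  ultimately show ?thesis using fin card_0_eq[OF fin] by linarith
qed

end

text \<open>The homological clauses for S are read off from the local homology at the centre of the
  face through v with directions S.\<close>

theorem homology_sphere_dirs: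
  assumes F: "F \<subseteq> cube_faces n" and down: "\<And>X Y. X \<in> F \<Longrightarrow> Y \<in> cube_faces n \<Longrightarrow> Y \<subseteq> X \<Longrightarrow> Y \<in> F"
    and v: "v \<in> cube_verts n" "vface n v {} \<in> F"
    and man: "Z2_homology_manifold d (geom_real F)"
    and dim: "\<And>T. T \<in> dirs n F v \<Longrightarrow> card T \<le> d"
  shows "homology_sphere {..<n} (dirs n F v) d"
proof -
  have sp: "star_point n F v S" if "S \<in> dirs n F v" for S
    using F down v(1) that by (unfold_locales) blast+
  have e: "{} \<in> dirs n F v" using v(2) by (simp add: dirs_def)
  let ?X = "subtopology (powertop_real UNIV) (geom_real F)"
  have rh: "card (rhom2 i ?X (geom_real F - {star_point.pt v S})) = (if i = d then 2 else 1)" if "S \<in> dirs n F v" for S i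
    using man star_point.pt_in_M[OF sp[OF that]] unfolding Z2_homology_manifold_def by blast
  have fin: "finite S" if "S \<in> dirs n F v" for S using that finite_subset by (auto simp: dirs_def)
  have cardL: "card T + card S \<le> d" if "T \<in> link (dirs n F v) S" for T S
  proof -
    have *: "T \<union> S \<in> dirs n F v" "T \<inter> S = {}" using that by (auto simp: link_def)
    have "finite T" "finite S" using fin[OF *(1)] by auto
    then show ?thesis using dim[OF *(1)] card_Un_disjoint[of T S] *(2) by simp
  qed
  have ex: "exact_at {..<n} (link (dirs n F v) S) i" if "S \<in> dirs n F v" "i + card S \<noteq> d" for S i
    by (rule star_point.exact_at_link[OF sp[OF that(1)]]) (use rh[OF that(1)] that(2) in auto)
  have un: "c = c'" if S: "S \<in> dirs n F v" "i + card S = d"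
    and c: "chain_on (link (dirs n F v) S) i c" "chain_on (link (dirs n F v) S) i c'"
     "\<forall>G. bd {..<n} c G = 0" "\<forall>G. bd {..<n} c' G = 0" "\<exists>T. c T \<noteq> 0" "\<exists>T. c' T \<noteq> 0" for S i c c'
  proof -
    obtain T T' where T: "c T \<noteq> 0" "c' T' \<noteq> 0" using c(5,6) by blast
    have two: "card (rhom2 (card S + i) ?X (geom_real F - {star_point.pt v S})) = 2"
      using rh[OF S(1), of "card S + i"] S(2) by (simp add: add.commute)
    show ?thesis
    proof (rule star_point.top_cycle_unique[OF sp[OF S(1)] two _ c(1) _ T(1) c(2) _ T(2)])
      show "card T \<le> i" if "T \<in> link (dirs n F v) S" for T using cardL[OF that] S(2) by simp
    qed (use c(3,4) in blast)+
  qed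
  have tw: "card {a \<in> {..<n} - S. insert a S \<in> dirs n F v} = 2" if S: "S \<in> dirs n F v" "Suc (card S) = d" for S
  proof (rule star_point.card_facets_of_ridge[OF sp[OF S(1)] S(2)])
    show "card (rhom2 d ?X (geom_real F - {star_point.pt v S})) = 2" using rh[OF S(1)] by simp
    show "card (rhom2 (card S) ?X (geom_real F - {star_point.pt v S})) = 1" using rh[OF S(1)] S(2) by simp
    show "card T \<le> 1" if "T \<in> link (dirs n F v) S" for T using cardL[OF that] S(2) by simp
  qed
  have dn: "S \<in> dirs n F v" if "T \<in> dirs n F v" "S \<subseteq> T" for S T
    using star_point.dirs_down[OF sp[OF e] that] .
  show ?thesis
    unfolding homology_sphere_def
  proof (intro conjI ballI allI impI)
    show "dirs n F v \<subseteq> Pow {..<n}" by (auto simp: dirs_def)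
  qed (fact e | (rule dim; assumption) | (rule dn; assumption) | (rule tw; assumption)
      | (rule ex; assumption) | (rule un; assumption) | rule finite_lessThan)+
qed


section \<open>Relabelling homology spheres\<close>

text \<open>Two vertex links live on coordinates of different cubes and can be compared only after
  both are transported to one vertex set N. As all vertices of L' lie in the image of
  \<open>\<psi>\<close>, \<open>pull\<close> and \<open>push\<close> translate chains of the links
  in both directions, preserving cycles.\<close>

lemma homology_sphere_relabel:
  fixes N :: "'a set" and N' :: "'b set"
  assumes hs: "homology_sphere N' L' d" and N: "finite N" "inj_on \<psi> N" "\<psi> ` N \<subseteq> N'"
    and vert: "\<And>b. {b} \<in> L' \<Longrightarrow> b \<in> \<psi> ` N"
  shows "homology_sphere N {T. T \<subseteq> N \<and> \<psi> ` T \<in> L'} d"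
proof -
  note D = homology_sphereD[OF hs]
  define L where "L = {T. T \<subseteq> N \<and> \<psi> ` T \<in> L'}"
  define pull :: "('b set \<Rightarrow> bit) \<Rightarrow> 'a set \<Rightarrow> bit" where "pull c T = (if T \<subseteq> N then c (\<psi> ` T) else 0)" for c T
  define push :: "('a set \<Rightarrow> bit) \<Rightarrow> 'b set \<Rightarrow> bit" where "push c T = (if T \<subseteq> \<psi> ` N then c (N \<inter> \<psi> -` T) else 0)" for c T
  have inv1: "N \<inter> \<psi> -` (\<psi> ` T) = T" if "T \<subseteq> N" for T using that N(2) by (auto dest: inj_onD)
  have inv2: "\<psi> ` (N \<inter> \<psi> -` T) = T" if "T \<subseteq> \<psi> ` N" for T using that by auto
  have card: "card (\<psi> ` T) = card T" if "T \<subseteq> N" for T using that N(2) card_image inj_on_subset by metis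
  have L'N: "T \<subseteq> \<psi> ` N" if "T \<in> L'" for T using vert D(4)[OF that] by blast
  have linkN: "T \<subseteq> \<psi> ` N" if "T \<in> link L' S" for T S using L'N[of "T \<union> S"] that by (auto simp: link_def)
  have link: "T \<in> link L S \<longleftrightarrow> T \<subseteq> N \<and> \<psi> ` T \<in> link L' (\<psi> ` S)" if "S \<in> L" for T S
  proof -
    have S: "S \<subseteq> N" using that by (simp add: L_def)
    have "T \<inter> S = {} \<longleftrightarrow> \<psi> ` T \<inter> \<psi> ` S = {}" if "T \<subseteq> N"
      using inj_on_image_Int[OF N(2) that S] by blast
    then show ?thesis using S by (auto simp: link_def L_def image_Un)
  qed
  have pp: "pull (push c) = c" if "\<And>T. c T \<noteq> 0 \<Longrightarrow> T \<subseteq> N" for c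
  proof
    fix T show "pull (push c) T = c T"
      using that[of T] inv1[of T] by (cases "T \<subseteq> N") (auto simp: pull_def push_def)
  qed
  have bd_pull: "bd N (pull c) T = pull (bd N' c) T" if c: "\<And>T. c T \<noteq> 0 \<Longrightarrow> T \<subseteq> \<psi> ` N" for c T
  proof (cases "T \<subseteq> N")
    case True
    have "bd N (pull c) T = (\<Sum>a\<in>N - T. c (insert (\<psi> a) (\<psi> ` T)))"
      unfolding bd_def using True by (intro sum.cong) (auto simp: pull_def)
    also have "\<dots> = (\<Sum>b\<in>\<psi> ` (N - T). c (insert b (\<psi> ` T)))"
      using sum.reindex[OF inj_on_subset[OF N(2) Diff_subset[of N T]], of "\<lambda>b. c (insert b (\<psi> ` T))"]
      by (simp add: comp_def)
    also have "\<psi> ` (N - T) = \<psi> ` N - \<psi> ` T" using inj_on_image_set_diff[OF N(2), of N T] True by blast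
    also have "(\<Sum>b\<in>\<psi> ` N - \<psi> ` T. c (insert b (\<psi> ` T))) = bd N' c (\<psi> ` T)"
      unfolding bd_def
    proof (rule sum.mono_neutral_left)
      show "finite (N' - \<psi> ` T)" using D(1) by simp
      show "\<psi> ` N - \<psi> ` T \<subseteq> N' - \<psi> ` T" using N(3) by auto
      show "\<forall>i\<in>N' - \<psi> ` T - (\<psi> ` N - \<psi> ` T). c (insert i (\<psi> ` T)) = 0"
      proof
        fix i assume "i \<in> N' - \<psi> ` T - (\<psi> ` N - \<psi> ` T)"
        then have "\<not> insert i (\<psi> ` T) \<subseteq> \<psi> ` N" by blast
        then show "c (insert i (\<psi> ` T)) = 0" using c by blast
      qed
    qed
    finally show ?thesis using pull_def[of "bd N' c" T] True by (simp only: if_True)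
  qed (auto simp: pull_def bd_def intro!: sum.neutral)
  have chain_push: "chain_on (link L' (\<psi> ` S)) i (push c)" if S: "S \<in> L" and c: "chain_on (link L S) i c" for S i c
    unfolding chain_on_def
  proof (intro allI impI)
    fix T assume "push c T \<noteq> 0"
    then have T: "T \<subseteq> \<psi> ` N" "c (N \<inter> \<psi> -` T) \<noteq> 0" by (auto simp: push_def split: if_splits)
    have "N \<inter> \<psi> -` T \<in> link L S \<and> card (N \<inter> \<psi> -` T) = i" using c T(2) unfolding chain_on_def by blast
    then show "T \<in> link L' (\<psi> ` S) \<and> card T = i"
      using link[OF S] inv2[OF T(1)] card[of "N \<inter> \<psi> -` T"] by auto
  qed
  have supp: "T \<subseteq> N" if "S \<in> L" "chain_on (link L S) i c" "c T \<noteq> 0" for S i c T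
    using that link[OF that(1), of T] unfolding chain_on_def by blast
  have supp': "T \<subseteq> \<psi> ` N" if "chain_on (link L' S) i c" "c T \<noteq> 0" for S i c T
    using that linkN unfolding chain_on_def by blast
  have bd_push: "bd N' (push c) T = 0"
    if S: "S \<in> L" and c: "chain_on (link L S) i c" "\<And>G. bd N c G = 0" for S i c T
  proof (cases "T \<subseteq> \<psi> ` N")
    case True
    have "pull (bd N' (push c)) (N \<inter> \<psi> -` T) = bd N (pull (push c)) (N \<inter> \<psi> -` T)"
      using bd_pull[OF supp'[OF chain_push[OF S c(1)]]] by simp
    also have "pull (push c) = c" by (rule pp) (rule supp[OF S c(1)])
    finally have "pull (bd N' (push c)) (N \<inter> \<psi> -` T) = 0" using c(2) by simp
    then show ?thesis using inv2[OF True] by (simp add: pull_def)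
  next
    case False
    then show ?thesis unfolding bd_def push_def by (intro sum.neutral) auto
  qed
  have sub: "\<psi> ` S \<in> L'" if "S \<in> L" for S using that by (simp add: L_def)
  have cS: "card (\<psi> ` S) = card S" if "S \<in> L" for S using card that by (simp add: L_def)
  have ex: "exact_at N (link L S) i" if S: "S \<in> L" "i + card S \<noteq> d" for S i
    unfolding exact_at_def
  proof (intro allI impI, elim conjE)
    fix c assume c: "chain_on (link L S) i c" "\<forall>G. bd N c G = 0"
    have "exact_at N' (link L' (\<psi> ` S)) i" using D(7)[OF sub[OF S(1)]] cS[OF S(1)] S(2) by simp
    then obtain y where y: "chain_on (link L' (\<psi> ` S)) (Suc i) y" "bd N' y = push c"
      using chain_push[OF S(1) c(1)] bd_push[OF S(1) c(1)] c(2) unfolding exact_at_def by blast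
    have "bd N (pull y) = pull (bd N' y)" using bd_pull[OF supp'[OF y(1)]] by blast
    also have "\<dots> = c" unfolding y(2) by (rule pp) (rule supp[OF S(1) c(1)])
    finally have "bd N (pull y) = c" .
    moreover have "chain_on (link L S) (Suc i) (pull y)"
      unfolding chain_on_def
    proof (intro allI impI)
      fix T assume "pull y T \<noteq> 0"
      then have T: "T \<subseteq> N" "y (\<psi> ` T) \<noteq> 0" by (auto simp: pull_def split: if_splits)
      then have "\<psi> ` T \<in> link L' (\<psi> ` S) \<and> card (\<psi> ` T) = Suc i" using y(1) unfolding chain_on_def by blast
      then show "T \<in> link L S \<and> card T = Suc i" using link[OF S(1)] T(1) card[OF T(1)] by simp
    qed
    ultimately show "\<exists>y. chain_on (link L S) (Suc i) y \<and> bd N y = c" by blast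
  qed
  have un: "c = c'" if S: "S \<in> L" "i + card S = d"
    and c: "chain_on (link L S) i c" "chain_on (link L S) i c'"
     "\<forall>G. bd N c G = 0" "\<forall>G. bd N c' G = 0" "\<exists>T. c T \<noteq> 0" "\<exists>T. c' T \<noteq> 0" for S i c c'
  proof -
    have nz: "\<exists>T. push c T \<noteq> 0" if nc: "chain_on (link L S) i c" "\<exists>T. c T \<noteq> 0" for c
    proof -
      obtain T where T: "c T \<noteq> 0" using nc(2) by blast
      then have "T \<subseteq> N" by (rule supp[OF S(1) nc(1)])
      then have "push c (\<psi> ` T) = c T" using inv1 by (auto simp: push_def)
      then show ?thesis using T by metis
    qed
    obtain T T' where "push c T \<noteq> 0" "push c' T' \<noteq> 0" using nz c(1,2,5,6) by meson
    moreover have "i + card (\<psi> ` S) = d" using cS[OF S(1)] S(2) by simp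
    ultimately have "push c = push c'"
      using D(8)[OF sub[OF S(1)] _ chain_push[OF S(1) c(1)] chain_push[OF S(1) c(2)]]
        bd_push[OF S(1) c(1)] bd_push[OF S(1) c(2)] c(3,4) by blast
    then show ?thesis using pp[OF supp[OF S(1) c(1)]] pp[OF supp[OF S(1) c(2)]] by metis
  qed
  have tw: "card {a \<in> N - S. insert a S \<in> L} = 2" if S: "S \<in> L" "Suc (card S) = d" for S
  proof -
    let ?A = "{a \<in> N - S. insert a S \<in> L}"
    have SN: "S \<subseteq> N" using S by (simp add: L_def)
    have "{b \<in> N' - \<psi> ` S. insert b (\<psi> ` S) \<in> L'} = \<psi> ` ?A"
    proof (intro equalityI subsetI)
      fix b assume b: "b \<in> {b \<in> N' - \<psi> ` S. insert b (\<psi> ` S) \<in> L'}"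
      then have "b \<in> \<psi> ` N" using L'N by blast
      then obtain a where "b = \<psi> a" "a \<in> N" by blast
      then show "b \<in> \<psi> ` ?A" using b SN by (auto simp: L_def)
    next
      fix b assume "b \<in> \<psi> ` ?A"
      then obtain a where a: "b = \<psi> a" "a \<in> N" "a \<notin> S" "insert a S \<in> L" by blast
      then have "b \<notin> \<psi> ` S" using N(2) SN by (auto dest: inj_onD)
      then show "b \<in> {b \<in> N' - \<psi> ` S. insert b (\<psi> ` S) \<in> L'}" using a N(3) by (auto simp: L_def)
    qed
    moreover have "card (\<psi> ` ?A) = card ?A" by (rule card) blast
    ultimately show ?thesis using D(9)[OF sub[OF S(1)]] cS[OF S(1)] S(2) by simp
  qed
  have e: "{} \<in> L" using D(3) by (simp add: L_def)
  have dim: "card T \<le> d" if "T \<in> L" for T using D(5)[OF sub[OF that]] cS[OF that] by simp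
  have dn: "S \<in> L" if "T \<in> L" "S \<subseteq> T" for S T
    using that D(4)[of "\<psi> ` T" "\<psi> ` S"] by (auto simp: L_def)
  have "homology_sphere N L d"
    unfolding homology_sphere_def
  proof (intro conjI ballI allI impI)
    show "L \<subseteq> Pow N" by (auto simp: L_def)
  qed (fact e | (rule dim; assumption) | (rule dn; assumption) | (rule tw; assumption)
      | (rule ex; assumption) | (rule un; assumption) | fact N(1))+
  then show ?thesis by (simp only: L_def)
qed

section \<open>Faces of cubes\<close>

lemma card_vface:
  assumes v: "v \<in> cube_verts n" and T: "T \<subseteq> {..<n}"
  shows "card (vface n v T) = 2 ^ card T"
proof -
  \<comment> \<open>A vertex of the face is given by the set of coordinates in which it differs from
    v.\<close>
  have "bij_betw (\<lambda>S i. if i \<in> S then \<not> v i else v i) (Pow T) (vface n v T)"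
  proof (rule bij_betwI[where g = "\<lambda>x. {i. x i \<noteq> v i}"])
    show "(\<lambda>S i. if i \<in> S then \<not> v i else v i) \<in> Pow T \<rightarrow> vface n v T"
      using v T by (fastforce simp: vface_def cube_verts_def)
    show "(\<lambda>x. {i. x i \<noteq> v i}) \<in> vface n v T \<rightarrow> Pow T"
      using v by (auto simp: vface_def cube_verts_def) (metis linorder_not_less)+
  qed auto
  then have "card (vface n v T) = card (Pow T)" by (simp add: bij_betw_same_card)
  also have "\<dots> = 2 ^ card T" using finite_subset[OF T] by (simp add: card_Pow)
  finally show ?thesis .
qed

lemma cube_face_eq_vface:
  assumes "X \<in> cube_faces n" "v \<in> X"
  obtains T where "T \<subseteq> {..<n}" "X = vface n v T" "v \<in> cube_verts n"
proof -
  obtain w where w: "X = cube_face n w" using assms(1) by (auto simp: cube_faces_def)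
  let ?T = "{i. i < n \<and> w i = None}"
  have "X = vface n v ?T"
  proof (intro equalityI subsetI)
    fix x assume x: "x \<in> X"
    have "x i = v i" if "i < n" "i \<notin> ?T" for i
    proof -
      obtain b where "w i = Some b" using \<open>i < n\<close> \<open>i \<notin> ?T\<close> by auto
      then show ?thesis using x assms(2) that(1) by (auto simp: w cube_face_def)
    qed
    then show "x \<in> vface n v ?T" using x by (auto simp: w cube_face_def vface_def)
  next
    fix x assume x: "x \<in> vface n v ?T"
    have "x i = b" if "i < n" "w i = Some b" for i b
    proof -
      have "x i = v i" using x that by (auto simp: vface_def)
      then show ?thesis using assms(2) that by (auto simp: w cube_face_def)
    qed
    then show "x \<in> X" using x by (auto simp: w cube_face_def vface_def)
  qed
  moreover have "v \<in> cube_verts n" using assms(2) by (simp add: w cube_face_def)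
  ultimately show ?thesis by (intro that[of ?T]) auto
qed

lemma vface_subset_imp:
  assumes "v \<in> cube_verts n" "S \<subseteq> {..<n}" "vface n v S \<subseteq> vface n v T"
  shows "S \<subseteq> T"
proof
  fix i assume i: "i \<in> S"
  then have "v(i := \<not> v i) \<in> vface n v S" using assms(1,2) by (auto simp: vface_def cube_verts_def)
  then have "v(i := \<not> v i) \<in> vface n v T" using assms(3) by blast
  moreover have "i < n" using i assms(2) by auto
  ultimately show "i \<in> T" by (force simp: vface_def)
qed

lemma vface_refl: "v \<in> cube_verts n \<Longrightarrow> v \<in> vface n v T"
  by (simp add: vface_def)

lemma vface_Int: "vface n v S \<inter> vface n v T = vface n v (S \<inter> T)"
  by (auto simp: vface_def)

lemma cube_face_nonempty: "Y \<in> cube_faces n \<Longrightarrow> Y \<noteq> {}"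
proof -
  assume "Y \<in> cube_faces n"
  then obtain w where w: "Y = cube_face n w" by (auto simp: cube_faces_def)
  have "(\<lambda>i. i < n \<and> w i = Some True) \<in> cube_face n w" by (auto simp: cube_face_def cube_verts_def)
  then show ?thesis using w by blast
qed

lemma card_cube_verts: "card (cube_verts n) = 2 ^ n"
proof -
  have eq: "vface n (\<lambda>_. False) {..<n} = cube_verts n" by (auto simp: vface_def)
  have "(\<lambda>_. False) \<in> cube_verts n" by (simp add: cube_verts_def)
  from card_vface[OF this subset_refl] show ?thesis by (simp add: eq)
qed

section \<open>The dimension of a face from the number of its vertices\<close>

definition minimals :: "'a set set \<Rightarrow> 'a set set" where
  "minimals A = {G \<in> A. \<forall>G'\<in>A. G' \<subseteq> G \<longrightarrow> G' = G}"

lemma minimals_eq_singletons: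
  assumes "\<And>G. G \<in> A \<Longrightarrow> G \<noteq> {} \<and> G \<subseteq> X" "\<And>x. x \<in> X \<Longrightarrow> {x} \<in> A"
  shows "minimals A = (\<lambda>x. {x}) ` X"
proof (intro equalityI subsetI)
  fix G assume G: "G \<in> minimals A"
  then have GA: "G \<in> A" by (simp add: minimals_def)
  then obtain x where x: "x \<in> G" "x \<in> X" using assms(1) by blast
  then have "{x} = G" using G assms(2) unfolding minimals_def by blast
  then show "G \<in> (\<lambda>x. {x}) ` X" using x(2) by blast
next
  fix G assume "G \<in> (\<lambda>x. {x}) ` X"
  then obtain x where x: "G = {x}" "x \<in> X" by blast
  have "G' = G" if "G' \<in> A" "G' \<subseteq> G" for G' using assms(1)[OF that(1)] that(2) x(1) by blast
  then show "G \<in> minimals A" using assms(2) x by (auto simp: minimals_def)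
qed

lemma image_minimals:
  assumes bij: "bij_betw h A B" and mono: "\<And>G G'. G \<in> A \<Longrightarrow> G' \<in> A \<Longrightarrow> G \<subseteq> G' \<longleftrightarrow> h G \<subseteq> h G'"
  shows "minimals B = h ` minimals A"
proof (intro equalityI subsetI)
  have hA: "h ` A = B" and inj: "inj_on h A" using bij unfolding bij_betw_def by blast+
  {
    fix Y assume Y: "Y \<in> minimals B"
    then have "Y \<in> h ` A" using hA by (simp add: minimals_def)
    then obtain G where G: "G \<in> A" "Y = h G" by (rule imageE) blast
    have "G' = G" if "G' \<in> A" "G' \<subseteq> G" for G'
    proof -
      have "h G' \<subseteq> h G" using mono[OF that(1) G(1)] that(2) by simp
      moreover have "h G' \<in> B" using hA that(1) by blast
      ultimately have "h G' = h G" using Y G(2) by (auto simp: minimals_def)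
      then show ?thesis using inj_onD[OF inj] that(1) G(1) by blast
    qed
    then show "Y \<in> h ` minimals A" using G unfolding minimals_def by blast
  next
    fix Y assume "Y \<in> h ` minimals A"
    then obtain G where G: "G \<in> minimals A" "Y = h G" by blast
    then have GA: "G \<in> A" by (simp add: minimals_def)
    have "Y' = Y" if Y': "Y' \<in> B" "Y' \<subseteq> Y" for Y'
    proof -
      have "Y' \<in> h ` A" using hA Y'(1) by simp
      then obtain G' where G': "G' \<in> A" "Y' = h G'" by (rule imageE) blast
      then have "G' \<subseteq> G" using mono[OF G'(1) GA] Y'(2) G(2) by simp
      then have "G' = G" using G(1) G'(1) unfolding minimals_def by blast
      then show ?thesis using G G' by simp
    qed
    then show "Y \<in> minimals B" using GA hA G(2) unfolding minimals_def by blast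
  }
qed

lemma singleton_in_cube_faces:
  assumes x: "x \<in> cube_verts n" shows "{x} \<in> cube_faces n"
proof -
  have "card (vface n x {}) = 1" using card_vface[OF x] by simp
  then have "vface n x {} = {x}" using vface_refl[OF x] by (metis card_1_singletonE singletonD)
  then show ?thesis using vface_in_cube_faces[of n x "{}"] by simp
qed

text \<open>A poset isomorphism preserves minimal elements, and on both sides these are the
  singletons, so X has as many vertices as the m-cube.\<close>

lemma card_face_if_face_poset_iso:
  assumes cc: "cubical_complex V F" and X: "X \<in> F" and iso: "face_poset_iso F X m"
  shows "card X = 2 ^ m"
proof -
  let ?A = "{G \<in> F. G \<subseteq> X}"
  obtain h where h: "bij_betw h ?A (cube_faces m)" and h0: "\<forall>G\<in>?A. \<forall>G'\<in>?A. G \<subseteq> G' \<longleftrightarrow> h G \<subseteq> h G'"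
    using iso unfolding face_poset_iso_def by (elim exE conjE)
  have F: "\<forall>X\<in>F. X \<noteq> {} \<and> X \<subseteq> V" using cc unfolding cubical_complex_def by (elim conjE)
  have V: "\<forall>v\<in>V. {v} \<in> F" using cc unfolding cubical_complex_def by (elim conjE)
  have 1: "minimals ?A = (\<lambda>x. {x}) ` X"
    by (rule minimals_eq_singletons) (use F V X in blast)+
  have 2: "minimals (cube_faces m) = (\<lambda>x. {x}) ` cube_verts m"
  proof (rule minimals_eq_singletons)
    fix G assume G: "G \<in> cube_faces m"
    then have "G \<subseteq> cube_verts m" by (auto simp: cube_faces_def cube_face_def)
    then show "G \<noteq> {} \<and> G \<subseteq> cube_verts m" using cube_face_nonempty[OF G] by simp
  qed (rule singleton_in_cube_faces)
  have "minimals (cube_faces m) = h ` minimals ?A"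
    by (rule image_minimals[OF h bspec[OF bspec[OF h0]]])
  moreover have "inj_on h (minimals ?A)"
    using h by (rule bij_betw_imp_inj_on[THEN inj_on_subset]) (auto simp: minimals_def)
  ultimately have "card (minimals (cube_faces m)) = card (minimals ?A)" by (simp add: card_image)
  then show ?thesis by (simp add: 1 2 card_image card_cube_verts)
qed

text \<open>Two cubes with equally many vertices have the same dimension, so the description in
  \<open>face_dim\<close> is unique. From here on dimension is expressed by cardinality, which
  bijections of vertices respect.\<close>

lemma card_face:
  assumes cc: "cubical_complex V F" and X: "X \<in> F"
  shows "card X = 2 ^ face_dim F X"
proof -
  obtain m where m: "face_poset_iso F X m" using cc X unfolding cubical_complex_def by blast
  have "m' = m" if "face_poset_iso F X m'" for m'
  proof -
    have "(2::nat) ^ m' = 2 ^ m"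
      using card_face_if_face_poset_iso[OF cc X that] card_face_if_face_poset_iso[OF cc X m] by simp
    then show ?thesis by simp
  qed
  then have "face_dim F X = m" unfolding face_dim_def using m by blast
  then show ?thesis using card_face_if_face_poset_iso[OF cc X m] by simp
qed


section \<open>Extending an isomorphism of skeleta\<close>

definition cube_manifold :: "nat \<Rightarrow> nat \<Rightarrow> (nat \<Rightarrow> bool) set set \<Rightarrow> bool" where
  "cube_manifold d n F \<longleftrightarrow> F \<subseteq> cube_faces n \<and>
     (\<forall>X\<in>F. \<forall>Y\<in>cube_faces n. Y \<subseteq> X \<longrightarrow> Y \<in> F) \<and>
     Z2_homology_manifold d (geom_real F) \<and> (\<forall>X\<in>F. card X \<le> 2 ^ d)"

lemma cube_manifoldD:
  assumes "cube_manifold d n F"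
  shows "F \<subseteq> cube_faces n" "X \<in> F \<Longrightarrow> Y \<in> cube_faces n \<Longrightarrow> Y \<subseteq> X \<Longrightarrow> Y \<in> F"
    "Z2_homology_manifold d (geom_real F)" "X \<in> F \<Longrightarrow> card X \<le> 2 ^ d"
  using assms unfolding cube_manifold_def by blast+

lemma cube_manifold_vertex:
  assumes "cube_manifold d n F" "v \<in> \<Union>F"
  shows "v \<in> cube_verts n" "{} \<in> dirs n F v"
proof -
  obtain X where X: "X \<in> F" "v \<in> X" using assms(2) by blast
  then obtain T where T: "X = vface n v T" "v \<in> cube_verts n"
    using cube_face_eq_vface cube_manifoldD(1)[OF assms(1)] by (metis subsetD)
  then show "v \<in> cube_verts n" by blast
  have "vface n v {} \<subseteq> X" unfolding T(1) by (rule vface_mono) simp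
  then show "{} \<in> dirs n F v"
    using cube_manifoldD(2)[OF assms(1) X(1) vface_in_cube_faces] by (simp add: dirs_def)
qed

lemma cube_manifold_sphere:
  assumes man: "cube_manifold d n F" and v: "v \<in> \<Union>F"
  shows "homology_sphere {..<n} (dirs n F v) d"
proof (rule homology_sphere_dirs)
  show "F \<subseteq> cube_faces n" "Z2_homology_manifold d (geom_real F)" "v \<in> cube_verts n"
    using cube_manifoldD[OF man] cube_manifold_vertex(1)[OF man v] by blast+
  show "Y \<in> F" if "X \<in> F" "Y \<in> cube_faces n" "Y \<subseteq> X" for X Y using cube_manifoldD(2)[OF man that] .
  show "vface n v {} \<in> F" using cube_manifold_vertex(2)[OF man v] by (simp add: dirs_def)
  fix T assume "T \<in> dirs n F v"
  then have "(2::nat) ^ card T \<le> 2 ^ d"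
    using cube_manifoldD(4)[OF man, of "vface n v T"] card_vface[OF cube_manifold_vertex(1)[OF man v], of T]
    by (simp add: dirs_def)
  then show "card T \<le> d" by simp
qed

lemma face_at_vertex:
  assumes man: "cube_manifold d n F" and X: "X \<in> F" "v \<in> X" and c: "card X = 2 ^ j"
  obtains T where "T \<in> dirs n F v" "X = vface n v T" "card T = j"
proof -
  obtain T where T: "T \<subseteq> {..<n}" "X = vface n v T" "v \<in> cube_verts n"
    using cube_face_eq_vface[of X n v] cube_manifoldD(1)[OF man] X by blast
  then have "(2::nat) ^ card T = 2 ^ j" using card_vface c by simp
  then have "card T = j" by simp
  then show ?thesis using T X(1) by (intro that[of T]) (auto simp: dirs_def)
qed

text \<open>Edges at v go to edges at the image of v, which gives a map \<open>\<psi>\<close> of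
  directions. A face of dimension at most j is determined by its edges at v, so
  \<open>\<psi>\<close> identifies the links of both vertices on simplices with at most j elements,
  and \<open>homology_sphere_skeleton_step\<close> supplies the simplex for X. The resulting face Y
  contains the images of all faces of X at v of dimension j, and these miss only the antipode
  u.\<close>

lemma face_of_link_transfer:
  fixes \<phi> :: "(nat \<Rightarrow> bool) \<Rightarrow> (nat \<Rightarrow> bool)"
  assumes man: "cube_manifold d n F" and man': "cube_manifold d m F'"
    and \<phi>: "bij_betw \<phi> (\<Union>F) (\<Union>F')"
    and skel: "\<And>X. X \<subseteq> \<Union>F \<Longrightarrow> card X \<le> 2 ^ j \<Longrightarrow> X \<in> F \<longleftrightarrow> \<phi> ` X \<in> F'"
    and j: "1 \<le> j" "d + 3 \<le> 2 * Suc j"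
    and X: "X \<in> F" "card X = 2 ^ Suc j" and v: "v \<in> X"
  shows "\<exists>Y u. Y \<in> F' \<and> card Y = 2 ^ Suc j \<and> u \<in> X \<and> u \<noteq> v \<and> \<phi> ` (X - {u}) \<subseteq> Y"
proof -
  let ?L = "dirs n F v" and ?v' = "\<phi> v"
  let ?L' = "dirs m F' ?v'"
  have inj: "inj_on \<phi> (\<Union>F)" and im: "\<phi> ` \<Union>F = \<Union>F'" using \<phi> by (auto simp: bij_betw_def)
  have vF: "v \<in> \<Union>F" using v X by blast
  then have vF': "?v' \<in> \<Union>F'" using im by blast
  have vc: "v \<in> cube_verts n" and v'c: "?v' \<in> cube_verts m"
    using cube_manifold_vertex(1)[OF man vF] cube_manifold_vertex(1)[OF man' vF'] by blast+
  have hs: "homology_sphere {..<n} ?L d" and hs': "homology_sphere {..<m} ?L' d"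
    using cube_manifold_sphere[OF man vF] cube_manifold_sphere[OF man' vF'] by blast+
  note D = homology_sphereD[OF hs] and D' = homology_sphereD[OF hs']
  have cardim: "card (\<phi> ` A) = card A" if "A \<subseteq> \<Union>F" for A
    using card_image inj_on_subset[OF inj that] by blast
  have Ln: "T \<subseteq> {..<n}" "vface n v T \<in> F" if "T \<in> ?L" for T using that by (auto simp: dirs_def)
  have L'm: "T \<subseteq> {..<m}" "vface m ?v' T \<in> F'" if "T \<in> ?L'" for T using that by (auto simp: dirs_def)
  have fwd: "\<exists>T'\<in>?L'. \<phi> ` vface n v T = vface m ?v' T' \<and> card T' = card T" if T: "T \<in> ?L" "card T \<le> j" for T
  proof -
    have sub: "vface n v T \<subseteq> \<Union>F" using Ln[OF T(1)] by blast
    have cT: "card (vface n v T) = 2 ^ card T" by (rule card_vface[OF vc Ln(1)[OF T(1)]])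
    then have "card (vface n v T) \<le> 2 ^ j" using T(2) by simp
    then have "\<phi> ` vface n v T \<in> F'" using skel[OF sub] Ln(2)[OF T(1)] by blast
    moreover have "?v' \<in> \<phi> ` vface n v T" using vface_refl[OF vc] by blast
    moreover have "card (\<phi> ` vface n v T) = 2 ^ card T" using cardim[OF sub] cT by simp
    ultimately obtain T' where "T' \<in> ?L'" "\<phi> ` vface n v T = vface m ?v' T'" "card T' = card T"
      by (rule face_at_vertex[OF man'])
    then show ?thesis by blast
  qed
  have bwd: "\<exists>T\<in>?L. \<phi> ` vface n v T = vface m ?v' T' \<and> card T = card T'" if T': "T' \<in> ?L'" "card T' \<le> j" for T'
  proof -
    let ?Y = "vface m ?v' T'"
    have "?Y \<subseteq> \<phi> ` \<Union>F" unfolding im using L'm(2)[OF T'(1)] by blast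
    then obtain A where A: "A \<subseteq> \<Union>F" "?Y = \<phi> ` A" by (auto simp: subset_image_iff)
    have cA: "card A = 2 ^ card T'"
      using cardim[OF A(1)] A(2) card_vface[OF v'c L'm(1)[OF T'(1)]] by simp
    then have "card A \<le> 2 ^ j" using T'(2) by simp
    then have AF: "A \<in> F" using skel[OF A(1)] A(2) L'm(2)[OF T'(1)] by simp
    have "?v' \<in> \<phi> ` A" using vface_refl[OF v'c, of T'] A(2) by simp
    then have "v \<in> A" using inj_on_image_mem_iff[OF inj vF A(1)] by blast
    then obtain T where "T \<in> ?L" "A = vface n v T" "card T = card T'" by (rule face_at_vertex[OF man AF _ cA])
    then show ?thesis using A(2) by auto
  qed
  \<comment> \<open>The directions of edges at v, on which both links will be placed.\<close>
  define N where "N = {c. {c} \<in> ?L}"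
  have Nn: "N \<subseteq> {..<n}" using Ln(1) by (auto simp: N_def)
  then have finN: "finite N" using finite_subset by blast
  have LN: "T \<subseteq> N" if "T \<in> ?L" for T using D(4)[OF that] by (auto simp: N_def)
  have "\<exists>c'. {c'} \<in> ?L' \<and> \<phi> ` vface n v {c} = vface m ?v' {c'}" if c: "c \<in> N" for c
  proof -
    obtain T' where T': "T' \<in> ?L'" "\<phi> ` vface n v {c} = vface m ?v' T'" "card T' = 1"
      using fwd[of "{c}"] c j by (auto simp: N_def)
    obtain c' where "T' = {c'}" using T'(3) by (rule card_1_singletonE)
    then show ?thesis using T' by blast
  qed
  then obtain \<psi> where \<psi>: "\<And>c. c \<in> N \<Longrightarrow> {\<psi> c} \<in> ?L'"
    "\<And>c. c \<in> N \<Longrightarrow> \<phi> ` vface n v {c} = vface m ?v' {\<psi> c}" by metis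
  have img_inj: "S = T" if ST: "S \<in> ?L" "T \<in> ?L" "\<phi> ` vface n v S = \<phi> ` vface n v T" for S T
  proof -
    have "vface n v S = vface n v T"
      using inj_on_image_eq_iff[OF inj] ST Ln by (meson Union_upper)
    then show ?thesis using vface_subset_imp[OF vc] Ln(1) ST(1,2) by (metis subset_antisym subset_refl)
  qed
  have inj\<psi>: "inj_on \<psi> N"
  proof (rule inj_onI)
    fix a b assume ab: "a \<in> N" "b \<in> N" "\<psi> a = \<psi> b"
    then have "\<phi> ` vface n v {a} = \<phi> ` vface n v {b}" using \<psi>(2) by simp
    then have "{a} = {b}" using img_inj ab unfolding N_def by blast
    then show "a = b" by simp
  qed
  have key: "\<phi> ` vface n v T = vface m ?v' (\<psi> ` T) \<and> \<psi> ` T \<in> ?L'" if T: "T \<in> ?L" "card T \<le> j" for T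
  proof -
    obtain T' where T': "T' \<in> ?L'" "\<phi> ` vface n v T = vface m ?v' T'" "card T' = card T" using fwd[OF T] by blast
    have "\<psi> c \<in> T'" if c: "c \<in> T" for c
    proof -
      have cN: "c \<in> N" using LN[OF T(1)] c by blast
      have "vface n v {c} \<subseteq> vface n v T" using c by (intro vface_mono) simp
      then have "vface m ?v' {\<psi> c} \<subseteq> vface m ?v' T'" unfolding \<psi>(2)[OF cN, symmetric] T'(2)[symmetric] by (rule image_mono)
      then have "{\<psi> c} \<subseteq> T'" using vface_subset_imp[OF v'c] L'm(1)[OF \<psi>(1)[OF cN]] by blast
      then show ?thesis by simp
    qed
    then have "\<psi> ` T \<subseteq> T'" by blast
    moreover have "card (\<psi> ` T) = card T'" using T'(3) card_image[OF inj_on_subset[OF inj\<psi> LN[OF T(1)]]] by simp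
    ultimately have "\<psi> ` T = T'" using card_subset_eq[OF D'(6)[OF T'(1)]] by simp
    then show ?thesis using T' by simp
  qed
  have \<psi>N: "\<psi> ` N \<subseteq> {..<m}" using \<psi>(1) L'm(1) by blast
  have vert: "b \<in> \<psi> ` N" if b: "{b} \<in> ?L'" for b
  proof -
    obtain T where T: "T \<in> ?L" "\<phi> ` vface n v T = vface m ?v' {b}" "card T = 1"
      using bwd[of "{b}"] b j by auto
    obtain c where c: "T = {c}" using T(3) by (rule card_1_singletonE)
    have "vface m ?v' {\<psi> c} = vface m ?v' {b}" using T c \<psi>(2)[of c] by (simp add: N_def)
    then have "{\<psi> c} \<subseteq> {b}" using vface_subset_imp[OF v'c] L'm(1)[OF \<psi>(1)] T(1) c
      by (metis N_def mem_Collect_eq subset_refl)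
    then show ?thesis using T(1) c by (auto simp: N_def)
  qed
  \<comment> \<open>Relabelling by \<open>id\<close> only shrinks the vertex set from all
    coordinates to N.\<close>
  have sph1: "homology_sphere N {T. T \<subseteq> N \<and> id ` T \<in> ?L} d"
    by (rule homology_sphere_relabel[OF hs finN]) (use Nn in \<open>auto simp: N_def\<close>)
  have sph2: "homology_sphere N {T. T \<subseteq> N \<and> \<psi> ` T \<in> ?L'} d"
    by (rule homology_sphere_relabel[OF hs' finN inj\<psi> \<psi>N vert])
  have agree: "T \<in> {T. T \<subseteq> N \<and> id ` T \<in> ?L} \<longleftrightarrow> T \<in> {T. T \<subseteq> N \<and> \<psi> ` T \<in> ?L'}" if "card T < Suc j" for T
  proof -
    have "T \<in> ?L" if TN: "T \<subseteq> N" "\<psi> ` T \<in> ?L'" "card T \<le> j" for T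
    proof -
      have "card (\<psi> ` T) \<le> j" using TN(3) card_image[OF inj_on_subset[OF inj\<psi> TN(1)]] by simp
      then obtain T0 where T0: "T0 \<in> ?L" "\<phi> ` vface n v T0 = vface m ?v' (\<psi> ` T)" "card T0 = card (\<psi> ` T)"
        using bwd[OF TN(2)] by blast
      have "vface m ?v' (\<psi> ` T0) = vface m ?v' (\<psi> ` T)" and mem: "\<psi> ` T0 \<in> ?L'"
        using key[OF T0(1)] T0 \<open>card (\<psi> ` T) \<le> j\<close> by auto
      then have "\<psi> ` T0 = \<psi> ` T"
        using vface_subset_imp[OF v'c] L'm(1)[OF mem] L'm(1)[OF TN(2)] by (metis subset_antisym subset_refl)
      then have "T0 = T" using inj_on_image_eq_iff[OF inj\<psi> LN[OF T0(1)] TN(1)] by blast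
      then show ?thesis using T0(1) by simp
    qed
    then show ?thesis using key[of T] LN[of T] that by auto
  qed
  obtain T where T: "T \<in> ?L" "X = vface n v T" "card T = Suc j" by (rule face_at_vertex[OF man X(1) v X(2)])
  have "T \<in> {T. T \<subseteq> N \<and> \<psi> ` T \<in> ?L'}"
    by (rule homology_sphere_skeleton_step[OF sph1 sph2 agree j(2)]) (use T LN in auto)
  then have \<psi>T: "\<psi> ` T \<in> ?L'" by blast
  let ?Y = "vface m ?v' (\<psi> ` T)"
  define u where "u = (\<lambda>i. if i \<in> T then \<not> v i else v i)"
  have "card (\<psi> ` T) = Suc j" using card_image[OF inj_on_subset[OF inj\<psi> LN[OF T(1)]]] T(3) by simp
  then have "card ?Y = 2 ^ Suc j" using card_vface[OF v'c L'm(1)[OF \<psi>T]] by simp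
  moreover have "u \<in> X" using vc Ln(1)[OF T(1)] by (auto simp: T(2) u_def vface_def cube_verts_def)
  moreover have "u \<noteq> v"
  proof
    assume uv: "u = v"
    obtain i where i: "i \<in> T" using T(3) by fastforce
    have "u i = (\<not> v i)" using i by (simp add: u_def)
    moreover have "u i = v i" using uv by simp
    ultimately have "v i = (\<not> v i)" by simp
    then show False by simp
  qed
  moreover have "\<phi> ` (X - {u}) \<subseteq> ?Y"
  proof
    fix y assume "y \<in> \<phi> ` (X - {u})"
    then obtain x where x: "x \<in> X" "x \<noteq> u" "y = \<phi> x" by blast
    \<comment> \<open>A vertex of X agreeing with v in no direction of T is the antipode u; any
      other lies in a face of X at v that omits a direction c in which it agrees with v.\<close>
    have "\<exists>c\<in>T. x c = v c"
    proof (rule ccontr)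
      assume "\<not> ?thesis"
      moreover have "x i = v i" if "i \<notin> T" for i
        using x(1) that vc by (cases "i < n") (auto simp: T(2) vface_def cube_verts_def)
      ultimately have "x = u" by (auto simp: u_def fun_eq_iff)
      then show False using x(2) by simp
    qed
    then obtain c where c: "c \<in> T" "x c = v c" by blast
    have "x \<in> vface n v (T - {c})" using x(1) c unfolding T(2) vface_def by auto
    moreover have "T - {c} \<in> ?L" by (rule D(4)[OF T(1)]) blast
    moreover have "card (T - {c}) \<le> j" using T(3) c(1) D(6)[OF T(1)] by simp
    ultimately have "y \<in> vface m ?v' (\<psi> ` (T - {c}))" using key x(3) by blast
    moreover have "vface m ?v' (\<psi> ` (T - {c})) \<subseteq> ?Y" by (rule vface_mono) blast
    ultimately show "y \<in> ?Y" by blast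
  qed
  ultimately show ?thesis using L'm(2)[OF \<psi>T] by blast
qed

text \<open>The faces found at a vertex and at its antipode share more than half of their vertices, so
  they coincide.\<close>

lemma face_transfer:
  fixes \<phi> :: "(nat \<Rightarrow> bool) \<Rightarrow> (nat \<Rightarrow> bool)"
  assumes man: "cube_manifold d n F" and man': "cube_manifold d m F'"
    and \<phi>: "bij_betw \<phi> (\<Union>F) (\<Union>F')"
    and skel: "\<And>X. X \<subseteq> \<Union>F \<Longrightarrow> card X \<le> 2 ^ j \<Longrightarrow> X \<in> F \<longleftrightarrow> \<phi> ` X \<in> F'"
    and j: "2 \<le> j" "d + 3 \<le> 2 * Suc j"
    and X: "X \<in> F" "card X = 2 ^ Suc j"
  shows "\<phi> ` X \<in> F'"
proof -
  note step = face_of_link_transfer[OF man man' \<phi> skel _ j(2) X]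
  have "X \<noteq> {}" using X(2) by auto
  then obtain v where v: "v \<in> X" by blast
  have j1: "1 \<le> j" using j by simp
  obtain Y u where Y: "Y \<in> F'" "card Y = 2 ^ Suc j" "u \<in> X" "\<phi> ` (X - {u}) \<subseteq> Y"
    using step[OF _ _ j1 v] by blast
  \<comment> \<open>Repeating the step at u yields a face containing the image of u, but possibly
    not that of some w other than u.\<close>
  obtain Y' w where Y': "Y' \<in> F'" "card Y' = 2 ^ Suc j" "w \<in> X" "w \<noteq> u" "\<phi> ` (X - {w}) \<subseteq> Y'"
    using step[OF _ _ j1 Y(3)] by blast
  have XF: "X \<subseteq> \<Union>F" using X by blast
  have injX: "inj_on \<phi> X" using \<phi> inj_on_subset[OF _ XF] by (auto simp: bij_betw_def)
  have finX: "finite X" using X(2) by (metis card.infinite power_not_zero zero_neq_numeral)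
  have fin: "finite Y" "finite Y'" using Y(2) Y'(2) by (metis card.infinite power_not_zero zero_neq_numeral)+
  have sub: "\<phi> ` (X - {u, w}) \<subseteq> Y \<inter> Y'" using Y(4) Y'(5) by blast
  have "card (X - {u, w}) = 2 ^ Suc j - 2" using Y(3) Y'(3,4) finX X(2) by (simp add: card_Diff_subset)
  then have "card (\<phi> ` (X - {u, w})) = 2 ^ Suc j - 2" using card_image inj_on_subset[OF injX Diff_subset] by metis
  then have big: "2 ^ Suc j - 2 \<le> card (Y \<inter> Y')" using card_mono[OF _ sub] fin by simp
  \<comment> \<open>For \<open>2 \<le> j\<close> this gives \<open>2 ^ Suc j - 2 > 2 ^ j\<close>. An
    intersection of two faces of the cube, if nonempty, has a power of two as its number of
    vertices, so here it must be all of both.\<close>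
  have j4: "(4::nat) \<le> 2 ^ j" using power_increasing[OF j(1), of "2::nat"] by simp
  then have "card (Y \<inter> Y') > 2 ^ j" using big by simp
  then have "Y \<inter> Y' \<noteq> {}" by auto
  then obtain x where x: "x \<in> Y" "x \<in> Y'" by blast
  obtain S where S: "S \<in> dirs m F' x" "Y = vface m x S" "card S = Suc j" by (rule face_at_vertex[OF man' Y(1) x(1) Y(2)])
  obtain S' where S': "S' \<in> dirs m F' x" "Y' = vface m x S'" "card S' = Suc j" by (rule face_at_vertex[OF man' Y'(1) x(2) Y'(2)])
  have xc: "x \<in> cube_verts m" using x Y(1) by (intro cube_manifold_vertex(1)[OF man']) blast
  have Sm: "S \<subseteq> {..<m}" "S' \<subseteq> {..<m}" using S(1) S'(1) by (auto simp: dirs_def)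
  then have finS: "finite S" "finite S'" using finite_subset by blast+
  have "S \<inter> S' \<subseteq> {..<m}" using Sm by blast
  then have "card (Y \<inter> Y') = 2 ^ card (S \<inter> S')"
    unfolding S(2) S'(2) vface_Int by (rule card_vface[OF xc])
  then have "(2::nat) ^ j < 2 ^ card (S \<inter> S')" using \<open>card (Y \<inter> Y') > 2 ^ j\<close> by simp
  then have "Suc j \<le> card (S \<inter> S')" by simp
  then have "S \<inter> S' = S" "S \<inter> S' = S'"
    using S(3) S'(3) finS card_seteq[of S "S \<inter> S'"] card_seteq[of S' "S \<inter> S'"] by auto
  then have "Y = Y'" using S(2) S'(2) by simp
  then have "\<phi> ` X \<subseteq> Y" using Y(4) Y'(4,5) by blast
  moreover have "card (\<phi> ` X) = card Y" using card_image[OF injX] X(2) Y(2) by simp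
  ultimately have "\<phi> ` X = Y" using card_subset_eq[OF fin(1)] by blast
  then show ?thesis using Y(1) by simp
qed

text \<open>Induction on the dimension, starting at k; the converse direction applies
  \<open>face_transfer\<close> to the inverse bijection. A set whose size lies strictly between two
  powers of 2 is a face on neither side.\<close>

lemma faces_determined_by_skeleton:
  fixes \<phi> :: "(nat \<Rightarrow> bool) \<Rightarrow> (nat \<Rightarrow> bool)"
  assumes d: "1 \<le> d"
    and man: "cube_manifold d n F" and man': "cube_manifold d m F'"
    and \<phi>: "bij_betw \<phi> (\<Union>F) (\<Union>F')"
    and skel: "\<And>X. X \<subseteq> \<Union>F \<Longrightarrow> card X \<le> 2 ^ (d div 2 + 1) \<Longrightarrow> X \<in> F \<longleftrightarrow> \<phi> ` X \<in> F'"
    and X: "X \<subseteq> \<Union>F"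
  shows "X \<in> F \<longleftrightarrow> \<phi> ` X \<in> F'"
proof -
  define k where "k = d div 2 + 1"
  have inj: "inj_on \<phi> (\<Union>F)" and im: "\<phi> ` \<Union>F = \<Union>F'" using \<phi> by (auto simp: bij_betw_def)
  have pow: "\<exists>i. card Y = 2 ^ i" if "Y \<in> F" "cube_manifold d n F" for Y F n
  proof -
    have Yc: "Y \<in> cube_faces n" using cube_manifoldD(1)[OF that(2)] that(1) by blast
    then obtain v where "v \<in> Y" using cube_face_nonempty by blast
    then obtain T where "T \<subseteq> {..<n}" "Y = vface n v T" "v \<in> cube_verts n" by (rule cube_face_eq_vface[OF Yc])
    then show ?thesis using card_vface by blast
  qed
  have P: "\<forall>X. X \<subseteq> \<Union>F \<longrightarrow> card X \<le> 2 ^ (k + i) \<longrightarrow> (X \<in> F \<longleftrightarrow> \<phi> ` X \<in> F')" for i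
  proof (induction i)
    case 0
    then show ?case using skel by (simp add: k_def)
  next
    case (Suc i)
    let ?j = "k + i"
    have IH: "\<And>X. X \<subseteq> \<Union>F \<Longrightarrow> card X \<le> 2 ^ ?j \<Longrightarrow> X \<in> F \<longleftrightarrow> \<phi> ` X \<in> F'" using Suc.IH by blast
    define \<theta> where "\<theta> = inv_into (\<Union>F) \<phi>"
    have \<theta>: "bij_betw \<theta> (\<Union>F') (\<Union>F)" unfolding \<theta>_def by (rule bij_betw_inv_into[OF \<phi>])
    have \<theta>im: "\<theta> ` (\<phi> ` A) = A" if "A \<subseteq> \<Union>F" for A
      unfolding \<theta>_def by (rule inv_into_image_cancel[OF inj that])
    have IH': "Y \<in> F' \<longleftrightarrow> \<theta> ` Y \<in> F" if Y: "Y \<subseteq> \<Union>F'" "card Y \<le> 2 ^ ?j" for Y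
    proof -
      obtain A where A: "A \<subseteq> \<Union>F" "Y = \<phi> ` A" using Y(1) im by (metis subset_image_iff)
      have "card A = card Y" using A card_image[OF inj_on_subset[OF inj A(1)]] by simp
      then show ?thesis using IH[OF A(1)] Y(2) A(2) \<theta>im[OF A(1)] by simp
    qed
    show ?case
    proof (intro allI impI)
      fix X assume X: "X \<subseteq> \<Union>F" "card X \<le> 2 ^ (k + Suc i)"
      have cX: "card (\<phi> ` X) = card X" using card_image[OF inj_on_subset[OF inj X(1)]] .
      show "X \<in> F \<longleftrightarrow> \<phi> ` X \<in> F'"
      proof (cases "card X \<le> 2 ^ ?j")
        case True
        then show ?thesis using IH[OF X(1)] by blast
      next
        case False
        have top: "card X = 2 ^ Suc ?j" if "card X = 2 ^ l" for l
        proof -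
          have "\<not> (2::nat) ^ l \<le> 2 ^ ?j" using that False by simp
          then have "\<not> l \<le> ?j" by (metis one_le_numeral power_increasing)
          moreover have "(2::nat) ^ l \<le> 2 ^ (k + Suc i)" using that X(2) by simp
          then have "l \<le> k + Suc i" by (rule power_le_imp_le_exp[rotated]) simp
          ultimately have "l = Suc ?j" by simp
          then show ?thesis using that by simp
        qed
        \<comment> \<open>The hypothesis \<open>2 \<le> ?j\<close> of \<open>face_transfer\<close>
          could fail only for d = 1, where k = 1; but then a face with \<open>2 ^ Suc ?j\<close>
          vertices would exceed dimension d.\<close>
        have arith: "2 \<le> ?j" "d + 3 \<le> 2 * Suc ?j" if "card X = 2 ^ Suc ?j" "card X \<le> 2 ^ d"
        proof -
          have "(2::nat) ^ Suc ?j \<le> 2 ^ d" using that by simp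
          then have "Suc ?j \<le> d" by (simp only: power_increasing_iff)
          then show "2 \<le> ?j" "d + 3 \<le> 2 * Suc ?j" using d unfolding k_def by presburger+
        qed
        show ?thesis
        proof
          assume XF: "X \<in> F"
          obtain l where "card X = 2 ^ l" using pow[OF XF man] by blast
          then have c: "card X = 2 ^ Suc ?j" by (rule top)
          show "\<phi> ` X \<in> F'"
            by (rule face_transfer[OF man man' \<phi> IH arith[OF c cube_manifoldD(4)[OF man XF]] XF c])
        next
          assume XF: "\<phi> ` X \<in> F'"
          obtain l where "card (\<phi> ` X) = 2 ^ l" using pow[OF XF man'] by blast
          then have c: "card (\<phi> ` X) = 2 ^ Suc ?j" using top cX by simp
          have "card X \<le> 2 ^ d" using cube_manifoldD(4)[OF man' XF] cX by simp
          moreover have "card X = 2 ^ Suc ?j" using c cX by simp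
          ultimately have a: "2 \<le> ?j" "d + 3 \<le> 2 * Suc ?j" using arith by blast+
          have "\<theta> ` (\<phi> ` X) \<in> F"
            by (rule face_transfer[OF man' man \<theta> IH' a XF c])
          then show "X \<in> F" using \<theta>im[OF X(1)] by simp
        qed
      qed
    qed
  qed
  \<comment> \<open>Every set is reached by the induction because
    \<open>card X < 2 ^ card X\<close>.\<close>
  have "card X \<le> 2 ^ (k + card X)"
    by (metis less_imp_le less_exp le_add2 one_le_numeral order_trans power_increasing)
  then show ?thesis using P X by blast
qed

lemma cube_manifold_of_embedding:
  assumes man: "cubical_homology_manifold d V F" and emb: "cube_embedding n f V F"
  shows "cube_manifold d n ((`) f ` F)" "inj_on f V" "\<Union>((`) f ` F) = f ` V"
proof -
  have cc: "cubical_complex V F" and dim: "complex_dim F = d"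
    and Z: "Z2_homology_manifold d (geom_real ((`) f ` F))"
    using man emb unfolding cubical_homology_manifold_def by blast+
  have sub: "cube_subcomplex n (f ` V) ((`) f ` F)" and iso: "cc_iso f V F (f ` V) ((`) f ` F)"
    using emb unfolding cube_embedding_def by blast+
  show inj: "inj_on f V" using iso unfolding cc_iso_def bij_betw_def by blast
  show "\<Union>((`) f ` F) = f ` V" using sub unfolding cube_subcomplex_def by simp
  have FV: "\<forall>X\<in>F. X \<noteq> {} \<and> X \<subseteq> V" using cc unfolding cubical_complex_def by (elim conjE)
  have "finite V" using cc unfolding cubical_complex_def by (elim conjE)
  then have finF: "finite F" using FV by (metis PowI finite_Pow_iff finite_subset subsetI)
  have "card X \<le> 2 ^ d" if X: "X \<in> (`) f ` F" for X
  proof -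
    obtain Y where Y: "Y \<in> F" "X = f ` Y" using X by blast
    have "card X = card Y" using Y FV card_image[OF inj_on_subset[OF inj]] by blast
    also have "\<dots> = 2 ^ face_dim F Y" by (rule card_face[OF cc Y(1)])
    also have "face_dim F Y \<le> d"
      using Max_ge[of "face_dim F ` F"] finF Y(1) dim unfolding complex_dim_def by auto
    then have "(2::nat) ^ face_dim F Y \<le> 2 ^ d" by simp
    finally show ?thesis .
  qed
  then have "\<forall>X\<in>(`) f ` F. card X \<le> 2 ^ d" by blast
  moreover have "(`) f ` F \<subseteq> cube_faces n"
    using sub unfolding cube_subcomplex_def by (elim conjE)
  moreover have "\<forall>X\<in>(`) f ` F. \<forall>Y\<in>cube_faces n. Y \<subseteq> X \<longrightarrow> Y \<in> (`) f ` F"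
    using sub unfolding cube_subcomplex_def by (elim conjE)
  ultimately show "cube_manifold d n ((`) f ` F)"
    using Z unfolding cube_manifold_def by (intro conjI)
qed

lemma mem_embedded_faces:
  assumes "inj_on f V" "\<And>X. X \<in> F \<Longrightarrow> X \<subseteq> V" "X \<subseteq> V"
  shows "f ` X \<in> (`) f ` F \<longleftrightarrow> X \<in> F"
proof
  assume "f ` X \<in> (`) f ` F"
  then obtain Y where Y: "Y \<in> F" "f ` X = f ` Y" by (rule imageE) simp
  then have "X = Y" using inj_on_image_eq_iff[OF assms(1,3) assms(2)[OF Y(1)]] by simp
  then show "X \<in> F" using Y(1) by simp
qed simp

lemma skel_faces_iff:
  assumes "cubical_complex V F"
  shows "X \<in> skel_faces k F \<longleftrightarrow> X \<in> F \<and> card X \<le> 2 ^ k"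
  using card_face[OF assms] by (auto simp: skel_faces_def)

theorem mainTheorem6:
  fixes d :: nat
    and VM :: "'a set" and FM :: "'a set set"
    and VN :: "'b set" and FN :: "'b set set"
  assumes "d \<ge> 1"
    and "cubical_homology_manifold d VM FM" and "cube_embeddable VM FM"
    and "cubical_homology_manifold d VN FN" and "cube_embeddable VN FN"
    and "cc_isomorphic VM (skel_faces (d div 2 + 1) FM) VN (skel_faces (d div 2 + 1) FN)"
  shows "cc_isomorphic VM FM VN FN"
proof -
  let ?k = "d div 2 + 1"
  obtain n f where f: "cube_embedding n f VM FM" using assms(3) unfolding cube_embeddable_def by blast
  obtain m g where g: "cube_embedding m g VN FN" using assms(5) unfolding cube_embeddable_def by blast
  note M = cube_manifold_of_embedding[OF assms(2) f] and N = cube_manifold_of_embedding[OF assms(4) g]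
  have ccM: "cubical_complex VM FM" and ccN: "cubical_complex VN FN"
    using assms(2,4) unfolding cubical_homology_manifold_def by blast+
  have subM: "X \<subseteq> VM" if "X \<in> FM" for X using ccM that unfolding cubical_complex_def by blast
  have subN: "X \<subseteq> VN" if "X \<in> FN" for X using ccN that unfolding cubical_complex_def by blast
  obtain h where h: "cc_iso h VM (skel_faces ?k FM) VN (skel_faces ?k FN)"
    using assms(6) unfolding cc_isomorphic_def by blast
  then have bij: "bij_betw h VM VN" unfolding cc_iso_def by blast
  then have injh: "inj_on h VM" and imh: "h ` VM = VN" by (auto simp: bij_betw_def)
  have skel: "X \<in> FM \<longleftrightarrow> h ` X \<in> FN" if X: "X \<subseteq> VM" "card X \<le> 2 ^ ?k" for X
  proof
    assume "X \<in> FM"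
    then have "X \<in> skel_faces ?k FM" using skel_faces_iff[OF ccM] X by blast
    then have "h ` X \<in> skel_faces ?k FN" using h unfolding cc_iso_def by blast
    then show "h ` X \<in> FN" by (simp add: skel_faces_def)
  next
    assume "h ` X \<in> FN"
    moreover have "card (h ` X) \<le> 2 ^ ?k" using card_image[OF inj_on_subset[OF injh X(1)]] X(2) by simp
    ultimately have "h ` X \<in> skel_faces ?k FN" using skel_faces_iff[OF ccN] by blast
    then obtain X' where X': "X' \<in> skel_faces ?k FM" "h ` X' = h ` X" using h unfolding cc_iso_def by blast
    then have "X' \<in> FM" by (simp add: skel_faces_def)
    then have "X' = X" using inj_on_image_eq_iff[OF injh subM X(1)] X'(2) by blast
    then show "X \<in> FM" using \<open>X' \<in> FM\<close> by simp
  qed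
  \<comment> \<open>The given bijection h, read in the cube models of both complexes.\<close>
  define \<phi> where "\<phi> = g \<circ> h \<circ> inv_into VM f"
  have \<phi>f: "\<phi> ` f ` X = g ` h ` X" if "X \<subseteq> VM" for X
  proof -
    have "inv_into VM f ` f ` X = X" by (rule inv_into_image_cancel[OF M(2) that])
    moreover have "\<phi> ` f ` X = g ` h ` inv_into VM f ` f ` X"
      unfolding \<phi>_def by (simp only: image_comp o_assoc)
    ultimately show ?thesis by simp
  qed
  have "bij_betw (inv_into VM f) (f ` VM) VM" using M(2) by (simp add: bij_betw_inv_into inj_on_imp_bij_betw)
  from bij_betw_trans[OF bij_betw_trans[OF this bij] inj_on_imp_bij_betw[OF N(2)]]
  have \<phi>: "bij_betw \<phi> (\<Union>((`) f ` FM)) (\<Union>((`) g ` FN))"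
    unfolding \<phi>_def M(3) N(3) by (simp only: o_assoc)
  have hN: "h ` X \<subseteq> VN" if "X \<subseteq> VM" for X using imh that by blast
  have transfer: "(f ` X \<in> (`) f ` FM \<longleftrightarrow> \<phi> ` f ` X \<in> (`) g ` FN) \<longleftrightarrow> (X \<in> FM \<longleftrightarrow> h ` X \<in> FN)" if X: "X \<subseteq> VM" for X
    using mem_embedded_faces[OF M(2) subM X] mem_embedded_faces[OF N(2) subN hN[OF X]] \<phi>f[OF X] by simp
  have skel': "X' \<in> (`) f ` FM \<longleftrightarrow> \<phi> ` X' \<in> (`) g ` FN"
    if X': "X' \<subseteq> \<Union>((`) f ` FM)" "card X' \<le> 2 ^ ?k" for X'
  proof -
    obtain X where X: "X \<subseteq> VM" "X' = f ` X" using X'(1) unfolding M(3) by (auto simp: subset_image_iff)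
    have "card X = card X'" using card_image[OF inj_on_subset[OF M(2) X(1)]] X(2) by simp
    then show ?thesis using transfer[OF X(1)] skel[OF X(1)] X'(2) X(2) by simp
  qed
  have faces: "X \<in> FM \<longleftrightarrow> h ` X \<in> FN" if X: "X \<subseteq> VM" for X
  proof -
    have sub: "f ` X \<subseteq> \<Union>((`) f ` FM)" unfolding M(3) using X by blast
    have "f ` X \<in> (`) f ` FM \<longleftrightarrow> \<phi> ` f ` X \<in> (`) g ` FN"
      by (rule faces_determined_by_skeleton[OF assms(1) M(1) N(1) \<phi> _ sub]) (rule skel'; assumption)
    with transfer[OF X] show ?thesis by blast
  qed
  \<comment> \<open>The isomorphism of the skeleta is itself the isomorphism wanted.\<close>
  have "cc_iso h VM FM VN FN"
    unfolding cc_iso_def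
  proof (intro conjI ballI)
    show "h ` X \<in> FN" if "X \<in> FM" for X using faces[OF subM[OF that]] that by blast
    fix Y assume Y: "Y \<in> FN"
    then obtain X where X: "X \<subseteq> VM" "Y = h ` X" using subN imh by (metis subset_image_iff)
    then show "\<exists>X\<in>FM. h ` X = Y" using faces[OF X(1)] Y by blast
  qed (rule bij)
  then show ?thesis unfolding cc_isomorphic_def by blast
qed

end
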